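(* In a quantum VOA $(V,Y,T,\Omega,\mathcal S)$ the following associativity identity holds: $$Y(z)(1\otimes Y(w))=Y(w)(Y(z-w)\otimes 1).$$ This is understood as follows: on the left hand side $Y(z)$ is decomposed as $\sum_m Y^{(m)}(z-w)w^m/m!$, and then the equality holds in $\mathrm{Hom}(V\otimes V\otimes V,\,V[[w,w^{-1},z-w,(z-w)^{-1}]])$ modulo any given power of $h$ after multiplication by a suitable power of $z$.
   Context: $k$ is a field of characteristic $0$, $h$ a formal parameter, tensor products are $h$-adically completed. For a topologically free $k[[h]]$-module $V$, $V((z))=\{\sum_{n\in\mathbb Z}v_nz^n:\ v_n\to0\ h\text{-adically as }n\to-\infty\}$. Superscripts indicate tensor factors on which an operator acts; $\mathcal S^{21}=\sigma\mathcal S\sigma$ with $\sigma$ the flip. A braided VOA over $k[[h]]$ is: a topologically free $k[[h]]$-module $V$; a linear map $Y:V\otimes V\to V((z))$, $\mathbf v\otimes\mathbf w\mapsto Y(z)(\mathbf v\otimes\mathbf w)=Y(\mathbf v,z)\mathbf w$; a linear operator $T:V\to V$; a vector $\Omega\in V$; a linear map $\mathcal S(z):V\otimes V\to V\otimes V\otimes k((z))$ with $\mathcal S=1+O(h)$, satisfying the shift condition $[T\otimes1,\mathcal S(z)]=-\frac{d\mathcal S}{dz}$, the quantum Yang–Baxter equation $\mathcal S^{12}(z)\mathcal S^{13}(z+w)\mathcal S^{23}(w)=\mathcal S^{23}(w)\mathcal S^{13}(z+w)\mathcal S^{12}(z)$ and unitarity $\mathcal S^{21}(z)=\mathcal S^{-1}(-z)$;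 subject to: (QA1) for any $\mathbf v,\mathbf w\in V$ and any natural $M$ there is $N\ge0$ such that for any $\mathbf u\in V$, $(z_1-z_2)^NY(z_1)(1\otimes Y(z_2))(\mathcal S(z_1-z_2)(\mathbf v\otimes\mathbf w)\otimes\mathbf u)$ coincides with $(z_1-z_2)^NY(z_2)(1\otimes Y(z_1))(\mathbf w\otimes\mathbf v\otimes\mathbf u)$ modulo $h^M$; (QA2) $T\Omega=0$ and $\frac{d}{dz}Y(z)=TY(z)-Y(z)(1\otimes T)$; (QA3) $Y(z)(\Omega\otimes\mathbf v)=\mathbf v$ for all $\mathbf v$; $Y(z)(\mathbf v\otimes\Omega)$ is regular at $z=0$ and its value there is $\mathbf v$. A quantum VOA is a braided VOA satisfying the hexagon relation (QA4) $\mathcal S(w)(Y(u)\otimes1)=(Y(u)\otimes1)\mathcal S^{23}(w)\mathcal S^{13}(u+w)$ (matrix elements of the two sides coincide in $k((w))((u))[[h]]$). *)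

theory Defs
  imports "HOL-Library.Poly_Mapping" "HOL-Computational_Algebra.Formal_Laurent_Series"
begin

section \<open>Topologically free modules over k[[h]]\<close>

text \<open>
  The ring k[[h]] is \<^typ>\<open>'k fps\<close>, so h is \<^const>\<open>fps_X\<close>.  A k-vector space with basis 'b is
  \<^typ>\<open>'b \<Rightarrow>\<^sub>0 'k\<close>, and the type below is V0[[h]] for V0 with basis 'b; the standard topologically
  free module.
\<close>

type_synonym ('b, 'k) cfree = "('b \<Rightarrow>\<^sub>0 'k) fps"

definition cscale :: "'k::comm_ring_1 fps \<Rightarrow> ('b, 'k) cfree \<Rightarrow> ('b, 'k) cfree" where
  "cscale c t = Abs_fps (\<lambda>n. \<Sum>m\<le>n. Poly_Mapping.map ((*) (fps_nth c m)) (fps_nth t (n - m)))"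

definition cbasis :: "'b \<Rightarrow> ('b, 'k::comm_ring_1) cfree" where
  "cbasis b = fps_const (Poly_Mapping.single b 1)"

text \<open>
  The k[[h]]-linear map sending the basis element b to F b.
  All k[[h]]-linear maps between these modules are h-adically continuous, hence arise in this way.
\<close>

definition clift :: "('b \<Rightarrow> ('c, 'k) cfree) \<Rightarrow> ('b, 'k::comm_ring_1) cfree \<Rightarrow> ('c, 'k) cfree" where
  "clift F t = Abs_fps (\<lambda>n. \<Sum>m\<le>n. \<Sum>b\<in>Poly_Mapping.keys (fps_nth t m).
      Poly_Mapping.map ((*) (Poly_Mapping.lookup (fps_nth t m) b)) (fps_nth (F b) (n - m)))"

definition hdvd :: "('k::comm_ring_1 fps \<Rightarrow> 'm::ab_group_add \<Rightarrow> 'm) \<Rightarrow> nat \<Rightarrow> 'm \<Rightarrow> bool" where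
  "hdvd scale M x \<longleftrightarrow> (\<exists>y. x = scale (fps_X ^ M) y)"

definition hcong :: "('k::comm_ring_1 fps \<Rightarrow> 'm::ab_group_add \<Rightarrow> 'm) \<Rightarrow> nat \<Rightarrow> 'm \<Rightarrow> 'm \<Rightarrow> bool" where
  "hcong scale M x y \<longleftrightarrow> hdvd scale M (x - y)"

text \<open>
  Unconditional h-adic summation.  Every infinite sum below is one coefficient of a
  product of formal series; modulo each power of h only finitely many of its terms are nonzero.
\<close>

definition has_hsum ::
  "('k::comm_ring_1 fps \<Rightarrow> 'm::ab_group_add \<Rightarrow> 'm) \<Rightarrow> ('i \<Rightarrow> 'm) \<Rightarrow> 'm \<Rightarrow> bool" where
  "has_hsum scale f x \<longleftrightarrow>
     (\<forall>M. \<exists>F. finite F \<and> (\<forall>G. finite G \<and> F \<subseteq> G \<longrightarrow> hcong scale M (sum f G) x))"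

definition hsum :: "('k::comm_ring_1 fps \<Rightarrow> 'm::ab_group_add \<Rightarrow> 'm) \<Rightarrow> ('i \<Rightarrow> 'm) \<Rightarrow> 'm" where
  "hsum scale f = (THE x. has_hsum scale f x)"

text \<open>
  A topologically free module is an arbitrary k[[h]]-module 'v with an isomorphism \<phi> to some V0[[h]].
  The choice of \<phi> is used only to have concrete carriers for the completed tensor powers:
  V \<otimes> V = (V0 \<otimes> V0)[[h]] is the type \<^typ>\<open>('b \<times> 'b, 'k) cfree\<close> and V \<otimes> V \<otimes> V is the
  type \<^typ>\<open>('b \<times> 'b \<times> 'b, 'k) cfree\<close>.
\<close>

locale topologically_free = module scale
  for scale :: "'k::field_char_0 fps \<Rightarrow> 'v::ab_group_add \<Rightarrow> 'v" +
  fixes \<phi> :: "'v \<Rightarrow> ('b, 'k) cfree"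
  assumes linear_\<phi>: "module_hom scale cscale \<phi>"
    and bij_\<phi>: "bij \<phi>"

section \<open>Formal series\<close>

text \<open>
  A formal series in z and 1/z with coefficients in a module is the function
  taking an integer n to the coefficient of \<open>z^n\<close>; with two variables there are two arguments.
  The predicate \<open>laurent\<close> cuts out V((z)).
\<close>

definition laurent :: "('k::comm_ring_1 fps \<Rightarrow> 'm::ab_group_add \<Rightarrow> 'm) \<Rightarrow> (int \<Rightarrow> 'm) \<Rightarrow> bool" where
  "laurent scale f \<longleftrightarrow> (\<forall>M. \<exists>N. \<forall>n<N. hdvd scale M (f n))"

text \<open>
  Membership in the completed tensor product of a module with k((z)): modulo each power of h,
  a finite sum of products of a vector and an element of k((z)).  This is smaller than V((z)).
\<close>

definition tensor_laurent ::
  "('k::comm_ring_1 fps \<Rightarrow> 'm::ab_group_add \<Rightarrow> 'm) \<Rightarrow> (int \<Rightarrow> 'm) \<Rightarrow> bool" where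
  "tensor_laurent scale f \<longleftrightarrow>
     (\<forall>M. \<exists>(r::nat) (x::nat \<Rightarrow> 'm) (g::nat \<Rightarrow> 'k fls).
        \<forall>n. hcong scale M (f n) (\<Sum>i<r. scale (fps_const (fls_nth (g i) n)) (x i)))"

definition dz :: "('k::comm_ring_1 fps \<Rightarrow> 'm \<Rightarrow> 'm) \<Rightarrow> (int \<Rightarrow> 'm) \<Rightarrow> int \<Rightarrow> 'm" where
  "dz scale f n = scale (of_int (n + 1)) (f (n + 1))"

text \<open>
  The coefficient of \<open>x^i y^j\<close> in \<open>(x + c y)^(i + j)\<close>, expanded in nonnegative powers of y.
\<close>

definition binc :: "'k::field_char_0 \<Rightarrow> int \<Rightarrow> nat \<Rightarrow> 'k fps" where
  "binc c i j = fps_const ((of_int (i + int j) gchoose j) * c ^ j)"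

text \<open>Multiplication of a series in x and y by \<open>(x + c y)^N\<close>.\<close>

definition binmult :: "('k::field_char_0 fps \<Rightarrow> 'm::ab_group_add \<Rightarrow> 'm) \<Rightarrow> 'k \<Rightarrow> nat \<Rightarrow>
    (int \<Rightarrow> int \<Rightarrow> 'm) \<Rightarrow> int \<Rightarrow> int \<Rightarrow> 'm" where
  "binmult scale c N A p q =
     (\<Sum>k\<le>N. scale (fps_const (of_nat (N choose k) * c ^ k)) (A (p - int (N - k)) (q - int k)))"

section \<open>Operators on tensor factors\<close>

definition vbasis :: "('v \<Rightarrow> ('b, 'k::comm_ring_1) cfree) \<Rightarrow> 'b \<Rightarrow> 'v" where
  "vbasis \<phi> b = inv \<phi> (cbasis b)"

definition tens2 ::
  "('v \<Rightarrow> ('b, 'k::comm_ring_1) cfree) \<Rightarrow> 'v \<Rightarrow> 'v \<Rightarrow> ('b \<times> 'b, 'k) cfree" where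
  "tens2 \<phi> v w = clift (\<lambda>a. clift (\<lambda>b. cbasis (a, b)) (\<phi> w)) (\<phi> v)"

definition tens3 ::
  "('v \<Rightarrow> ('b, 'k::comm_ring_1) cfree) \<Rightarrow> 'v \<Rightarrow> 'v \<Rightarrow> 'v \<Rightarrow> ('b \<times> 'b \<times> 'b, 'k) cfree" where
  "tens3 \<phi> v w u =
     clift (\<lambda>a. clift (\<lambda>b. clift (\<lambda>c. cbasis (a, b, c)) (\<phi> u)) (\<phi> w)) (\<phi> v)"

definition op12 :: "(('b \<times> 'b, 'k::comm_ring_1) cfree \<Rightarrow> ('b \<times> 'b, 'k) cfree) \<Rightarrow>
    ('b \<times> 'b \<times> 'b, 'k) cfree \<Rightarrow> ('b \<times> 'b \<times> 'b, 'k) cfree" where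
  "op12 F = clift (\<lambda>(a, b, c). clift (\<lambda>(a', b'). cbasis (a', b', c)) (F (cbasis (a, b))))"

definition op13 :: "(('b \<times> 'b, 'k::comm_ring_1) cfree \<Rightarrow> ('b \<times> 'b, 'k) cfree) \<Rightarrow>
    ('b \<times> 'b \<times> 'b, 'k) cfree \<Rightarrow> ('b \<times> 'b \<times> 'b, 'k) cfree" where
  "op13 F = clift (\<lambda>(a, b, c). clift (\<lambda>(a', c'). cbasis (a', b, c')) (F (cbasis (a, c))))"

definition op23 :: "(('b \<times> 'b, 'k::comm_ring_1) cfree \<Rightarrow> ('b \<times> 'b, 'k) cfree) \<Rightarrow>
    ('b \<times> 'b \<times> 'b, 'k) cfree \<Rightarrow> ('b \<times> 'b \<times> 'b, 'k) cfree" where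
  "op23 F = clift (\<lambda>(a, b, c). clift (\<lambda>(b', c'). cbasis (a, b', c')) (F (cbasis (b, c))))"

definition flip :: "('b \<times> 'b, 'k::comm_ring_1) cfree \<Rightarrow> ('b \<times> 'b, 'k) cfree" where
  "flip = clift (\<lambda>(a, b). cbasis (b, a))"

definition T_left :: "('v \<Rightarrow> ('b, 'k::comm_ring_1) cfree) \<Rightarrow> ('v \<Rightarrow> 'v) \<Rightarrow>
    ('b \<times> 'b, 'k) cfree \<Rightarrow> ('b \<times> 'b, 'k) cfree" where
  "T_left \<phi> T = clift (\<lambda>(a, b). tens2 \<phi> (T (vbasis \<phi> a)) (vbasis \<phi> b))"

definition T_right :: "('v \<Rightarrow> ('b, 'k::comm_ring_1) cfree) \<Rightarrow> ('v \<Rightarrow> 'v) \<Rightarrow>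
    ('b \<times> 'b, 'k) cfree \<Rightarrow> ('b \<times> 'b, 'k) cfree" where
  "T_right \<phi> T = clift (\<lambda>(a, b). tens2 \<phi> (vbasis \<phi> a) (T (vbasis \<phi> b)))"

text \<open>The coefficients of \<open>z^n\<close> in \<open>Y(z) \<otimes> 1\<close> and \<open>1 \<otimes> Y(z)\<close>, from \<open>V \<otimes> V \<otimes> V\<close> to \<open>V \<otimes> V\<close>.\<close>

definition Y_left :: "('v \<Rightarrow> ('b, 'k::comm_ring_1) cfree) \<Rightarrow>
    (('b \<times> 'b, 'k) cfree \<Rightarrow> int \<Rightarrow> 'v) \<Rightarrow> int \<Rightarrow> ('b \<times> 'b \<times> 'b, 'k) cfree \<Rightarrow> ('b \<times> 'b, 'k) cfree" where
  "Y_left \<phi> Y n = clift (\<lambda>(a, b, c). tens2 \<phi> (Y (cbasis (a, b)) n) (vbasis \<phi> c))"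

definition Y_right :: "('v \<Rightarrow> ('b, 'k::comm_ring_1) cfree) \<Rightarrow>
    (('b \<times> 'b, 'k) cfree \<Rightarrow> int \<Rightarrow> 'v) \<Rightarrow> int \<Rightarrow> ('b \<times> 'b \<times> 'b, 'k) cfree \<Rightarrow> ('b \<times> 'b, 'k) cfree" where
  "Y_right \<phi> Y n = clift (\<lambda>(a, b, c). tens2 \<phi> (vbasis \<phi> a) (Y (cbasis (b, c)) n))"

section \<open>Braided and quantum vertex operator algebras\<close>

text \<open>
  \<open>Y t n\<close> and \<open>S t n\<close> are the coefficients of \<open>z^n\<close> in \<open>Y(z) t\<close> and \<open>S(z) t\<close>.
  In the quantum Yang-Baxter equation \<open>S(z + w)\<close> is expanded in nonnegative powers of w, and in (QA1)
  \<open>S(z1 - z2)\<close> is expanded in nonnegative powers of z2.  Neither choice matters: modulo a power of h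
  and on a given vector the Yang-Baxter equation lives in a finite-rank module over
  \<open>k[[z,w]][1/z,1/w,1/(z+w)]\<close>, and for large N the factor \<open>(z1 - z2)^N\<close> cancels the pole of S.
\<close>

locale braided_voa = topologically_free scale \<phi>
  for scale :: "'k::field_char_0 fps \<Rightarrow> 'v::ab_group_add \<Rightarrow> 'v"
    and \<phi> :: "'v \<Rightarrow> ('b, 'k) cfree" +
  fixes Y :: "('b \<times> 'b, 'k) cfree \<Rightarrow> int \<Rightarrow> 'v"
    and T :: "'v \<Rightarrow> 'v"
    and \<Omega> :: 'v
    and S :: "('b \<times> 'b, 'k) cfree \<Rightarrow> int \<Rightarrow> ('b \<times> 'b, 'k) cfree"
  assumes Y_linear: "module_hom cscale scale (\<lambda>t. Y t n)"
    and Y_laurent: "laurent scale (Y t)"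
    and T_linear: "module_hom scale scale T"
    and S_linear: "module_hom cscale cscale (\<lambda>t. S t n)"
    and S_laurent: "tensor_laurent cscale (S t)"
    and S_mod_h: "hcong cscale 1 (S t n) (if n = 0 then t else 0)"
    and shift: "T_left \<phi> T (S t n) - S (T_left \<phi> T t) n = - dz cscale (S t) n"
    and yang_baxter:
      "hsum cscale (\<lambda>(i, j). cscale (binc 1 i j)
          (op12 (\<lambda>s. S s (p - i)) (op13 (\<lambda>s. S s (i + int j)) (op23 (\<lambda>s. S s (q - int j)) x))))
       = hsum cscale (\<lambda>(i, j). cscale (binc 1 i j)
          (op23 (\<lambda>s. S s (q - int j)) (op13 (\<lambda>s. S s (i + int j)) (op12 (\<lambda>s. S s (p - i)) x))))"
    and unitarity_left:
      "hsum cscale (\<lambda>i. cscale (fps_const ((-1) powi i)) (flip (S (flip (S t i)) (n - i))))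
       = (if n = 0 then t else 0)"
    and unitarity_right:
      "hsum cscale (\<lambda>i. cscale (fps_const ((-1) powi i)) (S (flip (S (flip t) (n - i))) i))
       = (if n = 0 then t else 0)"
    and QA1:
      "\<exists>N. \<forall>u p q. hcong scale M
         (binmult scale (-1) N
            (\<lambda>p q. hsum scale (\<lambda>(i, j). scale (binc (-1) i j)
               (Y (Y_right \<phi> Y (q - int j) (op12 (\<lambda>s. S s (i + int j)) (tens3 \<phi> v w u))) (p - i))))
            p q)
         (binmult scale (-1) N
            (\<lambda>p q. Y (Y_right \<phi> Y p (tens3 \<phi> w v u)) q)
            p q)"
    and QA2_vacuum: "T \<Omega> = 0"
    and QA2_derivative: "dz scale (Y t) n = T (Y t n) - Y (T_right \<phi> T t) n"
    and QA3_left: "Y (tens2 \<phi> \<Omega> v) n = (if n = 0 then v else 0)"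
    and QA3_regular: "n < 0 \<Longrightarrow> Y (tens2 \<phi> v \<Omega>) n = 0"
    and QA3_value: "Y (tens2 \<phi> v \<Omega>) 0 = v"

text \<open>
  The hexagon relation compares coefficients of \<open>u^p w^q\<close> in \<open>k((w))((u))[[h]]\<close>, so \<open>S(u + w)\<close> is
  expanded in nonnegative powers of u.
\<close>

locale quantum_voa = braided_voa scale \<phi> Y T \<Omega> S
  for scale :: "'k::field_char_0 fps \<Rightarrow> 'v::ab_group_add \<Rightarrow> 'v"
    and \<phi> :: "'v \<Rightarrow> ('b, 'k) cfree"
    and Y :: "('b \<times> 'b, 'k) cfree \<Rightarrow> int \<Rightarrow> 'v"
    and T :: "'v \<Rightarrow> 'v"
    and \<Omega> :: 'v
    and S :: "('b \<times> 'b, 'k) cfree \<Rightarrow> int \<Rightarrow> ('b \<times> 'b, 'k) cfree" +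
  assumes QA4:
    "S (Y_left \<phi> Y p x) q =
       hsum cscale (\<lambda>(j, i). cscale (binc 1 j i)
         (Y_left \<phi> Y (p - int i) (op23 (\<lambda>s. S s (q - j)) (op13 (\<lambda>s. S s (j + int i)) x))))"

end

theory Submission
  imports Defs
begin

text \<open>
  Write \<open>A = Y(x + w)(1 \<otimes> Y(w))\<close>, expanded in nonnegative powers of \<open>w\<close>, and
  \<open>B = Y(w)(Y(x) \<otimes> 1)\<close>, and let \<open>\<sigma>\<close> be the flip.  Identities between \<open>A\<close> and \<open>B\<close> are modulo a power
  of \<open>h\<close>, on a fixed vector, and after multiplication by a power of \<open>z = x + w\<close>.

  The first ingredient is the skew symmetry \<open>Y(z) S(z) = e^{zT} Y(-z) \<sigma>\<close> (\<open>skew_symmetry\<close>).  It comes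
  from the locality axiom \<open>QA1\<close> with the vacuum as third vector: there \<open>1 \<otimes> Y(z\<^sub>2)\<close> becomes
  \<open>1 \<otimes> e^{z\<^sub>2 T}\<close>, the braided side contains only nonnegative powers of \<open>z\<^sub>2\<close>, and the coefficient of
  \<open>z\<^sub>2^0\<close> of both sides is the assertion, multiplied by \<open>z\<^sub>1^N\<close>.

  The second ingredient is that \<open>A\<close> and \<open>B\<close> agree after both have been composed with
  \<open>S^{23}(w) S^{13}(x + w)\<close> (\<open>braided_associativity\<close>).  For \<open>B\<close>, the hexagon relation moves the two
  braidings across \<open>Y(x) \<otimes> 1\<close>, where they become \<open>S(w)\<close>, and skew symmetry gives
  \<open>e^{wT} Y(-w) \<sigma> (Y(x) \<otimes> 1)\<close>, that is, \<open>e^{wT} Y(-w)(1 \<otimes> Y(x))\<close> on the cyclically permuted vector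
  \<open>c \<otimes> a \<otimes> b\<close>.  For \<open>A\<close>, skew symmetry in the last two factors absorbs \<open>S^{23}(w)\<close>, and
  \<open>Y(x + w)(1 \<otimes> e^{wT}) = e^{wT} Y(x)\<close> turns the rest into
  \<open>e^{wT} Y(x)(1 \<otimes> Y(-w)) S^{12}(x + w)\<close> on \<open>a \<otimes> c \<otimes> b\<close>.  These two expressions agree by locality with
  \<open>z\<^sub>1 = x\<close> and \<open>z\<^sub>2 = -w\<close>, since then \<open>z\<^sub>1 - z\<^sub>2 = x + w\<close>.

  Finally the braidings have to be removed.  They are \<open>1 + O(h)\<close>, so the difference \<open>A - B\<close> on a vector
  is \<open>A - B\<close> composed with the braidings, which vanishes, minus \<open>h\<close> times a combination of the values
  of \<open>A - B\<close> on finitely many vectors with scalar series as coefficients; induction on the power of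
  \<open>h\<close> finishes the proof (\<open>assoc_mod_basis\<close>).  In that combination \<open>A\<close> is multiplied by powers of \<open>x + w\<close> expanded in
  nonnegative powers of \<open>w\<close>, and \<open>B\<close> by the same powers expanded in nonnegative powers of \<open>x\<close>; a further
  power of \<open>z\<close> makes all exponents nonnegative, and then the two expansions coincide
  (\<open>expansion_exchange\<close>).

  All formal calculus is done with scalar series.  A vector modulo \<open>h^M\<close> is determined by its values under
  the \<open>k\<close>-linear functionals that vanish on multiples of \<open>h^M\<close> (\<open>hcong_iff_hfun\<close>), and such a functional
  turns an \<open>h\<close>-adic sum into a sum with finitely many nonzero terms (\<open>hfun_hsum\<close>).
\<close>

section \<open>Sums with finite support\<close>

lemma Sum_any_eq_sum: "finite A \<Longrightarrow> (\<And>x. x \<notin> A \<Longrightarrow> f x = 0) \<Longrightarrow> Sum_any f = sum f A"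
  by (rule Sum_any.expand_superset) auto

lemma Sum_any_inj_reindex:
  assumes "inj h" and "\<And>y. y \<notin> range h \<Longrightarrow> f y = 0"
  shows "Sum_any (\<lambda>x. f (h x)) = Sum_any f"
proof -
  have "{y. f y \<noteq> 0} = h ` {x. f (h x) \<noteq> 0}"
    using assms(2) by (auto simp: image_iff) (metis rangeE)
  moreover have "inj_on h {x. f (h x) \<noteq> 0}"
    using assms(1) by (rule inj_on_subset) simp
  ultimately show ?thesis
    by (simp add: Sum_any.expand_set sum.reindex)
qed

lemma finite_support_reindex:
  assumes "\<And>y. y \<notin> range h \<Longrightarrow> f y = 0" and "finite {x. f (h x) \<noteq> 0}"
  shows "finite {y. f y \<noteq> 0}"
proof (rule finite_subset)
  show "{y. f y \<noteq> 0} \<subseteq> h ` {x. f (h x) \<noteq> 0}"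
    using assms(1) by (auto simp: image_iff) (metis rangeE)
qed (use assms(2) in simp)

lemma finite_support_pair:
  assumes "finite {(a, b). f a b \<noteq> 0}"
  shows "finite ({a. \<exists>b. f a b \<noteq> 0} \<times> {b. \<exists>a. f a b \<noteq> 0})"
proof (rule finite_subset)
  show "{a. \<exists>b. f a b \<noteq> 0} \<times> {b. \<exists>a. f a b \<noteq> 0}
      \<subseteq> fst ` {(a, b). f a b \<noteq> 0} \<times> snd ` {(a, b). f a b \<noteq> 0}"
    by force
  show "finite (fst ` {(a, b). f a b \<noteq> 0} \<times> snd ` {(a, b). f a b \<noteq> 0})"
    using assms by blast
qed

lemma Sum_any_pair:
  assumes "finite {(a, b). f a b \<noteq> 0}"
  shows "Sum_any (\<lambda>(a, b). f a b) = Sum_any (\<lambda>a. Sum_any (f a))"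
  by (rule Sum_any.cartesian_product [OF finite_support_pair [OF assms] order_refl, symmetric])

lemma Sum_any_commute:
  assumes "finite {(a, b). f a b \<noteq> 0}"
  shows "Sum_any (\<lambda>a. Sum_any (f a)) = Sum_any (\<lambda>b. Sum_any (\<lambda>a. f a b))"
  by (rule Sum_any.swap [OF finite_support_pair [OF assms] order_refl])

lemma Sum_any_add:
  assumes "finite {a. f a \<noteq> 0}" "finite {a. g a \<noteq> 0}"
  shows "Sum_any (\<lambda>a. f a + g a) = Sum_any f + Sum_any g"
  by (rule Sum_any.distrib [OF assms])

lemma Sum_any_cmult:
  fixes c :: "'k::field"
  shows "Sum_any (\<lambda>a. c * f a) = c * Sum_any f"
proof (cases "c = 0")
  case False
  then have "{a. c * f a \<noteq> 0} = {a. f a \<noteq> 0}" by auto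
  then show ?thesis by (simp add: Sum_any.expand_set sum_distrib_left)
qed simp

text \<open>
  Families of series are Laurent with a bound that depends on an index; this makes the bound uniform
  over finitely many indices.
\<close>

lemma uniform_lower_bound:
  fixes R :: "'a \<Rightarrow> int \<Rightarrow> bool"
  assumes "finite Q" and "\<And>q. q \<in> Q \<Longrightarrow> \<exists>p0. \<forall>p<p0. R q p"
  shows "\<exists>p0. \<forall>q\<in>Q. \<forall>p<p0. R q p"
  using assms
proof (induction Q rule: finite_induct)
  case (insert x Q)
  obtain p0 where "\<forall>q\<in>Q. \<forall>p<p0. R q p"
    using insert.IH insert.prems by (metis insertCI)
  moreover obtain p1 where "\<forall>p<p1. R x p"
    using insert.prems by blast
  ultimately have "\<forall>q\<in>insert x Q. \<forall>p<min p0 p1. R q p" by auto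
  then show ?case by blast
qed simp

lemma Sum_any_antidiagonal:
  fixes g :: "nat \<Rightarrow> nat \<Rightarrow> 'a::comm_monoid_add"
  assumes fin: "finite {(m, k). g m k \<noteq> 0}"
  shows "Sum_any (\<lambda>m. Sum_any (g m)) = Sum_any (\<lambda>n. \<Sum>j\<le>n. g (n - j) j)"
proof -
  define G where "G n j = (if j \<le> n then g (n - j) j else 0)" for n j
  define h :: "nat \<times> nat \<Rightarrow> nat \<times> nat" where "h = (\<lambda>(m, k). (m + k, k))"
  have inj: "inj h" by (auto simp: h_def inj_on_def)
  have out: "(\<lambda>(n, j). G n j) y = 0" if "y \<notin> range h" for y
  proof (rule ccontr)
    assume "(\<lambda>(n, j). G n j) y \<noteq> 0"
    then have "y = h (fst y - snd y, snd y)" by (cases y) (auto simp: h_def G_def split: if_splits)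
    then show False using that by blast
  qed
  have comp: "(\<lambda>x. (\<lambda>(n, j). G n j) (h x)) = (\<lambda>(m, k). g m k)"
    by (auto simp: h_def G_def fun_eq_iff)
  have fin': "finite {x. (\<lambda>(m, k). g m k) x \<noteq> 0}"
    using fin by (simp add: case_prod_unfold)
  have fin'': "finite {x. (\<lambda>(n, j). G n j) (h x) \<noteq> 0}"
    using fin' unfolding comp [THEN fun_cong] .
  have "finite {x. (\<lambda>(n, j). G n j) x \<noteq> 0}"
    by (rule finite_support_reindex [where f = "\<lambda>(n, j). G n j" and h = h, OF _ fin'']) (rule out)
  then have finG: "finite {(n, j). G n j \<noteq> 0}" by (simp add: case_prod_unfold)
  have "Sum_any (\<lambda>m. Sum_any (g m)) = Sum_any (\<lambda>(m, k). g m k)"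
    by (rule Sum_any_pair [OF fin, symmetric])
  also have "\<dots> = Sum_any (\<lambda>(n, j). G n j)"
    unfolding comp [symmetric] by (rule Sum_any_inj_reindex [OF inj out])
  also have "\<dots> = Sum_any (\<lambda>n. Sum_any (G n))" by (rule Sum_any_pair [OF finG])
  also have "\<dots> = Sum_any (\<lambda>n. \<Sum>j\<le>n. g (n - j) j)"
  proof (rule Sum_any.cong)
    fix n
    have "Sum_any (G n) = (\<Sum>j\<le>n. G n j)" by (rule Sum_any_eq_sum) (auto simp: G_def)
    then show "Sum_any (G n) = (\<Sum>j\<le>n. g (n - j) j)" by (simp add: G_def)
  qed
  finally show ?thesis .
qed

lemma pair_subsetI: "(\<And>a b. P a b \<Longrightarrow> (a, b) \<in> B) \<Longrightarrow> {(a, b). P a b} \<subseteq> B"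
  by auto

lemma Sum_any_sum:
  assumes "finite I" and "\<And>k. k \<in> I \<Longrightarrow> finite {r. f k r \<noteq> 0}"
  shows "Sum_any (\<lambda>r. \<Sum>k\<in>I. f k r) = (\<Sum>k\<in>I. Sum_any (f k))"
proof -
  define R where "R = (\<Union>k\<in>I. {r. f k r \<noteq> 0})"
  have R: "finite R" using assms by (simp add: R_def)
  have 1: "Sum_any (f k) = sum (f k) R" if "k \<in> I" for k
    by (rule Sum_any_eq_sum [OF R]) (use that in \<open>auto simp: R_def\<close>)
  have "Sum_any (\<lambda>r. \<Sum>k\<in>I. f k r) = (\<Sum>r\<in>R. \<Sum>k\<in>I. f k r)"
    by (rule Sum_any_eq_sum [OF R]) (auto simp: R_def intro: sum.neutral)
  also have "\<dots> = (\<Sum>k\<in>I. Sum_any (f k))"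
    by (subst sum.swap) (simp add: 1)
  finally show ?thesis .
qed

section \<open>Scalar formal series in two variables\<close>

definition bincoef :: "'k::field_char_0 \<Rightarrow> int \<Rightarrow> nat \<Rightarrow> 'k" where
  "bincoef c i j = (of_int (i + int j) gchoose j) * c ^ j"

lemma binc_eq: "binc c i j = fps_const (bincoef c i j)"
  by (simp add: binc_def bincoef_def)

lemma bincoef_0 [simp]: "bincoef c i 0 = 1"
  by (simp add: bincoef_def)

lemma bincoef_pascal: "bincoef c (i - 1) (Suc j) + c * bincoef c i j = bincoef c i (Suc j)"
proof -
  have "(of_int (i + int j) + 1 :: 'a) gchoose Suc j
      = (of_int (i + int j) gchoose j) + (of_int (i + int j) gchoose Suc j)"
    by (rule gbinomial_Suc_Suc)
  then show ?thesis
    by (simp add: bincoef_def algebra_simps)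
qed

text \<open>
  A function \<open>f :: int \<Rightarrow> int \<Rightarrow> 'k\<close> stands for the series with coefficient \<open>f p q\<close> at \<open>x^p y^q\<close>, and
  \<open>expansion c F\<close> is the series \<open>\<Sum>n. (x + c y)^n F\<^sub>n(x, y)\<close> in which negative powers are expanded in
  nonnegative powers of \<open>y\<close>.  Both \<open>QA1\<close> and the hexagon relation have this shape.
\<close>

definition expansion :: "'k::field_char_0 \<Rightarrow> (int \<Rightarrow> int \<Rightarrow> int \<Rightarrow> 'k) \<Rightarrow> int \<Rightarrow> int \<Rightarrow> 'k" where
  "expansion c F p q = Sum_any (\<lambda>(i, j). bincoef c i j * F (i + int j) (p - i) (q - int j))"

text \<open>
  Multiplication by \<open>x + c y\<close>.
\<close>

definition linmul :: "'k::field_char_0 \<Rightarrow> (int \<Rightarrow> int \<Rightarrow> 'k) \<Rightarrow> int \<Rightarrow> int \<Rightarrow> 'k" where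
  "linmul c f p q = f (p - 1) q + c * f p (q - 1)"

text \<open>
  These bounds make each coefficient of \<open>expansion c F\<close> a finite sum: \<open>F\<^sub>n\<close> vanishes for small \<open>n\<close>, and
  all \<open>F\<^sub>n\<close> lie in \<open>k((x))((y))\<close> with bounds independent of \<open>n\<close>.
\<close>

definition expandable :: "(int \<Rightarrow> int \<Rightarrow> int \<Rightarrow> 'k::zero) \<Rightarrow> bool" where
  "expandable F \<longleftrightarrow> (\<exists>n0. \<forall>n<n0. \<forall>p q. F n p q = 0) \<and> (\<exists>q0. \<forall>q<q0. \<forall>n p. F n p q = 0)
     \<and> (\<forall>q. \<exists>p0. \<forall>p<p0. \<forall>n. F n p q = 0)"

lemma finite_expansion_index:
  assumes "expandable F"
  shows "finite {(i, j). F (i + int j) (p - i) (q - int j) \<noteq> 0}"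
proof -
  obtain n0 where n0: "\<And>n p q. n < n0 \<Longrightarrow> F n p q = 0" using assms unfolding expandable_def by blast
  obtain q0 where q0: "\<And>q n p. q < q0 \<Longrightarrow> F n p q = 0" using assms unfolding expandable_def by blast
  have "\<exists>p0. \<forall>y\<in>{q0..q}. \<forall>p<p0. \<forall>n. F n p y = 0"
    using assms by (intro uniform_lower_bound) (auto simp: expandable_def)
  then obtain p0 where p0: "\<And>y n p. y \<in> {q0..q} \<Longrightarrow> p < p0 \<Longrightarrow> F n p y = 0" by blast
  have "(i, j) \<in> {n0 - (q - q0)..p - p0} \<times> {..nat (q - q0)}"
    if "F (i + int j) (p - i) (q - int j) \<noteq> 0" for i j
  proof -
    have *: "\<not> i + int j < n0" "\<not> q - int j < q0" using that n0 q0 by blast+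
    then have "q - int j \<in> {q0..q}" by simp
    then have "\<not> p - i < p0" using that p0 by blast
    then show ?thesis using * by auto
  qed
  then have "{(i, j). F (i + int j) (p - i) (q - int j) \<noteq> 0}
      \<subseteq> {n0 - (q - q0)..p - p0} \<times> {..nat (q - q0)}" by auto
  then show ?thesis by (rule finite_subset) simp
qed

lemma finite_expansion_support:
  assumes "expandable F"
  shows "finite {x. (case x of (i, j) \<Rightarrow> C i j * F (i + int j) (p - i) (q - int j)) \<noteq> (0::'k::field)}"
  by (rule finite_subset [OF _ finite_expansion_index [OF assms, of p q]]) auto

lemma linmul_expansion:
  assumes "expandable F"
  shows "linmul c (expansion c F) = expansion c (\<lambda>n. linmul c (F n))"
proof (intro ext)
  fix p q
  have "expansion c F (p - 1) q
      = Sum_any (\<lambda>(i, j). bincoef c i j * F (i + int j) (p - 1 - i) (q - int j))" (is "_ = Sum_any ?a")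
    by (simp add: expansion_def)
  moreover have "c * expansion c F p (q - 1)
      = Sum_any (\<lambda>(i, j). c * bincoef c i j * F (i + int j) (p - i) (q - 1 - int j))" (is "_ = Sum_any ?b")
    unfolding expansion_def Sum_any_cmult [symmetric] by (simp add: case_prod_unfold mult.assoc)
  moreover have "finite {x. ?a x \<noteq> 0}" "finite {x. ?b x \<noteq> 0}"
    using finite_expansion_support [OF assms] by fast+
  ultimately have "linmul c (expansion c F) p q = Sum_any (\<lambda>x. ?a x + ?b x)"
    by (simp add: linmul_def Sum_any_add)
  also have "(\<lambda>x. ?a x + ?b x) = (\<lambda>(i, j). bincoef c i j * linmul c (F (i + int j)) (p - i) (q - int j))"
    by (auto simp: linmul_def algebra_simps)
  finally show "linmul c (expansion c F) p q = expansion c (\<lambda>n. linmul c (F n)) p q"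
    unfolding expansion_def [of c "\<lambda>n. linmul c (F n)" p q] .
qed

text \<open>
  Multiplication by \<open>x + c y\<close> raises the exponent \<open>n\<close> of \<open>(x + c y)^n\<close> by one; on coefficients this is
  Pascal's rule for generalized binomial coefficients, hence valid for negative \<open>n\<close> as well.
\<close>

lemma linmul_expansion_shift:
  assumes "expandable F"
  shows "linmul c (expansion c F) = expansion c (\<lambda>n. F (n - 1))"
proof (intro ext)
  fix p q
  define a where "a = (\<lambda>(i, j). bincoef c i j * F (i + int j) (p - 1 - i) (q - int j))"
  define b where "b = (\<lambda>(i, j). c * bincoef c i j * F (i + int j) (p - i) (q - 1 - int j))"
  define a' where "a' = (\<lambda>(i, j). bincoef c (i - 1) j * F (i + int j - 1) (p - i) (q - int j))"
  define b' where "b' = (\<lambda>(i, j). (case j of 0 \<Rightarrow> 0 | Suc k \<Rightarrow>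
     c * bincoef c i k * F (i + int j - 1) (p - i) (q - int j)))"
  have fin: "finite {x. a x \<noteq> 0}" "finite {x. b x \<noteq> 0}"
    unfolding a_def b_def using finite_expansion_support [OF assms] by fast+
  have a: "a = (\<lambda>x. a' (apfst (\<lambda>i. i + 1) x))"
    by (auto simp: a_def a'_def algebra_simps fun_eq_iff)
  have b: "b = (\<lambda>x. b' (apsnd Suc x))"
    by (auto simp: b_def b'_def algebra_simps fun_eq_iff)
  have inj: "inj (apfst (\<lambda>i::int. i + 1) :: int \<times> nat \<Rightarrow> _)" "inj (apsnd Suc :: int \<times> nat \<Rightarrow> _)"
    by (auto simp: inj_on_def)
  have ra: "x \<in> range (apfst (\<lambda>i::int. i + 1))" for x :: "int \<times> nat"
    by (rule range_eqI [of _ _ "(fst x - 1, snd x)"]) (auto simp: prod_eq_iff)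
  have rb: "b' x = 0" if "x \<notin> range (apsnd Suc)" for x
  proof (cases x)
    case (Pair i j)
    then have "j = 0" using that by (cases j) (auto simp: image_iff)
    then show ?thesis using Pair by (simp add: b'_def)
  qed
  have fin': "finite {x. a' x \<noteq> 0}" "finite {x. b' x \<noteq> 0}"
    using finite_support_reindex [of "apfst (\<lambda>i. i + 1)" a'] finite_support_reindex [of "apsnd Suc" b', OF rb]
      fin ra unfolding a b by simp_all
  have suma: "Sum_any a = Sum_any a'"
    unfolding a by (rule Sum_any_inj_reindex [OF inj(1)]) (simp add: ra)
  have sumb: "Sum_any b = Sum_any b'"
    unfolding b by (rule Sum_any_inj_reindex [OF inj(2) rb])
  have "linmul c (expansion c F) p q = Sum_any a + Sum_any b"
    unfolding linmul_def expansion_def a_def b_def Sum_any_cmult [symmetric]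
    by (simp add: case_prod_unfold mult.assoc)
  also have "\<dots> = Sum_any a' + Sum_any b'"
    by (simp only: suma sumb)
  also have "\<dots> = Sum_any (\<lambda>x. a' x + b' x)"
    by (rule Sum_any_add [OF fin', symmetric])
  also have "(\<lambda>x. a' x + b' x) =
      (\<lambda>(i, j). bincoef c i j * F (i + int j - 1) (p - i) (q - int j))"
  proof (intro ext)
    fix x :: "int \<times> nat"
    obtain i j where x: "x = (i, j)" by (cases x)
    show "a' x + b' x = (case x of (i, j) \<Rightarrow> bincoef c i j * F (i + int j - 1) (p - i) (q - int j))"
    proof (cases j)
      case (Suc k)
      then show ?thesis
        using bincoef_pascal [of c i k] by (simp add: x a'_def b'_def distrib_right [symmetric])
    qed (simp add: x a'_def b'_def)
  qed
  finally show "linmul c (expansion c F) p q = expansion c (\<lambda>n. F (n - 1)) p q"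
    unfolding expansion_def [of c "\<lambda>n. F (n - 1)" p q] by (simp add: algebra_simps)
qed

lemma expandable_linmul:
  assumes "expandable F"
  shows "expandable (\<lambda>n. linmul c (F n))"
proof -
  obtain n0 where n0: "\<And>n p q. n < n0 \<Longrightarrow> F n p q = 0" using assms unfolding expandable_def by blast
  obtain q0 where q0: "\<And>q n p. q < q0 \<Longrightarrow> F n p q = 0" using assms unfolding expandable_def by blast
  have "\<exists>p0. \<forall>p<p0. \<forall>n. linmul c (F n) p q = 0" for q
  proof -
    obtain p0 p1 where "\<And>n p. p < p0 \<Longrightarrow> F n p q = 0" "\<And>n p. p < p1 \<Longrightarrow> F n p (q - 1) = 0"
      using assms unfolding expandable_def by meson
    then have "\<forall>p<min p0 p1. \<forall>n. linmul c (F n) p q = 0" by (simp add: linmul_def)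
    then show ?thesis by blast
  qed
  moreover have "\<forall>n<n0. \<forall>p q. linmul c (F n) p q = 0" "\<forall>q<q0. \<forall>n p. linmul c (F n) p q = 0"
    using n0 q0 by (auto simp: linmul_def)
  ultimately show ?thesis unfolding expandable_def by blast
qed

lemma expandable_shift:
  assumes "expandable F"
  shows "expandable (\<lambda>n. F (n - m))"
proof -
  obtain n0 where "\<And>n p q. n < n0 \<Longrightarrow> F n p q = 0" using assms unfolding expandable_def by blast
  then have "\<forall>n<n0 + m. \<forall>p q. F (n - m) p q = 0" by simp
  then show ?thesis using assms unfolding expandable_def by fast
qed

lemma linmul_pow_expansion:
  assumes "expandable F"
  shows "(linmul c ^^ N) (expansion c F) = expansion c (\<lambda>n. (linmul c ^^ N) (F n))"
    and "expandable (\<lambda>n. (linmul c ^^ N) (F n))"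
  by (induction N) (use assms in \<open>simp_all add: linmul_expansion expandable_linmul\<close>)

lemma linmul_pow_expansion_shift:
  assumes "expandable F"
  shows "(linmul c ^^ k) (expansion c F) = expansion c (\<lambda>n. F (n - int k))"
proof (induction k)
  case (Suc k)
  then show ?case
    by (simp add: linmul_expansion_shift [OF expandable_shift [OF assms]] algebra_simps)
qed simp

text \<open>
  The series \<open>\<Sum>n. (x + y)^n F\<^sub>n(x, y)\<close> again, with negative powers expanded in nonnegative powers of \<open>x\<close>.
\<close>

definition expansion' :: "(int \<Rightarrow> int \<Rightarrow> int \<Rightarrow> 'k::field_char_0) \<Rightarrow> int \<Rightarrow> int \<Rightarrow> 'k" where
  "expansion' F p q = expansion 1 (\<lambda>n q p. F n p q) q p"

lemma linmul_pow_transpose: "(linmul 1 ^^ N) (\<lambda>p q. f q p) = (\<lambda>p q. (linmul 1 ^^ N) f q p)"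
  by (induction N) (simp_all add: linmul_def fun_eq_iff add.commute)

lemma linmul_pow_expansion':
  assumes "expandable (\<lambda>n q p. F n p q)"
  shows "(linmul 1 ^^ (N + k)) (expansion' F) = expansion' (\<lambda>n. (linmul 1 ^^ N) (F (n - int k)))"
proof -
  have "(linmul 1 ^^ (N + k)) (expansion' F) = (\<lambda>p q. (linmul 1 ^^ (N + k)) (expansion 1 (\<lambda>n q p. F n p q)) q p)"
    unfolding expansion'_def by (rule linmul_pow_transpose)
  also have "\<dots> = (\<lambda>p q. expansion 1 (\<lambda>n. (linmul 1 ^^ N) (\<lambda>q p. F (n - int k) p q)) q p)"
    by (simp add: funpow_add linmul_pow_expansion_shift [OF assms] linmul_pow_expansion(1) [OF expandable_shift [OF assms]])
  also have "\<dots> = expansion' (\<lambda>n. (linmul 1 ^^ N) (F (n - int k)))"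
    by (simp add: expansion'_def linmul_pow_transpose [of N "F _"] fun_eq_iff)
  finally show ?thesis .
qed

text \<open>
  Nonnegative powers of \<open>x + y\<close> are polynomials, so the direction of expansion does not matter.
\<close>

lemma expansion_eq_expansion':
  assumes "\<And>n. n < 0 \<Longrightarrow> F n = (\<lambda>p q. 0)"
  shows "expansion 1 F = expansion' F"
proof (intro ext)
  fix p q
  let ?f = "\<lambda>i j. (of_int (i + j) gchoose nat j) * F (i + j) (p - i) (q - j)"
  define h where "h = (\<lambda>(i::nat, j::nat). bincoef (1::'a) (int i) j * F (int i + int j) (p - int i) (q - int j))"
  have zero: "bincoef (1::'a) i j * F (i + int j) x y = 0" if "i < 0" for i j x y
  proof (cases "i + int j < 0")
    case False
    then have "(of_int (i + int j) gchoose j :: 'a) = (of_nat (nat (i + int j)) gchoose j)" by simp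
    also have "\<dots> = of_nat (nat (i + int j) choose j)" by (rule binomial_gbinomial [symmetric])
    also have "\<dots> = 0" using that False by (simp add: binomial_eq_0)
    finally show ?thesis by (simp add: bincoef_def)
  qed (simp add: assms)
  have 1: "expansion 1 F p q = Sum_any h"
  proof -
    let ?g = "\<lambda>(i, j). bincoef 1 i j * F (i + int j) (p - i) (q - int j)"
    have "Sum_any (\<lambda>x. ?g (apfst int x)) = Sum_any ?g"
    proof (rule Sum_any_inj_reindex)
      show "inj (apfst int :: nat \<times> nat \<Rightarrow> _)" by (auto simp: inj_on_def)
      fix y :: "int \<times> nat" assume y: "y \<notin> range (apfst int)"
      have "fst y < 0"
      proof (rule ccontr)
        assume "\<not> fst y < 0"
        then have "y = apfst int (nat (fst y), snd y)" by (auto simp: prod_eq_iff)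
        then show False using y by blast
      qed
      then show "?g y = 0" using zero by (simp add: case_prod_unfold)
    qed
    then show ?thesis by (simp add: expansion_def h_def case_prod_unfold)
  qed
  have 2: "expansion' F p q = Sum_any (\<lambda>x. h (prod.swap x))"
  proof -
    let ?g = "\<lambda>(j, i). bincoef 1 j i * F (j + int i) (p - int i) (q - j)"
    have "Sum_any (\<lambda>x. ?g (apfst int x)) = Sum_any ?g"
    proof (rule Sum_any_inj_reindex)
      show "inj (apfst int :: nat \<times> nat \<Rightarrow> _)" by (auto simp: inj_on_def)
      fix y :: "int \<times> nat" assume y: "y \<notin> range (apfst int)"
      have "fst y < 0"
      proof (rule ccontr)
        assume "\<not> fst y < 0"
        then have "y = apfst int (nat (fst y), snd y)" by (auto simp: prod_eq_iff)
        then show False using y by blast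
      qed
      then show "?g y = 0" using zero by (simp add: case_prod_unfold)
    qed
    moreover have "?g (apfst int x) = h (prod.swap x)" for x
    proof -
      have "bincoef (1::'a) (int a) b = bincoef 1 (int b) a" for a b
      proof -
        have "(of_nat (a + b) gchoose b :: 'a) = (of_nat (a + b) gchoose a)"
          using gbinomial_of_nat_symmetric [of b "a + b"] by simp
        then show ?thesis by (simp add: bincoef_def add.commute)
      qed
      from this [of "fst x" "snd x"] show ?thesis
        by (simp add: h_def case_prod_unfold add.commute)
    qed
    ultimately show ?thesis by (simp add: expansion'_def expansion_def)
  qed
  show "expansion 1 F p q = expansion' F p q"
    unfolding 1 2 by (rule Sum_any_inj_reindex [symmetric]) (auto simp: image_iff)
qed

text \<open>
  If \<open>F\<^sub>n\<close> and \<open>G\<^sub>n\<close> agree after multiplication by \<open>(x + y)^N\<close> and only \<open>n \<ge> -k\<close> occur, the two opposite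
  expansions agree after multiplication by \<open>(x + y)^(N + k)\<close>: the factor \<open>(x + y)^k\<close> makes all exponents
  nonnegative, and \<open>(x + y)^N\<close> replaces \<open>F\<^sub>n\<close> by \<open>G\<^sub>n\<close>.
\<close>

lemma expansion_exchange:
  fixes F G :: "int \<Rightarrow> int \<Rightarrow> int \<Rightarrow> 'k::field_char_0"
  assumes F: "expandable F" and G: "expandable (\<lambda>n q p. G n p q)"
    and eq: "\<And>n. (linmul 1 ^^ N) (F n) = (linmul 1 ^^ N) (G n)"
    and n0: "\<And>n. n < - int k \<Longrightarrow> F n = (\<lambda>p q. 0)"
  shows "(linmul 1 ^^ (N + k)) (expansion 1 F) = (linmul 1 ^^ (N + k)) (expansion' G)"
proof -
  have "(linmul 1 ^^ (N + k)) (expansion 1 F) = expansion 1 (\<lambda>n. (linmul 1 ^^ N) (F (n - int k)))"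
    by (simp add: funpow_add linmul_pow_expansion_shift [OF F] linmul_pow_expansion(1) [OF expandable_shift [OF F]])
  also have "\<dots> = expansion' (\<lambda>n. (linmul 1 ^^ N) (F (n - int k)))"
  proof (rule expansion_eq_expansion')
    fix n :: int assume "n < 0"
    then have "F (n - int k) = (\<lambda>p q. 0)" using n0 by simp
    moreover have "(linmul (1::'k) ^^ N) (\<lambda>p q. 0) = (\<lambda>p q. 0)"
      by (induction N) (simp_all add: linmul_def)
    ultimately show "(linmul 1 ^^ N) (F (n - int k)) = (\<lambda>p q. 0)" by simp
  qed
  also have "\<dots> = (linmul 1 ^^ (N + k)) (expansion' G)"
    by (simp add: linmul_pow_expansion' [OF G] eq)
  finally show ?thesis .
qed

text \<open>
  This is \<open>\<Sum>k. y^k X\<^sub>k(x, -y)\<close>.  With \<open>X\<^sub>k\<close> obtained by composing with \<open>T^k / k!\<close> it is the operation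
  \<open>e^{yT} X(x, -y)\<close> that skew symmetry produces.
\<close>

definition twist :: "(nat \<Rightarrow> int \<Rightarrow> int \<Rightarrow> 'k::field_char_0) \<Rightarrow> int \<Rightarrow> int \<Rightarrow> 'k" where
  "twist X p q = Sum_any (\<lambda>k. (-1) powi (q - int k) * X k p (q - int k))"

lemma minus_one_powi_diff_1: "(-1) powi (n - 1) = - ((-1) powi n :: 'k::field)"
  by (simp add: power_int_diff)

definition bdd_q :: "(nat \<Rightarrow> int \<Rightarrow> int \<Rightarrow> 'k::zero) \<Rightarrow> bool" where
  "bdd_q X \<longleftrightarrow> (\<forall>p. \<exists>q0. \<forall>q<q0. \<forall>k. X k p q = 0)"

text \<open>
  The substitution \<open>y \<mapsto> -y\<close> turns \<open>x - y\<close> into \<open>x + y\<close>.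
\<close>

lemma linmul_twist:
  assumes "bdd_q X"
  shows "linmul 1 (twist X) = twist (\<lambda>k. linmul (-1) (X k))" and "bdd_q (\<lambda>k. linmul c (X k))"
proof -
  show "linmul 1 (twist X) = twist (\<lambda>k. linmul (-1) (X k))"
  proof (intro ext)
    fix p q
    have fin: "finite {k. (-1) powi (y - int k) * X k p' (z - int k) \<noteq> 0}" for y z p'
    proof -
      obtain q0 where q0: "\<And>q k. q < q0 \<Longrightarrow> X k p' q = 0" using assms unfolding bdd_q_def by meson
      have "{k. (-1) powi (y - int k) * X k p' (z - int k) \<noteq> 0} \<subseteq> {..nat (z - q0)}"
      proof
        fix k assume "k \<in> {k. (-1) powi (y - int k) * X k p' (z - int k) \<noteq> 0}"
        then have "\<not> z - int k < q0" using q0 by auto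
        then show "k \<in> {..nat (z - q0)}" by auto
      qed
      then show ?thesis by (rule finite_subset) simp
    qed
    have "linmul 1 (twist X) p q = Sum_any (\<lambda>k. (-1) powi (q - int k) * X k (p - 1) (q - int k)) +
       Sum_any (\<lambda>k. (-1) powi (q - 1 - int k) * X k p (q - 1 - int k))"
      by (simp add: linmul_def twist_def)
    also have "\<dots> = Sum_any (\<lambda>k. (-1) powi (q - int k) * X k (p - 1) (q - int k) +
       (-1) powi (q - 1 - int k) * X k p (q - 1 - int k))"
      by (rule Sum_any_add [OF fin fin, symmetric])
    also have "\<dots> = twist (\<lambda>k. linmul (-1) (X k)) p q"
    proof -
      have "(-1) powi (q - 1 - int k) * X k p (q - 1 - int k)
        = (-1) powi (q - int k) * ((-1) * X k p (q - int k - 1))" for k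
      proof -
        have "q - 1 - int k = q - int k - 1" by simp
        then show ?thesis by (simp only: minus_one_powi_diff_1) simp
      qed
      then show ?thesis by (simp add: twist_def linmul_def distrib_left right_diff_distrib)
    qed
    finally show "linmul 1 (twist X) p q = twist (\<lambda>k. linmul (-1) (X k)) p q" .
  qed
  show "bdd_q (\<lambda>k. linmul c (X k))"
    unfolding bdd_q_def
  proof
    fix p
    obtain q0 q1 where "\<And>q k. q < q0 \<Longrightarrow> X k p q = 0" "\<And>q k. q < q1 \<Longrightarrow> X k (p - 1) q = 0"
      using assms unfolding bdd_q_def by meson
    then have "\<forall>q<min q0 q1. \<forall>k. linmul c (X k) p q = 0" by (simp add: linmul_def)
    then show "\<exists>q0. \<forall>q<q0. \<forall>k. linmul c (X k) p q = 0" by blast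
  qed
qed

lemma linmul_pow_twist:
  assumes "bdd_q X"
  shows "(linmul 1 ^^ N) (twist X) = twist (\<lambda>k. (linmul (-1) ^^ N) (X k))"
    and "bdd_q (\<lambda>k. (linmul (-1) ^^ N) (X k))"
  by (induction N) (use assms in \<open>simp_all add: linmul_twist\<close>)

lemma linmul_pow_eq_sum:
  "(linmul c ^^ N) f p q = (\<Sum>k\<le>N. of_nat (N choose k) * c ^ k * f (p - int (N - k)) (q - int k))"
proof (induction N arbitrary: p q)
  case (Suc N)
  let ?g = "\<lambda>M k. of_nat (M choose k) * c ^ k * f (p - int (Suc N - k)) (q - int k)"
  have 1: "(linmul c ^^ N) f (p - 1) q = (\<Sum>k\<le>N. ?g N k)"
    unfolding Suc.IH by (rule sum.cong) (auto simp: Suc_diff_le algebra_simps)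
  have 2: "c * (linmul c ^^ N) f p (q - 1)
      = (\<Sum>k\<le>N. of_nat (N choose k) * c ^ Suc k * f (p - int (Suc N - Suc k)) (q - int (Suc k)))"
    unfolding Suc.IH sum_distrib_left by (rule sum.cong) (auto simp: algebra_simps)
  have "(\<Sum>k\<le>Suc N. ?g (Suc N) k) = ?g (Suc N) 0 + (\<Sum>k\<le>N. ?g (Suc N) (Suc k))"
    by (rule sum.atMost_Suc_shift)
  also have "(\<Sum>k\<le>N. ?g (Suc N) (Suc k)) = (\<Sum>k\<le>N. ?g N (Suc k)) + c * (linmul c ^^ N) f p (q - 1)"
    unfolding 2 sum.distrib [symmetric] by (rule sum.cong) (auto simp: algebra_simps)
  also have "?g (Suc N) 0 + ((\<Sum>k\<le>N. ?g N (Suc k)) + c * (linmul c ^^ N) f p (q - 1))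
      = (\<Sum>k\<le>Suc N. ?g N k) + c * (linmul c ^^ N) f p (q - 1)"
    unfolding sum.atMost_Suc_shift by simp
  also have "(\<Sum>k\<le>Suc N. ?g N k) = (\<Sum>k\<le>N. ?g N k)" by simp
  finally have "(\<Sum>k\<le>Suc N. ?g (Suc N) k) = (linmul c ^^ N) f (p - 1) q + c * (linmul c ^^ N) f p (q - 1)"
    unfolding 1 .
  then show ?case by (simp only: funpow.simps o_apply) (simp only: linmul_def [of c "(linmul c ^^ N) f"])
qed simp
text \<open>
  The same substitution turns an expansion in powers of \<open>x - y\<close> into one in powers of \<open>x + y\<close>.  The
  auxiliary family \<open>E\<close> bounds all \<open>H\<^sub>k\<close> simultaneously.
\<close>

lemma expansion_twist:
  fixes H :: "nat \<Rightarrow> int \<Rightarrow> int \<Rightarrow> int \<Rightarrow> 'k::field_char_0" and E :: "int \<Rightarrow> int \<Rightarrow> int \<Rightarrow> nat"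
  assumes E: "expandable E" and H: "\<And>k n p q. E n p q = 0 \<Longrightarrow> H k n p q = 0"
  shows "expansion 1 (\<lambda>n. twist (\<lambda>k. H k n)) = twist (\<lambda>k. expansion (-1) (H k))"
    and "bdd_q (\<lambda>k. expansion (-1) (H k))"
proof -
  obtain q0 where q0: "\<And>q n p. q < q0 \<Longrightarrow> E n p q = 0" using E unfolding expandable_def by blast
  show "expansion 1 (\<lambda>n. twist (\<lambda>k. H k n)) = twist (\<lambda>k. expansion (-1) (H k))"
  proof (intro ext)
    fix p q
    let ?f = "\<lambda>(i, j) k. bincoef 1 i j * ((-1) powi (q - int j - int k) * H k (i + int j) (p - i) (q - int j - int k))"
    define K where "K = nat (q - q0)"
    have "{(x, k). ?f x k \<noteq> 0} \<subseteq>
        (\<Union>k\<le>K. {(i, j). E (i + int j) (p - i) (q - int k - int j) \<noteq> 0} \<times> {k})"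
    proof clarify
      fix i j k assume nz: "bincoef 1 i j * ((-1) powi (q - int j - int k) * H k (i + int j) (p - i) (q - int j - int k)) \<noteq> 0"
      have "q - int j - int k = q - int k - int j" by simp
      with nz have e: "E (i + int j) (p - i) (q - int k - int j) \<noteq> 0"
        using H [of "i + int j" "p - i" "q - int k - int j" k] by auto
      then have "\<not> q - int k - int j < q0"
        using q0 [of "q - int k - int j" "i + int j" "p - i"] by auto
      then have "k \<le> K" by (simp add: K_def)
      with e show "((i, j), k) \<in> (\<Union>k\<le>K. {(i, j). E (i + int j) (p - i) (q - int k - int j) \<noteq> 0} \<times> {k})"
        by simp
    qed
    moreover have "finite (\<Union>k\<le>K. {(i, j). E (i + int j) (p - i) (q - int k - int j) \<noteq> 0} \<times> {k})"
      using finite_expansion_index [OF E] by blast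
    ultimately have fin: "finite {(x, k). ?f x k \<noteq> 0}" by (rule finite_subset)
    have "expansion 1 (\<lambda>n. twist (\<lambda>k. H k n)) p q = Sum_any (\<lambda>x. Sum_any (?f x))"
      unfolding expansion_def twist_def Sum_any_cmult [symmetric] by (simp add: case_prod_unfold)
    also have "\<dots> = Sum_any (\<lambda>k. Sum_any (\<lambda>x. ?f x k))"
      by (rule Sum_any_commute [OF fin])
    also have "\<dots> = twist (\<lambda>k. expansion (-1) (H k)) p q"
      unfolding expansion_def twist_def Sum_any_cmult [symmetric]
    proof (intro Sum_any.cong)
      fix k and x :: "int \<times> nat"
      obtain i j where x: "x = (i, j)" by (cases x)
      have i: "q - int j - int k = q - int k - int j" by simp
      have "(-1 :: 'k) ^ j = (-1) powi (- int j)"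
        by (simp add: power_int_minus power_inverse [symmetric])
      then have "(-1 :: 'k) powi (q - int k) * (-1) ^ j = (-1) powi (q - int k - int j)"
        by (simp add: power_int_add [symmetric])
      from this [symmetric] have c: "bincoef 1 i j * (-1 :: 'k) powi (q - int k - int j) = (-1) powi (q - int k) * bincoef (-1) i j"
        by (simp add: bincoef_def mult_ac)
      show "?f x k = (-1) powi (q - int k) * (case x of (i, j) \<Rightarrow> bincoef (-1) i j * H k (i + int j) (p - i) (q - int k - int j))"
        by (simp only: x prod.case i mult.assoc [symmetric] c)
    qed
    finally show "expansion 1 (\<lambda>n. twist (\<lambda>k. H k n)) p q = twist (\<lambda>k. expansion (-1) (H k)) p q" .
  qed
  show "bdd_q (\<lambda>k. expansion (-1) (H k))"
    unfolding bdd_q_def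
  proof (intro allI exI impI)
    fix p q k assume "q < q0"
    then show "expansion (-1) (H k) p q = 0"
      unfolding expansion_def by (simp add: case_prod_unfold H q0)
  qed
qed

lemma linmul_pow_plus: "(linmul c ^^ N) (\<lambda>p q. f p q + g p q) = (\<lambda>p q. (linmul c ^^ N) f p q + (linmul c ^^ N) g p q)"
  by (induction N) (simp_all add: linmul_def fun_eq_iff algebra_simps)

lemma linmul_pow_lincomb:
  "(linmul c ^^ N) (\<lambda>p q. \<Sum>a\<in>I. w a * f a p q) = (\<lambda>p q. \<Sum>a\<in>I. w a * (linmul c ^^ N) (f a) p q)"
  by (induction N) (simp_all add: linmul_def fun_eq_iff sum_distrib_left sum.distrib [symmetric] algebra_simps)

lemma linmul_pow_conv:
  assumes "\<And>p q. finite {r. f r p (q - r) \<noteq> 0}"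
  shows "(linmul c ^^ N) (\<lambda>p q. Sum_any (\<lambda>r. f r p (q - r))) = (\<lambda>p q. Sum_any (\<lambda>r. (linmul c ^^ N) (f r) p (q - r)))"
proof (intro ext)
  fix p q
  have eq: "q - int k - r = q - r - int k" for k r by simp
  have "(linmul c ^^ N) (\<lambda>p q. Sum_any (\<lambda>r. f r p (q - r))) p q
      = (\<Sum>k\<le>N. Sum_any (\<lambda>r. of_nat (N choose k) * c ^ k * f r (p - int (N - k)) (q - int k - r)))"
    unfolding linmul_pow_eq_sum Sum_any_cmult ..
  also have "\<dots> = Sum_any (\<lambda>r. \<Sum>k\<le>N. of_nat (N choose k) * c ^ k * f r (p - int (N - k)) (q - int k - r))"
  proof (rule Sum_any_sum [symmetric])
    fix k
    show "finite {r. of_nat (N choose k) * c ^ k * f r (p - int (N - k)) (q - int k - r) \<noteq> 0}"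
      by (rule finite_subset [OF _ assms [of "p - int (N - k)" "q - int k"]]) auto
  qed simp
  finally show "(linmul c ^^ N) (\<lambda>p q. Sum_any (\<lambda>r. f r p (q - r))) p q
      = Sum_any (\<lambda>r. (linmul c ^^ N) (f r) p (q - r))"
    unfolding linmul_pow_eq_sum eq .
qed

text \<open>
  In applications \<open>f r n\<close> is the series that belongs to the coefficient of \<open>w^r z^n\<close> in a braided vector,
  and the sum over \<open>r\<close> multiplies it by \<open>w^r\<close>.  Products are bounded first in the power of \<open>w\<close>, as here;
  iterates are bounded first in the power of \<open>x\<close>, as in \<open>conv_expandable'\<close>.
\<close>

lemma conv_expandable:
  fixes f :: "int \<Rightarrow> int \<Rightarrow> int \<Rightarrow> int \<Rightarrow> 'k::comm_monoid_add"
  assumes n0: "\<forall>n<n0. \<forall>r p q. f r n p q = 0" and r0: "\<forall>r<r0. \<forall>n p q. f r n p q = 0"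
    and q0: "\<forall>q<q0. \<forall>r n p. f r n p q = 0" and p0: "\<forall>q. \<exists>p0. \<forall>p<p0. \<forall>r n. f r n p q = 0"
  shows "expandable (\<lambda>n p q. Sum_any (\<lambda>r. f r n p (q - r)))" and "finite {r. f r n p (q - r) \<noteq> 0}"
proof -
  have supp: "f r n p (q - r) = 0" if "r \<notin> {r0..q - q0}" for r n p q
    using that r0 q0 by (cases "r < r0") auto
  then have "{r. f r n p (q - r) \<noteq> 0} \<subseteq> {r0..q - q0}" by blast
  then show "finite {r. f r n p (q - r) \<noteq> 0}" by (rule finite_subset) simp
  have "\<exists>p0. \<forall>p<p0. \<forall>n. Sum_any (\<lambda>r. f r n p (q - r)) = 0" for q
  proof -
    have "\<exists>p0. \<forall>r\<in>{r0..q - q0}. \<forall>p<p0. \<forall>r' n. f r' n p (q - r) = 0"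
      by (rule uniform_lower_bound) (use p0 in auto)
    then obtain p0 where "\<forall>r\<in>{r0..q - q0}. \<forall>p<p0. \<forall>r' n. f r' n p (q - r) = 0" by blast
    then have "\<forall>p<p0. \<forall>n r. f r n p (q - r) = 0" using supp by blast
    then have "\<forall>p<p0. \<forall>n. Sum_any (\<lambda>r. f r n p (q - r)) = 0" by simp
    then show ?thesis ..
  qed
  moreover have "\<forall>n<n0. \<forall>p q. Sum_any (\<lambda>r. f r n p (q - r)) = 0" using n0 by simp
  moreover have "\<forall>q<q0 + r0. \<forall>n p. Sum_any (\<lambda>r. f r n p (q - r)) = 0"
  proof (intro allI impI)
    fix q n p assume "q < q0 + r0"
    then have "f r n p (q - r) = 0" for r by (intro supp) auto
    then show "Sum_any (\<lambda>r. f r n p (q - r)) = 0" by simp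
  qed
  ultimately show "expandable (\<lambda>n p q. Sum_any (\<lambda>r. f r n p (q - r)))" unfolding expandable_def by blast
qed

lemma conv_expandable':
  fixes f :: "int \<Rightarrow> int \<Rightarrow> int \<Rightarrow> int \<Rightarrow> 'k::comm_monoid_add"
  assumes n0: "\<forall>n<n0. \<forall>r p q. f r n p q = 0" and r0: "\<forall>r<r0. \<forall>n p q. f r n p q = 0"
    and p0: "\<forall>p<p0. \<forall>r n q. f r n p q = 0" and q0: "\<forall>p. \<exists>q0. \<forall>q<q0. \<forall>r n. f r n p q = 0"
  shows "expandable (\<lambda>n q p. Sum_any (\<lambda>r. f r n p (q - r)))" and "finite {r. f r n p (q - r) \<noteq> 0}"
proof -
  obtain Q where Q: "\<And>p q r n. q < Q p \<Longrightarrow> f r n p q = 0" using q0 by metis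
  have supp: "f r n p (q - r) = 0" if "r \<notin> {r0..q - Q p}" for r n p q
    using that r0 Q by (cases "r < r0") auto
  then have "{r. f r n p (q - r) \<noteq> 0} \<subseteq> {r0..q - Q p}" by blast
  then show "finite {r. f r n p (q - r) \<noteq> 0}" by (rule finite_subset) simp
  have "\<forall>q<Q p + r0. \<forall>n. Sum_any (\<lambda>r. f r n p (q - r)) = 0" for p
  proof (intro allI impI)
    fix q n assume "q < Q p + r0"
    then have "f r n p (q - r) = 0" for r by (intro supp) auto
    then show "Sum_any (\<lambda>r. f r n p (q - r)) = 0" by simp
  qed
  moreover have "\<forall>n<n0. \<forall>p q. Sum_any (\<lambda>r. f r n p (q - r)) = 0" using n0 by simp
  moreover have "\<forall>p<p0. \<forall>n q. Sum_any (\<lambda>r. f r n p (q - r)) = 0" using p0 by simp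
  ultimately show "expandable (\<lambda>n q p. Sum_any (\<lambda>r. f r n p (q - r)))" unfolding expandable_def by blast
qed

lemma expansion_plus:
  assumes "expandable F" "expandable G"
  shows "expansion c (\<lambda>n p q. F n p q + G n p q) p q = expansion c F p q + expansion c G p q"
proof -
  have "expansion c (\<lambda>n p q. F n p q + G n p q) p q
      = Sum_any (\<lambda>x. (case x of (i, j) \<Rightarrow> bincoef c i j * F (i + int j) (p - i) (q - int j))
        + (case x of (i, j) \<Rightarrow> bincoef c i j * G (i + int j) (p - i) (q - int j)))"
    unfolding expansion_def by (intro Sum_any.cong) (auto simp: algebra_simps)
  also have "\<dots> = expansion c F p q + expansion c G p q"
    unfolding expansion_def by (rule Sum_any_add; rule finite_expansion_support) (use assms in auto)
  finally show ?thesis .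
qed

lemma expansion_delta: "expansion c (\<lambda>n p q. if n = 0 then f p q else 0) = f"
proof (intro ext)
  fix p q
  have "bincoef c i j * (if i + int j = 0 then f (p - i) (q - int j) else 0) = 0" if "(i, j) \<noteq> (0, 0)" for i j
  proof (cases "i + int j = 0")
    case True
    then have "0 < j" using that by (cases j) auto
    then show ?thesis using True by (cases j) (simp_all add: bincoef_def)
  qed simp
  then have "expansion c (\<lambda>n p q. if n = 0 then f p q else 0) p q
     = (\<Sum>(i, j)\<in>{(0, 0)}. bincoef c i j * (if i + int j = 0 then f (p - i) (q - int j) else 0))"
    unfolding expansion_def by (intro Sum_any_eq_sum) (simp_all only: finite.intros split_paired_all insert_iff empty_iff prod.case simp_thms)
  then show "expansion c (\<lambda>n p q. if n = 0 then f p q else 0) p q = f p q" by simp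
qed

section \<open>Topologically free modules and their functionals\<close>

definition ccoord :: "'b \<Rightarrow> ('b, 'k::comm_ring_1) cfree \<Rightarrow> 'k fps" where
  "ccoord b t = Abs_fps (\<lambda>n. Poly_Mapping.lookup (fps_nth t n) b)"

lemma nth_ccoord [simp]: "fps_nth (ccoord b t) n = Poly_Mapping.lookup (fps_nth t n) b"
  by (simp add: ccoord_def)

lemma cfree_eqI: "(\<And>b. ccoord b s = ccoord b t) \<Longrightarrow> s = t"
  by (rule fps_ext, rule poly_mapping_eqI) (metis nth_ccoord)

lemma lookup_map_mult: "Poly_Mapping.lookup (Poly_Mapping.map ((*) c) p) b = (c::'k::comm_ring_1) * Poly_Mapping.lookup p b"
  by (simp add: Poly_Mapping.map.rep_eq when_def)

lemma ccoord_cscale [simp]: "ccoord b (cscale c t) = c * ccoord b t"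
  by (rule fps_ext) (simp add: cscale_def lookup_sum lookup_map_mult fps_mult_nth atLeast0AtMost)

lemma ccoord_add [simp]: "ccoord b (s + t) = ccoord b s + ccoord b t"
  by (rule fps_ext) (simp add: lookup_add)

lemma ccoord_zero [simp]: "ccoord b 0 = 0"
  by (rule fps_ext) simp

lemma ccoord_diff [simp]: "ccoord b (s - t) = ccoord b s - ccoord b t"
  by (rule fps_ext) (simp add: lookup_minus)

lemma ccoord_sum: "ccoord b (sum f A) = (\<Sum>a\<in>A. ccoord b (f a))"
  by (induction A rule: infinite_finite_induct) auto

lemma ccoord_cbasis [simp]: "ccoord b (cbasis a :: ('b, 'k::comm_ring_1) cfree) = (if a = b then 1 else 0)"
  by (rule fps_ext) (simp add: cbasis_def lookup_single when_def)

lemma module_cscale: "module (cscale :: 'k::comm_ring_1 fps \<Rightarrow> ('b, 'k) cfree \<Rightarrow> _)"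
  by unfold_locales (rule cfree_eqI, simp add: algebra_simps)+

lemma ccoord_clift:
  assumes "finite K" and "\<And>m. m \<le> n \<Longrightarrow> Poly_Mapping.keys (fps_nth t m) \<subseteq> K"
  shows "fps_nth (ccoord c (clift F t)) n = (\<Sum>b\<in>K. fps_nth (ccoord b t * ccoord c (F b)) n)"
proof -
  have "fps_nth (ccoord c (clift F t)) n = (\<Sum>m\<le>n. \<Sum>b\<in>Poly_Mapping.keys (fps_nth t m).
      Poly_Mapping.lookup (fps_nth t m) b * Poly_Mapping.lookup (fps_nth (F b) (n - m)) c)"
    by (simp add: clift_def lookup_sum lookup_map_mult)
  also have "\<dots> = (\<Sum>m\<le>n. \<Sum>b\<in>K.
      Poly_Mapping.lookup (fps_nth t m) b * Poly_Mapping.lookup (fps_nth (F b) (n - m)) c)"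
    by (intro sum.cong refl sum.mono_neutral_left) (use assms in \<open>auto simp: in_keys_iff\<close>)
  also have "\<dots> = (\<Sum>b\<in>K. fps_nth (ccoord b t * ccoord c (F b)) n)"
    by (subst sum.swap) (simp add: fps_mult_nth atLeast0AtMost)
  finally show ?thesis .
qed

lemma clift_hom: "module_hom cscale cscale (clift F :: ('b, 'k::comm_ring_1) cfree \<Rightarrow> ('c, 'k) cfree)"
proof -
  have add: "clift F (s + t) = clift F s + clift F t" for s t :: "('b, 'k) cfree"
  proof (rule cfree_eqI, rule fps_ext)
    fix c n
    define K where "K = (\<Union>m\<le>n. Poly_Mapping.keys (fps_nth s m)) \<union> (\<Union>m\<le>n. Poly_Mapping.keys (fps_nth t m))"
    have K: "finite K" unfolding K_def by simp
    have "Poly_Mapping.keys (fps_nth s m) \<subseteq> K" "Poly_Mapping.keys (fps_nth t m) \<subseteq> K"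
      "Poly_Mapping.keys (fps_nth (s + t) m) \<subseteq> K" if "m \<le> n" for m
      using that Poly_Mapping.keys_add [of "fps_nth s m" "fps_nth t m"] by (auto simp: K_def)
    then show "fps_nth (ccoord c (clift F (s + t))) n = fps_nth (ccoord c (clift F s + clift F t)) n"
      using K by (simp only: ccoord_add fps_add_nth ccoord_clift sum.distrib [symmetric] distrib_right)
  qed
  have scale: "clift F (cscale a t) = cscale a (clift F t)" for a and t :: "('b, 'k) cfree"
  proof (rule cfree_eqI, rule fps_ext)
    fix c n
    define K where "K = (\<Union>m\<le>n. Poly_Mapping.keys (fps_nth (cscale a t) m)) \<union> (\<Union>m\<le>n. Poly_Mapping.keys (fps_nth t m))"
    have K: "finite K" unfolding K_def by simp
    have k: "Poly_Mapping.keys (fps_nth (cscale a t) m) \<subseteq> K" "Poly_Mapping.keys (fps_nth t m) \<subseteq> K" if "m \<le> n" for m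
      using that by (auto simp: K_def)
    have "fps_nth (ccoord c (clift F (cscale a t))) n = (\<Sum>b\<in>K. fps_nth (a * (ccoord b t * ccoord c (F b))) n)"
      using K k by (subst ccoord_clift) (auto simp: mult.assoc)
    also have "\<dots> = (\<Sum>b\<in>K. \<Sum>i\<le>n. fps_nth a i * fps_nth (ccoord b t * ccoord c (F b)) (n - i))"
      by (simp only: fps_mult_nth [of a] atLeast0AtMost)
    also have "\<dots> = (\<Sum>i\<le>n. fps_nth a i * (\<Sum>b\<in>K. fps_nth (ccoord b t * ccoord c (F b)) (n - i)))"
      by (subst sum.swap) (simp only: sum_distrib_left)
    also have "\<dots> = (\<Sum>i\<le>n. fps_nth a i * fps_nth (ccoord c (clift F t)) (n - i))"
    proof (intro sum.cong refl arg_cong2 [of _ _ _ _ "(*)"])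
      fix i assume "i \<in> {..n}"
      show "(\<Sum>b\<in>K. fps_nth (ccoord b t * ccoord c (F b)) (n - i)) = fps_nth (ccoord c (clift F t)) (n - i)"
        by (rule ccoord_clift [symmetric]) (use K k in auto)
    qed
    also have "\<dots> = fps_nth (ccoord c (cscale a (clift F t))) n"
      by (simp only: fps_mult_nth [of a] atLeast0AtMost ccoord_cscale)
    finally show "fps_nth (ccoord c (clift F (cscale a t))) n = fps_nth (ccoord c (cscale a (clift F t))) n" .
  qed
  show ?thesis
    by (simp add: module_hom_iff module_cscale add scale)
qed

lemma clift_cbasis [simp]: "clift F (cbasis b) = F b"
proof (rule cfree_eqI, rule fps_ext)
  fix c n
  have "fps_nth (ccoord c (clift F (cbasis b))) n = (\<Sum>b'\<in>{b}. fps_nth (ccoord b' (cbasis b) * ccoord c (F b')) n)"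
    by (rule ccoord_clift) (auto simp: cbasis_def split: if_splits)
  then show "fps_nth (ccoord c (clift F (cbasis b))) n = fps_nth (ccoord c (F b)) n" by simp
qed

lemma nth_cscale_X_power:
  "fps_nth (cscale (fps_X ^ M) t) n = (if n < M then 0 else fps_nth (t :: ('b, 'k::comm_ring_1) cfree) (n - M))"
proof (rule poly_mapping_eqI)
  fix b
  have "fps_nth (ccoord b (cscale (fps_X ^ M) t)) n = (if n < M then 0 else fps_nth (ccoord b t) (n - M))"
    unfolding ccoord_cscale by (rule fps_X_power_mult_nth)
  then show "Poly_Mapping.lookup (fps_nth (cscale (fps_X ^ M) t) n) b =
      Poly_Mapping.lookup (if n < M then 0 else fps_nth t (n - M)) b" by (simp del: ccoord_cscale)
qed

lemma hdvd_cscale_iff: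
  "hdvd cscale M (x :: ('b, 'k::comm_ring_1) cfree) \<longleftrightarrow> (\<forall>m<M. fps_nth x m = 0)"
proof
  assume "\<forall>m<M. fps_nth x m = 0"
  then have "x = cscale (fps_X ^ M) (Abs_fps (\<lambda>n. fps_nth x (n + M)))"
    by (intro fps_ext) (simp add: nth_cscale_X_power)
  then show "hdvd cscale M x" unfolding hdvd_def by blast
qed (auto simp: hdvd_def nth_cscale_X_power)

text \<open>
  A \<open>k\<close>-linear functional that vanishes on multiples of \<open>h^M\<close>.  It is only \<open>k\<close>-linear, so that
  reduction modulo \<open>h^M\<close> can be tested with values in the field \<open>k\<close>.
\<close>

definition hfun :: "('k::comm_ring_1 fps \<Rightarrow> 'm::ab_group_add \<Rightarrow> 'm) \<Rightarrow> nat \<Rightarrow> ('m \<Rightarrow> 'k) \<Rightarrow> bool" where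
  "hfun s M l \<longleftrightarrow> (\<forall>x y. l (x + y) = l x + l y) \<and> (\<forall>c x. l (s (fps_const c) x) = c * l x)
     \<and> (\<forall>x. l (s (fps_X ^ M) x) = 0)"

lemma
  assumes "hfun s M l"
  shows hfun_add: "l (x + y) = l x + l y"
    and hfun_scale: "l (s (fps_const c) x) = c * l x"
    and hfun_X: "l (s (fps_X ^ M) x) = 0"
    and hfun_hdvd: "hdvd s M x \<Longrightarrow> l x = 0"
  using assms by (auto simp: hfun_def hdvd_def)

lemma hfun_zero: "hfun s M l \<Longrightarrow> l 0 = 0"
  using hfun_add [of s M l 0 0] by simp

lemma hfun_uminus: "hfun s M l \<Longrightarrow> l (- x) = - l x"
  using hfun_add [of s M l x "- x"] hfun_zero [of s M l] by (simp add: eq_neg_iff_add_eq_0 add.commute)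

lemma hfun_diff: "hfun s M l \<Longrightarrow> l (x - y) = l x - l y"
  using hfun_add [of s M l x "- y"] hfun_uminus [of s M l y] by simp

lemma hfun_sum: "hfun s M l \<Longrightarrow> l (sum f A) = (\<Sum>a\<in>A. l (f a))"
  by (induction A rule: infinite_finite_induct) (auto simp: hfun_zero hfun_add)

lemma hfun_hcong: "hfun s M l \<Longrightarrow> hcong s M x y \<Longrightarrow> l x = l y"
  using hfun_hdvd [of s M l "x - y"] hfun_diff [of s M l x y] by (simp add: hcong_def)

lemma hfun_comp:
  assumes "module_hom s1 s2 f" and "hfun s2 M l"
  shows "hfun s1 M (\<lambda>x. l (f x))"
  using assms by (auto simp: hfun_def module_hom_iff)

lemma hom_hdvd: "module_hom s1 s2 f \<Longrightarrow> hdvd s1 M x \<Longrightarrow> hdvd s2 M (f x)"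
  by (auto simp: hdvd_def module_hom_iff)

lemma hfun_Suc_X:
  assumes "module s" and l: "hfun s (Suc M) l"
  shows "hfun s M (\<lambda>x. l (s fps_X x))"
proof -
  interpret m: module s by (rule assms(1))
  have "l (s fps_X (s (fps_const c) x)) = c * l (s fps_X x)" for c x
    using hfun_scale [OF l, of c "s fps_X x"] by (simp add: mult.commute)
  moreover have "l (s fps_X (s (fps_X ^ M) x)) = 0" for x
    using hfun_X [OF l, of x] by simp
  ultimately show ?thesis
    unfolding hfun_def by (simp add: m.scale_right_distrib hfun_add [OF l] del: m.scale_scale)
qed

text \<open>
  Modulo \<open>h^M\<close> a vector is a finite \<open>k\<close>-linear combination of the vectors \<open>h^m b\<close> with \<open>m < M\<close> and \<open>b\<close> in
  the basis.
\<close>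

lemma hfun_expand:
  fixes l :: "('b, 'k::comm_ring_1) cfree \<Rightarrow> 'k"
  assumes l: "hfun cscale M l" and K: "finite K" "\<And>m. m < M \<Longrightarrow> Poly_Mapping.keys (fps_nth u m) \<subseteq> K"
  shows "l u = (\<Sum>m<M. \<Sum>b\<in>K. fps_nth (ccoord b u) m * l (cscale (fps_X ^ m) (cbasis b)))"
proof -
  let ?v = "\<Sum>m<M. \<Sum>b\<in>K. cscale (fps_const (fps_nth (ccoord b u) m)) (cscale (fps_X ^ m) (cbasis b))"
  have "hdvd cscale M (u - ?v)"
    unfolding hdvd_cscale_iff
  proof (intro allI impI poly_mapping_eqI)
    fix n c assume n: "n < M"
    have "fps_nth (ccoord c ?v) n = (\<Sum>m<M. \<Sum>b\<in>K. if m = n \<and> b = c then fps_nth (ccoord b u) m else 0)"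
      unfolding ccoord_sum fps_sum_nth ccoord_cscale ccoord_cbasis
      by (intro sum.cong refl) (simp add: fps_X_power_nth)
    also have "\<dots> = (\<Sum>m<M. if m = n then (\<Sum>b\<in>K. if b = c then fps_nth (ccoord b u) n else 0) else 0)"
      by (intro sum.cong refl) auto
    also have "\<dots> = (\<Sum>b\<in>K. if b = c then fps_nth (ccoord b u) n else 0)"
      using n by (simp add: sum.delta)
    also have "\<dots> = fps_nth (ccoord c u) n"
      using K(1) K(2) [OF n] by (auto simp: sum.delta in_keys_iff subset_iff)
    finally show "Poly_Mapping.lookup (fps_nth (u - ?v) n) c = Poly_Mapping.lookup 0 c"
      using ccoord_diff [of c u ?v] by (simp add: lookup_minus)
  qed
  then have "l u = l ?v" using hfun_hcong [OF l] by (simp add: hcong_def)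
  also have "\<dots> = (\<Sum>m<M. \<Sum>b\<in>K. fps_nth (ccoord b u) m * l (cscale (fps_X ^ m) (cbasis b)))"
    by (simp only: hfun_sum [OF l] hfun_scale [OF l])
  finally show ?thesis .
qed

lemma hfun_binmult:
  assumes "hfun s M l"
  shows "l (binmult s c N X p q) = (linmul c ^^ N) (\<lambda>p q. l (X p q)) p q"
  unfolding binmult_def linmul_pow_eq_sum hfun_sum [OF assms] hfun_scale [OF assms] ..

definition hsummable :: "('k::comm_ring_1 fps \<Rightarrow> 'm::ab_group_add \<Rightarrow> 'm) \<Rightarrow> ('i \<Rightarrow> 'm) \<Rightarrow> bool" where
  "hsummable s f \<longleftrightarrow> (\<forall>M. finite {i. \<not> hdvd s M (f i)})"

lemma hsummable_support: "hsummable s f \<Longrightarrow> hfun s M l \<Longrightarrow> finite {i. l (f i) \<noteq> 0}"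
  by (rule finite_subset [of _ "{i. \<not> hdvd s M (f i)}"]) (auto simp: hsummable_def dest: hfun_hdvd)

lemma hdvd_mono:
  assumes "module s" and "hdvd s M x" and "m \<le> M"
  shows "hdvd s m x"
proof -
  obtain y where "x = s (fps_X ^ M) y" using assms(2) unfolding hdvd_def by blast
  also have "\<dots> = s (fps_X ^ m) (s (fps_X ^ (M - m)) y)"
    using assms(1,3) by (simp add: module.scale_scale flip: power_add)
  finally show ?thesis unfolding hdvd_def by blast
qed

context topologically_free
begin

lemma hom_\<phi>_inv: "module_hom cscale scale (inv \<phi>)"
  by (rule bij_module_hom_imp_inv_module_hom [OF linear_\<phi> bij_\<phi>])

lemma \<phi>_inv [simp]: "\<phi> (inv \<phi> x) = x"
  by (simp add: bij_\<phi> bij_is_surj surj_f_inv_f)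

lemma inv_\<phi> [simp]: "inv \<phi> (\<phi> x) = x"
  by (simp add: bij_\<phi> bij_is_inj)

lemma hdvd_iff: "hdvd scale M x \<longleftrightarrow> hdvd cscale M (\<phi> x)"
  using hom_hdvd [OF linear_\<phi>, of M x] hom_hdvd [OF hom_\<phi>_inv, of M "\<phi> x"] by auto

text \<open>
  The coefficients of \<open>h^m\<close> in the coordinates, for \<open>m < M\<close>, are enough functionals to detect divisibility
  by \<open>h^M\<close>.
\<close>

lemma hfun_coordinate:
  assumes "m < M"
  shows "hfun scale M (\<lambda>x. fps_nth (ccoord b (\<phi> x)) m)"
proof -
  interpret p: module_hom scale cscale \<phi> by (rule linear_\<phi>)
  show ?thesis
    unfolding hfun_def p.add p.scale ccoord_add ccoord_cscale fps_X_power_mult_nth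
    using assms by (simp del: nth_ccoord)
qed

lemma hdvd_iff_hfun: "hdvd scale M x \<longleftrightarrow> (\<forall>l. hfun scale M l \<longrightarrow> l x = 0)"
proof
  assume *: "\<forall>l. hfun scale M l \<longrightarrow> l x = 0"
  show "hdvd scale M x"
    unfolding hdvd_iff hdvd_cscale_iff
  proof (intro allI impI poly_mapping_eqI)
    fix m b assume "m < M"
    then have "fps_nth (ccoord b (\<phi> x)) m = 0"
      using * hfun_coordinate by blast
    then show "Poly_Mapping.lookup (fps_nth (\<phi> x) m) b = Poly_Mapping.lookup 0 b" by simp
  qed
qed (auto dest: hfun_hdvd)

lemma hcong_iff_hfun: "hcong scale M x y \<longleftrightarrow> (\<forall>l. hfun scale M l \<longrightarrow> l x = l y)"
proof -
  have "l (x - y) = 0 \<longleftrightarrow> l x = l y" if "hfun scale M l" for l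
    using hfun_diff [OF that, of x y] by simp
  then show ?thesis unfolding hcong_def hdvd_iff_hfun by blast
qed

lemma hfun_eqI:
  assumes "\<And>M l. hfun scale M l \<Longrightarrow> l x = l y"
  shows "x = y"
proof -
  have "\<phi> x = \<phi> y"
  proof (rule cfree_eqI, rule fps_ext)
    fix b m
    show "fps_nth (ccoord b (\<phi> x)) m = fps_nth (ccoord b (\<phi> y)) m"
      by (rule assms [OF hfun_coordinate [OF lessI]])
  qed
  then show ?thesis by (metis inv_\<phi>)
qed

lemma has_hsum_hfun:
  assumes "has_hsum scale f x" and l: "hfun scale M l"
  shows "\<exists>F. finite F \<and> (\<forall>G. finite G \<longrightarrow> F \<subseteq> G \<longrightarrow> (\<Sum>i\<in>G. l (f i)) = l x)"
proof -
  from assms(1) [unfolded has_hsum_def, THEN spec, of M] obtain F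
    where F: "finite F" "\<forall>G. finite G \<and> F \<subseteq> G \<longrightarrow> hcong scale M (sum f G) x"
    by (elim exE conjE that)
  have "(\<Sum>i\<in>G. l (f i)) = l x" if "finite G" "F \<subseteq> G" for G
    using hfun_hcong [OF l F(2) [THEN spec, THEN mp, OF conjI [OF that]]] hfun_sum [OF l, of f G] by simp
  then show ?thesis using F(1) by blast
qed

lemma has_hsum_unique:
  assumes "has_hsum scale f x" and "has_hsum scale f y"
  shows "x = y"
proof (rule hfun_eqI)
  fix M l assume l: "hfun scale M l"
  obtain F where F: "finite F" "\<forall>G. finite G \<longrightarrow> F \<subseteq> G \<longrightarrow> (\<Sum>i\<in>G. l (f i)) = l x"
    using has_hsum_hfun [OF assms(1) l] by blast
  obtain F' where F': "finite F'" "\<forall>G. finite G \<longrightarrow> F' \<subseteq> G \<longrightarrow> (\<Sum>i\<in>G. l (f i)) = l y"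
    using has_hsum_hfun [OF assms(2) l] by blast
  have "l x = (\<Sum>i\<in>F \<union> F'. l (f i))" using F F'(1) by simp
  also have "\<dots> = l y" using F' F(1) by simp
  finally show "l x = l y" .
qed

lemma hsum_eqI: "has_hsum scale f x \<Longrightarrow> hsum scale f = x"
  unfolding hsum_def using has_hsum_unique by blast

text \<open>
  Completeness: the coefficient of \<open>h^m\<close> of the sum involves only the finitely many terms that are not
  divisible by \<open>h^(m + 1)\<close>.
\<close>

lemma has_hsum_hsum:
  assumes "hsummable scale f"
  shows "has_hsum scale f (hsum scale f)"
proof -
  define F where "F M = {i. \<not> hdvd scale M (f i)}" for M
  have fin: "finite (F M)" for M using assms by (simp add: hsummable_def F_def)
  have mono: "F m \<subseteq> F M" if "m \<le> M" for m M
    using hdvd_mono [OF module_axioms] that by (auto simp: F_def)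
  define x where "x = inv \<phi> (Abs_fps (\<lambda>m. \<Sum>i\<in>F (Suc m). fps_nth (\<phi> (f i)) m))"
  interpret p: module_hom scale cscale \<phi> by (rule linear_\<phi>)
  have "has_hsum scale f x"
    unfolding has_hsum_def
  proof (intro allI exI conjI impI)
    fix M G assume G: "finite G \<and> F M \<subseteq> G"
    show "hcong scale M (sum f G) x"
      unfolding hcong_def hdvd_iff hdvd_cscale_iff
    proof (intro allI impI)
      fix m assume m: "m < M"
      have "fps_nth (\<phi> (f i)) m = 0" if "i \<notin> F (Suc m)" for i
        using that by (auto simp: F_def hdvd_iff hdvd_cscale_iff)
      then have "(\<Sum>i\<in>F (Suc m). fps_nth (\<phi> (f i)) m) = (\<Sum>i\<in>G. fps_nth (\<phi> (f i)) m)"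
        using G mono [of "Suc m" M] m by (intro sum.mono_neutral_left) auto
      then show "fps_nth (\<phi> (sum f G - x)) m = 0"
        by (simp add: p.diff p.sum x_def fps_sum_nth)
    qed
  qed (rule fin)
  then show ?thesis using hsum_eqI by metis
qed

lemma hfun_hsum:
  assumes f: "hsummable scale f" and l: "hfun scale M l"
  shows "l (hsum scale f) = Sum_any (\<lambda>i. l (f i))"
proof -
  obtain F where F: "finite F" "\<forall>G. finite G \<longrightarrow> F \<subseteq> G \<longrightarrow> (\<Sum>i\<in>G. l (f i)) = l (hsum scale f)"
    using has_hsum_hfun [OF has_hsum_hsum [OF f] l] by blast
  define G where "G = F \<union> {i. l (f i) \<noteq> 0}"
  have G: "finite G" using F(1) hsummable_support [OF f l] by (simp add: G_def)
  then have "l (hsum scale f) = (\<Sum>i\<in>G. l (f i))"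
    using F(2) by (simp add: G_def)
  also have "\<dots> = Sum_any (\<lambda>i. l (f i))"
    by (rule Sum_any_eq_sum [symmetric]) (use G in \<open>auto simp: G_def\<close>)
  finally show ?thesis .
qed

lemma hom_hsum:
  assumes hom: "\<And>i. module_hom s scale (f i)" and sm: "\<And>x. hsummable scale (\<lambda>i. f i x)"
    and "module s"
  shows "module_hom s scale (\<lambda>x. hsum scale (\<lambda>i. f i x))"
  unfolding module_hom_iff
proof (intro conjI allI)
  fix x y
  show "hsum scale (\<lambda>i. f i (x + y)) = hsum scale (\<lambda>i. f i x) + hsum scale (\<lambda>i. f i y)"
  proof (rule hfun_eqI)
    fix M l assume l: "hfun scale M l"
    show "l (hsum scale (\<lambda>i. f i (x + y))) = l (hsum scale (\<lambda>i. f i x) + hsum scale (\<lambda>i. f i y))"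
      unfolding hfun_add [OF l] hfun_hsum [OF sm l]
      using hom Sum_any_add [OF hsummable_support [OF sm l] hsummable_support [OF sm l], of x y]
      by (simp add: hfun_add [OF l] module_hom_iff)
  qed
next
  fix c x
  show "hsum scale (\<lambda>i. f i (s c x)) = scale c (hsum scale (\<lambda>i. f i x))"
  proof (rule hfun_eqI)
    fix M l assume l: "hfun scale M l"
    show "l (hsum scale (\<lambda>i. f i (s c x))) = l (scale c (hsum scale (\<lambda>i. f i x)))"
      unfolding hfun_hsum [OF sm l] hfun_hsum [OF sm hfun_comp [OF module_hom_scale_self l]]
      using hom by (simp add: module_hom_iff)
  qed
qed (use assms module_axioms in auto)

text \<open>
  A \<open>k[[h]]\<close>-linear map is determined by its values on the basis, because it is automatically
  \<open>h\<close>-adically continuous.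
\<close>

lemma hom_ext:
  assumes "module_hom cscale scale f" and "module_hom cscale scale g"
    and "\<And>b. f (cbasis b) = g (cbasis b)"
  shows "f x = g x"
proof (rule hfun_eqI)
  fix M l assume l: "hfun scale M l"
  define K where "K = (\<Union>m<M. Poly_Mapping.keys (fps_nth x m))"
  have K: "finite K" "\<And>m. m < M \<Longrightarrow> Poly_Mapping.keys (fps_nth x m) \<subseteq> K"
    unfolding K_def by auto
  show "l (f x) = l (g x)"
    using hfun_expand [OF hfun_comp [OF assms(1) l] K] hfun_expand [OF hfun_comp [OF assms(2) l] K]
      assms by (simp add: module_hom_iff)
qed

end

interpretation cfree: topologically_free cscale "\<lambda>x. x :: ('b, 'k::field_char_0) cfree"
  by (auto simp: topologically_free_def topologically_free_axioms_def module_cscale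
      module.module_hom_ident [OF module_cscale] bij_id [unfolded id_def])

lemma hom_comp: "module_hom s1 s2 f \<Longrightarrow> module_hom s2 s3 g \<Longrightarrow> module_hom s1 s3 (\<lambda>x. g (f x))"
  using module_hom_compose [of s1 s2 f s3 g] by (simp add: o_def)

lemma hom_plus:
  "module_hom s1 s2 f \<Longrightarrow> module_hom s1 s2 g \<Longrightarrow> module_hom s1 s2 (\<lambda>x. f x + g x)"
  by (simp add: module_hom_iff module.scale_right_distrib add_ac)

lemma hom_scaled: "module_hom s1 s2 f \<Longrightarrow> module_hom s1 s2 (\<lambda>x. s2 c (f x))"
  by (simp add: module_hom_iff module.scale_scale module.scale_right_distrib mult.commute)

lemma hom_clift:
  fixes G :: "('c, 'k::field_char_0) cfree \<Rightarrow> ('d, 'k) cfree"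
  assumes "module_hom cscale cscale G"
  shows "G (clift F t) = clift (\<lambda>b. G (F b)) t"
  by (rule cfree.hom_ext [OF hom_comp [OF clift_hom assms] clift_hom]) simp

lemma clift_param_hom:
  fixes \<Phi> :: "'b \<Rightarrow> 'v::ab_group_add \<Rightarrow> ('c, 'k::field_char_0) cfree"
  assumes "\<And>a. module_hom s cscale (\<Phi> a)" and "module s"
  shows "module_hom s cscale (\<lambda>x. clift (\<lambda>a. \<Phi> a x) t)"
  unfolding module_hom_iff
proof (intro conjI allI)
  fix x y
  show "clift (\<lambda>a. \<Phi> a (x + y)) t = clift (\<lambda>a. \<Phi> a x) t + clift (\<lambda>a. \<Phi> a y) t"
    by (rule cfree.hom_ext [OF clift_hom hom_plus [OF clift_hom clift_hom]])
       (use assms(1) in \<open>simp add: module_hom_iff\<close>)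
next
  fix c x
  show "clift (\<lambda>a. \<Phi> a (s c x)) t = cscale c (clift (\<lambda>a. \<Phi> a x) t)"
    by (rule cfree.hom_ext [OF clift_hom hom_scaled [OF clift_hom]])
       (use assms(1) in \<open>simp add: module_hom_iff\<close>)
qed (use assms(2) module_cscale in auto)

section \<open>Families of finite type\<close>

text \<open>
  A family of vectors that, modulo \<open>h^M\<close>, stays in the span of finitely many basis vectors.  Bounds that
  are known for each basis vector separately become uniform on such a family.  The coefficients of \<open>S(z) t\<close>
  form such a family because \<open>S(z) t\<close> lies in a tensor product with \<open>k((z))\<close>, not merely in \<open>(V \<otimes> V)((z))\<close>.
\<close>

definition fin_type :: "nat \<Rightarrow> ('i \<Rightarrow> ('b, 'k::comm_ring_1) cfree) \<Rightarrow> bool" where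
  "fin_type M u \<longleftrightarrow> (\<exists>K. finite K \<and> (\<forall>i. \<forall>m<M. Poly_Mapping.keys (fps_nth (u i) m) \<subseteq> K))"

lemma fin_type_const [simp]: "fin_type M (\<lambda>i. u)"
  unfolding fin_type_def by (rule exI [of _ "\<Union>m<M. Poly_Mapping.keys (fps_nth u m)"]) auto

lemma fin_type_reindex: "fin_type M u \<Longrightarrow> fin_type M (\<lambda>i. u (h i))"
  unfolding fin_type_def by (elim exE conjE, intro exI conjI) auto

lemma fin_type_diff: "fin_type M u \<Longrightarrow> fin_type M v \<Longrightarrow> fin_type M (\<lambda>i. u i - v i)"
  unfolding fin_type_def
proof (elim exE conjE)
  fix K L
  assume *: "finite K" "finite L" "\<forall>i. \<forall>m<M. Poly_Mapping.keys (fps_nth (u i) m) \<subseteq> K"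
    "\<forall>i. \<forall>m<M. Poly_Mapping.keys (fps_nth (v i) m) \<subseteq> L"
  have "Poly_Mapping.keys (fps_nth (u i - v i) m) \<subseteq> K \<union> L" if "m < M" for i m
    using * that keys_diff [of "fps_nth (u i) m" "fps_nth (v i) m"] by fastforce
  then show "\<exists>K. finite K \<and> (\<forall>i. \<forall>m<M. Poly_Mapping.keys (fps_nth (u i - v i) m) \<subseteq> K)"
    using * by (meson finite_UnI)
qed

lemma fin_type_hom:
  fixes \<Phi> :: "'j \<Rightarrow> ('b, 'k::field_char_0) cfree \<Rightarrow> ('c, 'k) cfree"
  assumes hom: "\<And>j. module_hom cscale cscale (\<Phi> j)" and u: "fin_type M u"
    and \<Phi>: "\<And>b. fin_type M (\<lambda>j. \<Phi> j (cbasis b))"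
  shows "fin_type M (\<lambda>(j, i). \<Phi> j (u i))"
proof -
  obtain K where K: "finite K" "\<And>i m. m < M \<Longrightarrow> Poly_Mapping.keys (fps_nth (u i) m) \<subseteq> K"
    using u unfolding fin_type_def by blast
  have "\<exists>L. \<forall>b. finite (L b) \<and> (\<forall>j. \<forall>m<M. Poly_Mapping.keys (fps_nth (\<Phi> j (cbasis b)) m) \<subseteq> L b)"
    using \<Phi> unfolding fin_type_def by (intro choice) blast
  then obtain L where L: "\<And>b. finite (L b)"
    "\<And>b j m. m < M \<Longrightarrow> Poly_Mapping.keys (fps_nth (\<Phi> j (cbasis b)) m) \<subseteq> L b" by blast
  have "Poly_Mapping.keys (fps_nth (\<Phi> j (u i)) m) \<subseteq> (\<Union>b\<in>K. L b)" if m: "m < M" for j i m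
  proof
    fix c assume c: "c \<in> Poly_Mapping.keys (fps_nth (\<Phi> j (u i)) m)"
    show "c \<in> (\<Union>b\<in>K. L b)"
    proof (rule ccontr)
      assume nc: "c \<notin> (\<Union>b\<in>K. L b)"
      have zero: "fps_nth (ccoord c (\<Phi> j (cscale (fps_X ^ m') (cbasis b)))) m = 0" if "b \<in> K" for m' b
      proof -
        have "fps_nth (ccoord c (\<Phi> j (cbasis b))) n = 0" if "n < M" for n
          using nc \<open>b \<in> K\<close> L(2) [OF that, of j b] by (auto simp: in_keys_iff)
        then show ?thesis
          using hom [of j] m by (simp add: module_hom_iff fps_X_power_mult_nth del: nth_ccoord)
      qed
      have "fps_nth (ccoord c (\<Phi> j (u i))) m = 0"
        using hfun_expand [OF hfun_comp [OF hom [of j] cfree.hfun_coordinate [OF m]] K(1), of "u i" c] K(2) [of _ i] zero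
        by (simp del: nth_ccoord)
      then show False using c by (simp add: in_keys_iff)
    qed
  qed
  moreover have "finite (\<Union>b\<in>K. L b)" using K(1) L(1) by blast
  ultimately show ?thesis unfolding fin_type_def by (intro exI [of _ "\<Union>b\<in>K. L b"]) auto
qed

lemma fin_type_map:
  fixes \<Phi> :: "('b, 'k::field_char_0) cfree \<Rightarrow> ('c, 'k) cfree"
  assumes "module_hom cscale cscale \<Phi>" and "fin_type M u"
  shows "fin_type M (\<lambda>i. \<Phi> (u i))"
  using fin_type_reindex [OF fin_type_hom [of "\<lambda>_::unit. \<Phi>" M u], of "\<lambda>i. ((), i)"] assms by simp

lemma (in topologically_free) uniform_hdvd:
  assumes hom: "\<And>p. module_hom cscale scale (f p)" and u: "fin_type M u"
    and f: "\<And>b. \<exists>p0::int. \<forall>p<p0. hdvd scale M (f p (cbasis b))"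
  shows "\<exists>p0. \<forall>p<p0. \<forall>i. hdvd scale M (f p (u i))"
proof -
  obtain K where K: "finite K" "\<And>i m. m < M \<Longrightarrow> Poly_Mapping.keys (fps_nth (u i) m) \<subseteq> K"
    using u unfolding fin_type_def by blast
  have "\<exists>p0. \<forall>b\<in>K. \<forall>p<p0. hdvd scale M (f p (cbasis b))"
    by (rule uniform_lower_bound [OF K(1)]) (use f in blast)
  then obtain p0 where p0: "\<And>b p. b \<in> K \<Longrightarrow> p < p0 \<Longrightarrow> hdvd scale M (f p (cbasis b))" by blast
  have "hdvd scale M (f p (u i))" if p: "p < p0" for p i
    unfolding hdvd_iff_hfun
  proof (intro allI impI)
    fix l assume l: "hfun scale M l"
    have "l (f p (cscale (fps_X ^ m) (cbasis b))) = 0" if "b \<in> K" for m b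
      using hfun_hdvd [OF hfun_comp [OF module_hom_scale_self l] p0 [OF that p]] hom [of p]
      by (simp add: module_hom_iff)
    then show "l (f p (u i)) = 0"
      using hfun_expand [OF hfun_comp [OF hom l] K, of p i] by simp
  qed
  then show ?thesis by blast
qed

lemma tensor_laurent_fin_type:
  assumes "tensor_laurent cscale (f :: int \<Rightarrow> ('b, 'k::field_char_0) cfree)"
  shows "fin_type M f" and "\<exists>n0. \<forall>n<n0. hdvd cscale M (f n)"
proof -
  obtain r x and g :: "nat \<Rightarrow> 'k fls" where
    *: "\<And>n. hcong cscale M (f n) (\<Sum>i<r. cscale (fps_const (fls_nth (g i) n)) (x i))"
    using assms unfolding tensor_laurent_def by (metis (no_types))
  have nth: "fps_nth (f n) m = fps_nth (\<Sum>i<r. cscale (fps_const (fls_nth (g i) n)) (x i)) m" if "m < M" for n m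
    using * [of n] that by (simp add: hcong_def hdvd_cscale_iff)
  have coef: "Poly_Mapping.lookup (fps_nth (f n) m) b
      = (\<Sum>i<r. fls_nth (g i) n * Poly_Mapping.lookup (fps_nth (x i) m) b)" if "m < M" for n m b
  proof -
    have "fps_nth (ccoord b (f n)) m = fps_nth (ccoord b (\<Sum>i<r. cscale (fps_const (fls_nth (g i) n)) (x i))) m"
      using nth [OF that] by simp
    also have "\<dots> = (\<Sum>i<r. fls_nth (g i) n * fps_nth (ccoord b (x i)) m)"
      unfolding ccoord_sum fps_sum_nth ccoord_cscale by (simp del: nth_ccoord)
    finally show ?thesis by simp
  qed
  have "Poly_Mapping.keys (fps_nth (f n) m) \<subseteq> (\<Union>i<r. \<Union>m<M. Poly_Mapping.keys (fps_nth (x i) m))"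
    if "m < M" for n m
  proof
    fix b assume "b \<in> Poly_Mapping.keys (fps_nth (f n) m)"
    then have "(\<Sum>i<r. fls_nth (g i) n * Poly_Mapping.lookup (fps_nth (x i) m) b) \<noteq> 0"
      using coef [OF that] by (simp add: in_keys_iff)
    then obtain i where "i < r" "Poly_Mapping.lookup (fps_nth (x i) m) b \<noteq> 0"
      by (metis (no_types, lifting) lessThan_iff mult_zero_right sum.neutral)
    then show "b \<in> (\<Union>i<r. \<Union>m<M. Poly_Mapping.keys (fps_nth (x i) m))"
      using that by (auto simp: in_keys_iff)
  qed
  then show "fin_type M f"
    unfolding fin_type_def
    by (intro exI [of _ "\<Union>i<r. \<Union>m<M. Poly_Mapping.keys (fps_nth (x i) m)"]) auto
  have "\<exists>n0. \<forall>i\<in>{..<r}. \<forall>n<n0. fls_nth (g i) n = 0"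
    by (rule uniform_lower_bound) (auto intro: fls_eq0_below_subdegree)
  then obtain n0 where "\<And>i n. i < r \<Longrightarrow> n < n0 \<Longrightarrow> fls_nth (g i) n = 0" by blast
  then have "\<forall>n<n0. hdvd cscale M (f n)"
    unfolding hdvd_cscale_iff by (auto intro!: poly_mapping_eqI simp: coef)
  then show "\<exists>n0. \<forall>n<n0. hdvd cscale M (f n)" ..
qed

text \<open>
  Division by \<open>h\<close>, dropping the constant term.
\<close>

definition hdiv :: "('b, 'k::comm_ring_1) cfree \<Rightarrow> ('b, 'k) cfree" where
  "hdiv x = Abs_fps (\<lambda>m. fps_nth x (Suc m))"

lemma cscale_hdiv: "hdvd cscale 1 x \<Longrightarrow> cscale fps_X (hdiv x) = x"
  using nth_cscale_X_power [of 1 "hdiv x"] by (intro fps_ext) (auto simp: hdiv_def hdvd_cscale_iff)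

lemma fin_type_hdiv: "fin_type (Suc M) u \<Longrightarrow> fin_type M (\<lambda>i. hdiv (u i))"
  unfolding fin_type_def hdiv_def by (elim exE conjE, intro exI conjI) auto

lemma hdvd_hdiv: "hdvd cscale (Suc M) x \<Longrightarrow> hdvd cscale M (hdiv x)"
  by (simp add: hdvd_cscale_iff hdiv_def)

lemma (in topologically_free) hdvd_hom_basis:
  assumes hom: "module_hom cscale scale D" and "\<And>b. hdvd scale M (D (cbasis b))"
  shows "hdvd scale M (D x)"
proof -
  obtain p0 :: int where "\<forall>p<p0. \<forall>i::unit. hdvd scale M (D x)"
    using uniform_hdvd [of "\<lambda>_. D" M "\<lambda>_::unit. x"] assms by auto
  then show ?thesis using lt_ex [of p0] by blast
qed

section \<open>Tensor factors and lower bounds\<close>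

text \<open>
  The common shape of \<open>S^{12}(z)\<close>, \<open>S^{13}(z)\<close> and \<open>S^{23}(z)\<close>: an operator-valued series with values in
  the tensor product with \<open>k((z))\<close>.
\<close>

definition operator_series :: "(int \<Rightarrow> ('c, 'k::field_char_0) cfree \<Rightarrow> ('d, 'k) cfree) \<Rightarrow> bool" where
  "operator_series \<Theta> \<longleftrightarrow> (\<forall>n. module_hom cscale cscale (\<Theta> n)) \<and>
     (\<forall>M b. fin_type M (\<lambda>n. \<Theta> n (cbasis b)) \<and> (\<exists>n0. \<forall>n<n0. hdvd cscale M (\<Theta> n (cbasis b))))"

lemma
  assumes "operator_series \<Theta>"
  shows operator_series_hom: "module_hom cscale cscale (\<Theta> n)"
    and operator_series_fin_type: "fin_type M u \<Longrightarrow> fin_type M (\<lambda>(n, i). \<Theta> n (u i))"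
    and operator_series_lower: "fin_type M u \<Longrightarrow> \<exists>n0. \<forall>n<n0. \<forall>i. hdvd cscale M (\<Theta> n (u i))"
proof -
  show hom: "module_hom cscale cscale (\<Theta> n)" for n using assms by (simp add: operator_series_def)
  show "fin_type M u \<Longrightarrow> fin_type M (\<lambda>(n, i). \<Theta> n (u i))"
    by (rule fin_type_hom [OF hom]) (use assms in \<open>simp_all add: operator_series_def\<close>)
  show "fin_type M u \<Longrightarrow> \<exists>n0. \<forall>n<n0. \<forall>i. hdvd cscale M (\<Theta> n (u i))"
    by (rule cfree.uniform_hdvd [OF hom]) (use assms in \<open>simp_all add: operator_series_def\<close>)
qed

lemma operator_series_single:
  assumes "operator_series \<Theta>"
  shows "fin_type M (\<lambda>n. \<Theta> n t)" and "\<exists>n0. \<forall>n<n0. hdvd cscale M (\<Theta> n t)"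
  using fin_type_reindex [OF operator_series_fin_type [OF assms fin_type_const [of M t]], of "\<lambda>n. (n, ())"]
    operator_series_lower [OF assms fin_type_const [of M t]] by simp_all

context topologically_free
begin

lemma \<phi>_vbasis [simp]: "\<phi> (vbasis \<phi> a) = cbasis a"
  by (simp add: vbasis_def)

lemma tens2_hom_left: "module_hom scale cscale (\<lambda>v. tens2 \<phi> v w)"
  unfolding tens2_def by (rule hom_comp [OF linear_\<phi> clift_hom])

lemma tens2_hom_right: "module_hom scale cscale (\<lambda>w. tens2 \<phi> v w)"
  unfolding tens2_def
  by (rule clift_param_hom [OF hom_comp [OF linear_\<phi> clift_hom] module_axioms])

lemma tens2_vbasis [simp]: "tens2 \<phi> (vbasis \<phi> a) (vbasis \<phi> b) = cbasis (a, b)"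
  by (simp add: tens2_def)

lemma tens3_vbasis [simp]: "tens3 \<phi> (vbasis \<phi> a) (vbasis \<phi> b) (vbasis \<phi> c) = cbasis (a, b, c)"
  by (simp add: tens3_def)

lemma vhom_ext:
  fixes f g :: "'v \<Rightarrow> ('c, 'k) cfree"
  assumes "module_hom scale cscale f" and "module_hom scale cscale g"
    and "\<And>b. f (vbasis \<phi> b) = g (vbasis \<phi> b)"
  shows "f x = g x"
  using cfree.hom_ext [OF hom_comp [OF hom_\<phi>_inv assms(1)] hom_comp [OF hom_\<phi>_inv assms(2)], of "\<phi> x"]
    assms(3) by (simp add: vbasis_def)

lemma scale_const_cancel:
  assumes "scale (fps_const c) x = scale (fps_const c) y" and "c \<noteq> 0"
  shows "x = y"
proof -
  have "scale (fps_const (1 / c)) (scale (fps_const c) x) = scale (fps_const (1 / c)) (scale (fps_const c) y)"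
    by (simp only: assms(1))
  then show ?thesis using assms(2) by simp
qed

lemma flip_tens2: "flip (tens2 \<phi> v (vbasis \<phi> b)) = tens2 \<phi> (vbasis \<phi> b) v"
  unfolding flip_def
  by (rule vhom_ext [OF hom_comp [OF tens2_hom_left clift_hom] tens2_hom_right]) simp

end

context braided_voa
begin

lemma Y_hom: "module_hom cscale scale (\<lambda>t. Y t n)"
  by (rule Y_linear)

lemma Y_left_hom: "module_hom cscale cscale (Y_left \<phi> Y n)"
  unfolding Y_left_def by (rule clift_hom)

lemma Y_right_hom: "module_hom cscale cscale (Y_right \<phi> Y n)"
  unfolding Y_right_def by (rule clift_hom)

lemma T_right_hom: "module_hom cscale cscale (T_right \<phi> T)"
  unfolding T_right_def by (rule clift_hom)

lemma flip_hom: "module_hom cscale cscale (flip :: ('b \<times> 'b, 'k) cfree \<Rightarrow> _)"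
  unfolding flip_def by (rule clift_hom)

text \<open>
  The operators on tensor factors are defined by their values on the basis, so they are linear for every
  argument \<open>F\<close>.
\<close>

lemma op_hom:
  "module_hom cscale cscale (op12 (F :: ('b \<times> 'b, 'k) cfree \<Rightarrow> _))"
  "module_hom cscale cscale (op13 F)" "module_hom cscale cscale (op23 F)"
  unfolding op12_def op13_def op23_def by (rule clift_hom)+

lemma S_bounds: "fin_type M (S t)" "\<exists>n0. \<forall>n<n0. hdvd cscale M (S t n)"
  by (rule tensor_laurent_fin_type [OF S_laurent])+

lemma operator_series_op:
  "operator_series (\<lambda>n. op12 (\<lambda>s. S s n))" "operator_series (\<lambda>n. op13 (\<lambda>s. S s n))" "operator_series (\<lambda>n. op23 (\<lambda>s. S s n))"
proof -
  have *: "fin_type M (\<lambda>n. clift F (S t n)) \<and> (\<exists>n0. \<forall>n<n0. hdvd cscale M (clift F (S t n)))"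
    for M t and F :: "'b \<times> 'b \<Rightarrow> ('b \<times> 'b \<times> 'b, 'k) cfree"
  proof
    show "fin_type M (\<lambda>n. clift F (S t n))" by (rule fin_type_map [OF clift_hom S_bounds(1)])
    obtain n0 where "\<forall>n<n0. hdvd cscale M (S t n)" using S_bounds(2) by blast
    then show "\<exists>n0. \<forall>n<n0. hdvd cscale M (clift F (S t n))" using hom_hdvd [OF clift_hom] by blast
  qed
  have
    "op12 F (cbasis x) = clift (\<lambda>y. cbasis (fst y, snd y, snd (snd x))) (F (cbasis (fst x, fst (snd x))))"
    "op13 F (cbasis x) = clift (\<lambda>y. cbasis (fst y, fst (snd x), snd y)) (F (cbasis (fst x, snd (snd x))))"
    "op23 F (cbasis x) = clift (\<lambda>y. cbasis (fst x, fst y, snd y)) (F (cbasis (snd x)))"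
    for F :: "('b \<times> 'b, 'k) cfree \<Rightarrow> ('b \<times> 'b, 'k) cfree" and x
    by (simp_all add: op12_def op13_def op23_def case_prod_unfold)
  note eq = this
  show "operator_series (\<lambda>n. op12 (\<lambda>s. S s n))" "operator_series (\<lambda>n. op13 (\<lambda>s. S s n))" "operator_series (\<lambda>n. op23 (\<lambda>s. S s n))"
    unfolding operator_series_def eq by (intro conjI allI op_hom * [THEN conjunct1] * [THEN conjunct2])+
qed

lemma Y_right_lower:
  assumes "fin_type M u"
  shows "\<exists>l0. \<forall>l<l0. \<forall>i. hdvd cscale M (Y_right \<phi> Y l (u i))"
proof (rule cfree.uniform_hdvd [OF Y_right_hom assms])
  fix x :: "'b \<times> 'b \<times> 'b"
  obtain a b c where x: "x = (a, b, c)" by (cases x)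
  obtain l0 where "\<forall>l<l0. hdvd scale M (Y (cbasis (b, c)) l)"
    using Y_laurent unfolding laurent_def by blast
  then have "\<forall>l<l0. hdvd cscale M (Y_right \<phi> Y l (cbasis x))"
    using hom_hdvd [OF tens2_hom_right] by (simp add: Y_right_def x)
  then show "\<exists>l0. \<forall>l<l0. hdvd cscale M (Y_right \<phi> Y l (cbasis x))" ..
qed

lemma Y_left_lower:
  assumes "fin_type M u"
  shows "\<exists>l0. \<forall>l<l0. \<forall>i. hdvd cscale M (Y_left \<phi> Y l (u i))"
proof (rule cfree.uniform_hdvd [OF Y_left_hom assms])
  fix x :: "'b \<times> 'b \<times> 'b"
  obtain a b c where x: "x = (a, b, c)" by (cases x)
  obtain l0 where "\<forall>l<l0. hdvd scale M (Y (cbasis (a, b)) l)"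
    using Y_laurent unfolding laurent_def by blast
  then have "\<forall>l<l0. hdvd cscale M (Y_left \<phi> Y l (cbasis x))"
    using hom_hdvd [OF tens2_hom_left] by (simp add: Y_left_def x)
  then show "\<exists>l0. \<forall>l<l0. hdvd cscale M (Y_left \<phi> Y l (cbasis x))" ..
qed

lemma Y_hom_lower:
  assumes "fin_type M u" and "module_hom cscale cscale \<Phi>"
  shows "\<exists>l0. \<forall>l<l0. \<forall>i. hdvd scale M (Y (\<Phi> (u i)) l)"
  by (rule uniform_hdvd [OF hom_comp [OF assms(2) Y_hom] assms(1)])
     (use Y_laurent in \<open>auto simp: laurent_def\<close>)

lemma Y_hdvd: "hdvd cscale M t \<Longrightarrow> hdvd scale M (Y t n)"
  by (rule hom_hdvd [OF Y_hom])

section \<open>Divided powers of the translation operator\<close>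

definition T_dpow :: "nat \<Rightarrow> 'v \<Rightarrow> 'v" where
  "T_dpow k x = scale (fps_const (1 / fact k)) ((T ^^ k) x)"

definition T_right_dpow :: "nat \<Rightarrow> ('b \<times> 'b, 'k) cfree \<Rightarrow> ('b \<times> 'b, 'k) cfree" where
  "T_right_dpow k x = cscale (fps_const (1 / fact k)) ((T_right \<phi> T ^^ k) x)"

lemma hom_funpow: "module_hom s s f \<Longrightarrow> module s \<Longrightarrow> module_hom s s (f ^^ k)"
  by (induction k) (auto simp: module_hom_iff)

lemma T_dpow_hom: "module_hom scale scale (T_dpow k)"
  unfolding T_dpow_def by (rule hom_scaled [OF hom_funpow [OF T_linear module_axioms]])

lemma T_right_dpow_hom: "module_hom cscale cscale (T_right_dpow k)"
  unfolding T_right_dpow_def by (rule hom_scaled [OF hom_funpow [OF T_right_hom module_cscale]])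

lemma T_dpow_0 [simp]: "T_dpow 0 x = x" by (simp add: T_dpow_def)

lemma T_right_dpow_0 [simp]: "T_right_dpow 0 x = x" by (simp add: T_right_dpow_def)

lemma T_dpow_Suc: "scale (fps_const (of_nat (Suc k))) (T_dpow (Suc k) x) = T_dpow k (T x)"
  by (simp add: T_dpow_def funpow_swap1 del: of_nat_Suc)

lemma T_right_dpow_Suc: "cscale (fps_const (of_nat (Suc k))) (T_right_dpow (Suc k) x) = T_right_dpow k (T_right \<phi> T x)"
  by (simp add: T_right_dpow_def funpow_swap1 del: of_nat_Suc)

lemma T_T_dpow: "T (T_dpow k x) = T_dpow k (T x)"
  using T_linear by (simp add: T_dpow_def module_hom_iff funpow_swap1)

lemma T_right_tens2: "T_right \<phi> T (tens2 \<phi> (vbasis \<phi> a) w) = tens2 \<phi> (vbasis \<phi> a) (T w)"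
  unfolding T_right_def
  by (rule vhom_ext [OF hom_comp [OF tens2_hom_right clift_hom] hom_comp [OF T_linear tens2_hom_right]]) simp

lemma T_right_dpow_tens2: "T_right_dpow k (tens2 \<phi> (vbasis \<phi> a) w) = tens2 \<phi> (vbasis \<phi> a) (T_dpow k w)"
proof -
  have "(T_right \<phi> T ^^ k) (tens2 \<phi> (vbasis \<phi> a) w) = tens2 \<phi> (vbasis \<phi> a) ((T ^^ k) w)"
    by (induction k) (simp_all add: T_right_tens2)
  then show ?thesis
    using tens2_hom_right by (simp add: T_right_dpow_def T_dpow_def module_hom_iff)
qed

lemma fps_const_of_int: "(of_int n :: 'k fps) = fps_const (of_int n)"
  by (simp add: fps_of_int)

lemma Y_derivative:
  "scale (fps_const (of_int (n + 1))) (Y t (n + 1)) = T (Y t n) - Y (T_right \<phi> T t) n"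
  using QA2_derivative [of t n] by (simp add: dz_def flip: fps_of_int)

text \<open>
  This is \<open>Y(z)(v \<otimes> \<Omega>) = e^{zT} v\<close>: as \<open>T \<Omega> = 0\<close>, the derivative of the left side is \<open>T\<close> applied to it,
  and its value at \<open>z = 0\<close> is \<open>v\<close>.
\<close>

lemma Y_vacuum_right:
  "Y (tens2 \<phi> (vbasis \<phi> a) \<Omega>) n = (if n < 0 then 0 else T_dpow (nat n) (vbasis \<phi> a))"
proof (cases "n < 0")
  case False
  have zero: "T_right \<phi> T (tens2 \<phi> (vbasis \<phi> a) \<Omega>) = 0"
    using module_hom.zero [OF tens2_hom_right] by (simp add: T_right_tens2 QA2_vacuum)
  have "Y (tens2 \<phi> (vbasis \<phi> a) \<Omega>) (int k) = T_dpow k (vbasis \<phi> a)" for k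
  proof (induction k)
    case (Suc k)
    have "scale (fps_const (of_nat (Suc k))) (Y (tens2 \<phi> (vbasis \<phi> a) \<Omega>) (int (Suc k)))
        = T (Y (tens2 \<phi> (vbasis \<phi> a) \<Omega>) (int k))"
      using Y_derivative [of "int k" "tens2 \<phi> (vbasis \<phi> a) \<Omega>"] module_hom.zero [OF Y_hom]
      by (simp add: zero add.commute)
    also have "\<dots> = scale (fps_const (of_nat (Suc k))) (T_dpow (Suc k) (vbasis \<phi> a))"
      unfolding Suc.IH T_T_dpow T_dpow_Suc ..
    finally show ?case
      by (rule scale_const_cancel) (rule of_nat_neq_0)
  qed (simp add: QA3_value)
  from this [of "nat n"] False show ?thesis by simp
qed (simp add: QA3_regular)

lemma bincoef_absorb: "of_int (p + 1) * bincoef (1::'k) (p + 1) m = of_nat (Suc m) * bincoef 1 p (Suc m)"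
proof -
  define a where "a = (of_int (p + 1 + int m) :: 'k)"
  have "a * (a gchoose m) = of_nat m * (a gchoose m) + of_nat (Suc m) * (a gchoose Suc m)"
    by (rule gbinomial_mult_1)
  moreover have "(of_int (p + 1) :: 'k) = a - of_nat m" by (simp add: a_def)
  ultimately show ?thesis
    by (simp add: bincoef_def a_def algebra_simps)
qed

lemma bincoef_absorb': "of_int (p + int m + 1) * bincoef (1::'k) p m = of_nat (Suc m) * bincoef 1 p (Suc m)"
  using Suc_times_gbinomial [of m "of_int (p + int m) :: 'k"] by (simp add: bincoef_def add_ac)

text \<open>
  The coefficient of \<open>x^p w^q\<close> in \<open>Y(x + w)(1 \<otimes> e^{wT}) = e^{wT} Y(x)\<close>.  The derivation \<open>d/dx\<close> and right
  composition with \<open>1 \<otimes> T\<close> commute and add up to left composition with \<open>T\<close>, so this is the binomial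
  theorem for divided powers; the induction multiplies by \<open>q + 1 = (q + 1 - j) + j\<close> and lets the two
  summands act on the two factors.
\<close>

lemma Y_exp_T:
  assumes l: "hfun scale M l"
  shows "(\<Sum>j\<le>q. bincoef 1 p (q - j) * l (Y (T_right_dpow j s) (p + int (q - j)))) = l (T_dpow q (Y s p))"
proof (induction q arbitrary: s p)
  case (Suc q)
  note lY = hfun_comp [OF Y_hom l]
  note lT = hfun_comp [OF T_dpow_hom l]
  have 1: "(\<Sum>j\<le>Suc q. of_nat (Suc q - j) * bincoef 1 p (Suc q - j) * l (Y (T_right_dpow j s) (p + int (Suc q - j))))
     = of_int (p + 1) * (\<Sum>j\<le>q. bincoef 1 (p + 1) (q - j) * l (Y (T_right_dpow j s) (p + 1 + int (q - j))))"
    (is "?L = _")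
  proof -
    have "?L = (\<Sum>j\<le>q. of_nat (Suc q - j) * bincoef 1 p (Suc q - j) * l (Y (T_right_dpow j s) (p + int (Suc q - j))))"
      by simp
    also have "\<dots> = (\<Sum>j\<le>q. of_int (p + 1) * (bincoef 1 (p + 1) (q - j) * l (Y (T_right_dpow j s) (p + 1 + int (q - j)))))"
    proof (rule sum.cong [OF refl])
      fix j assume "j \<in> {..q}"
      then have "Suc q - j = Suc (q - j)" "p + int (Suc (q - j)) = p + 1 + int (q - j)" by simp_all
      then show "of_nat (Suc q - j) * bincoef 1 p (Suc q - j) * l (Y (T_right_dpow j s) (p + int (Suc q - j)))
          = of_int (p + 1) * (bincoef 1 (p + 1) (q - j) * l (Y (T_right_dpow j s) (p + 1 + int (q - j))))"
        by (simp only: bincoef_absorb mult.assoc [symmetric])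
    qed
    finally show ?thesis by (simp only: sum_distrib_left)
  qed
  have 2: "(\<Sum>j\<le>Suc q. of_nat j * bincoef 1 p (Suc q - j) * l (Y (T_right_dpow j s) (p + int (Suc q - j))))
     = (\<Sum>j\<le>q. bincoef 1 p (q - j) * l (Y (T_right_dpow j (T_right \<phi> T s)) (p + int (q - j))))"
  proof -
    have "l (Y (T_right_dpow j (T_right \<phi> T s)) n) = of_nat (Suc j) * l (Y (T_right_dpow (Suc j) s) n)" for j n
      unfolding T_right_dpow_Suc [symmetric] by (rule hfun_scale [OF lY])
    then show ?thesis
      unfolding sum.atMost_Suc_shift by (simp add: mult_ac del: of_nat_Suc)
  qed
  have "of_nat (Suc q) * (\<Sum>j\<le>Suc q. bincoef 1 p (Suc q - j) * l (Y (T_right_dpow j s) (p + int (Suc q - j))))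
     = (\<Sum>j\<le>Suc q. of_nat (Suc q - j) * bincoef 1 p (Suc q - j) * l (Y (T_right_dpow j s) (p + int (Suc q - j))))
     + (\<Sum>j\<le>Suc q. of_nat j * bincoef 1 p (Suc q - j) * l (Y (T_right_dpow j s) (p + int (Suc q - j))))"
    unfolding sum_distrib_left sum.distrib [symmetric]
  proof (rule sum.cong [OF refl])
    fix j assume "j \<in> {..Suc q}"
    then have "of_nat (Suc q) = (of_nat (Suc q - j) + of_nat j :: 'k)"
      by (simp only: of_nat_add [symmetric]) simp
    then show "of_nat (Suc q) * (bincoef 1 p (Suc q - j) * l (Y (T_right_dpow j s) (p + int (Suc q - j))))
      = of_nat (Suc q - j) * bincoef 1 p (Suc q - j) * l (Y (T_right_dpow j s) (p + int (Suc q - j)))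
      + of_nat j * bincoef 1 p (Suc q - j) * l (Y (T_right_dpow j s) (p + int (Suc q - j)))"
      by (simp only: distrib_right mult.assoc)
  qed
  also have "\<dots> = of_int (p + 1) * l (T_dpow q (Y s (p + 1))) + l (T_dpow q (Y (T_right \<phi> T s) p))"
    unfolding 1 2 Suc.IH ..
  also have "\<dots> = l (T_dpow q (scale (fps_const (of_int (p + 1))) (Y s (p + 1)) + Y (T_right \<phi> T s) p))"
    by (simp only: hfun_add [OF lT] hfun_scale [OF lT])
  also have "\<dots> = of_nat (Suc q) * l (T_dpow (Suc q) (Y s p))"
    unfolding Y_derivative by (simp only: diff_add_cancel T_dpow_Suc [symmetric] hfun_scale [OF l])
  finally show ?case by (simp del: of_nat_Suc)
qed simp

text \<open>
  The coefficient of \<open>z^i\<close> in \<open>Y(u)(1 \<otimes> e^{zT}) = e^{zT} Y(u - z)\<close>, proved in the same way with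
  \<open>1 \<otimes> T = T - d/du\<close>.
\<close>

lemma Y_T_power:
  assumes l: "hfun scale M l"
  shows "l (Y (T_right_dpow i s) n) = (\<Sum>m\<le>i. (-1) ^ m * bincoef 1 n m * l (T_dpow (i - m) (Y s (n + int m))))"
proof (induction i arbitrary: s n)
  case (Suc i)
  let ?y = "\<lambda>i m. l (T_dpow i (Y s (n + int m)))"
  note lY = hfun_comp [OF Y_hom l]
  note lT = hfun_comp [OF T_dpow_hom l]
  have Y_T: "l (T_dpow k (Y (T_right \<phi> T s) n)) = of_nat (Suc k) * l (T_dpow (Suc k) (Y s n)) - of_int (n + 1) * l (T_dpow k (Y s (n + 1)))"
    for k n
  proof -
    have "Y (T_right \<phi> T s) n = T (Y s n) - scale (fps_const (of_int (n + 1))) (Y s (n + 1))"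
      unfolding Y_derivative by simp
    then show ?thesis
      by (simp only: hfun_diff [OF lT] hfun_scale [OF lT] T_dpow_Suc [symmetric] hfun_scale [OF l])
  qed
  have idx: "Y s (n + int m + 1) = Y s (n + int (Suc m))" for m
    by (simp add: add_ac)
  have "of_nat (Suc i) * l (Y (T_right_dpow (Suc i) s) n) = l (Y (T_right_dpow i (T_right \<phi> T s)) n)"
    unfolding T_right_dpow_Suc [symmetric] by (rule hfun_scale [OF lY, symmetric])
  also have "\<dots> = (\<Sum>m\<le>i. (-1) ^ m * bincoef 1 n m * (of_nat (Suc (i - m)) * ?y (Suc (i - m)) m
        - of_int (n + int m + 1) * ?y (i - m) (Suc m)))"
    unfolding Suc.IH Y_T idx ..
  also have "\<dots> = (\<Sum>m\<le>i. (-1) ^ m * bincoef 1 n m * (of_nat (Suc i - m) * ?y (Suc i - m) m)) +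
      (\<Sum>m\<le>i. (-1) ^ Suc m * (of_nat (Suc m) * bincoef 1 n (Suc m)) * ?y (Suc i - Suc m) (Suc m))"
    unfolding sum.distrib [symmetric] bincoef_absorb' [symmetric]
    by (intro sum.cong refl) (simp add: Suc_diff_le algebra_simps del: of_nat_Suc of_int_add)
  also have "\<dots> = (\<Sum>m\<le>Suc i. (-1) ^ m * bincoef 1 n m * (of_nat (Suc i - m) * ?y (Suc i - m) m)) +
      (\<Sum>m\<le>Suc i. (-1) ^ m * (of_nat m * bincoef 1 n m) * ?y (Suc i - m) m)"
    unfolding sum.atMost_Suc_shift [of "\<lambda>m. (-1) ^ m * (of_nat m * bincoef 1 n m) * ?y (Suc i - m) m"] by simp
  also have "\<dots> = of_nat (Suc i) * (\<Sum>m\<le>Suc i. (-1) ^ m * bincoef 1 n m * ?y (Suc i - m) m)"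
    unfolding sum_distrib_left sum.distrib [symmetric]
  proof (rule sum.cong [OF refl])
    fix m assume "m \<in> {..Suc i}"
    then have "of_nat (Suc i) = (of_nat (Suc i - m) + of_nat m :: 'k)"
      by (simp only: of_nat_add [symmetric]) simp
    then show "(-1) ^ m * bincoef 1 n m * (of_nat (Suc i - m) * ?y (Suc i - m) m) +
        (-1) ^ m * (of_nat m * bincoef 1 n m) * ?y (Suc i - m) m
      = of_nat (Suc i) * ((-1) ^ m * bincoef 1 n m * ?y (Suc i - m) m)"
      by (simp only: distrib_right distrib_left mult_ac)
  qed
  finally show ?case by (simp del: of_nat_Suc)
qed simp

end

section \<open>Skew symmetry\<close>

text \<open>
  This is the identity \<open>(z\<^sub>1 - z\<^sub>2)^N (z\<^sub>2 - z\<^sub>1)^d = (-1)^N (z\<^sub>2 - z\<^sub>1)^(N + d)\<close> at \<open>z\<^sub>2^0\<close>, where the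
  right side is a polynomial.
\<close>

lemma Vandermonde_shifted:
  fixes d :: int
  assumes "- int N \<le> d"
  shows "(\<Sum>k\<le>N. if 0 \<le> d + int k then of_nat (N choose k) * (of_int d gchoose nat (d + int k)) else 0)
    = (1 :: 'k::field_char_0)"
proof -
  define n where "n = nat (int N + d)"
  have n: "int n = int N + d" using assms by (simp add: n_def)
  let ?g = "\<lambda>m. (of_int d gchoose m :: 'k) * (of_nat N gchoose (n - m))"
  let ?f = "\<lambda>k. if 0 \<le> d + int k then of_nat (N choose k) * (of_int d gchoose nat (d + int k)) else (0 :: 'k)"
  have "(\<Sum>k\<le>N. ?f k) = (\<Sum>k\<in>{nat (- d)..N}. ?f k)"
    by (rule sum.mono_neutral_right) auto
  also have "\<dots> = (\<Sum>m\<in>{nat d..n}. ?g m)"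
  proof (rule sum.reindex_bij_witness [where i = "\<lambda>m. nat (int m - d)" and j = "\<lambda>k. nat (d + int k)"])
    fix k assume k: "k \<in> {nat (- d)..N}"
    then have "n - nat (d + int k) = N - k" using n by auto
    moreover have "(of_nat N gchoose (N - k) :: 'k) = of_nat (N choose k)"
      using k by (simp add: binomial_gbinomial [symmetric] binomial_symmetric [symmetric])
    ultimately show "?g (nat (d + int k)) = ?f k"
      using k by auto
  qed (use n in auto)
  also have "\<dots> = (\<Sum>m\<in>{0..n}. ?g m)"
  proof (rule sum.mono_neutral_left)
    show "\<forall>m\<in>{0..n} - {nat d..n}. ?g m = 0"
    proof
      fix m assume "m \<in> {0..n} - {nat d..n}"
      then have "N < n - m" using n by auto
      then have "(of_nat N gchoose (n - m) :: 'k) = 0"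
        by (simp add: binomial_gbinomial [symmetric] binomial_eq_0)
      then show "?g m = 0" by simp
    qed
  qed auto
  also have "\<dots> = (of_int d + of_nat N) gchoose n"
    by (rule gbinomial_Vandermonde)
  also have "of_int d + of_nat N = (of_nat n :: 'k)"
    using arg_cong [OF n, of "of_int :: int \<Rightarrow> 'k"] by simp
  also have "(of_nat n :: 'k) gchoose n = 1"
    by (simp add: binomial_gbinomial [symmetric])
  finally show ?thesis .
qed

context braided_voa
begin

text \<open>
  The indicator of the nonvanishing coefficients modulo \<open>h^M\<close>, used as a scalar family, bounds the vectors
  and their values under all functionals at once.
\<close>

lemma expandable_right:
  assumes u: "fin_type M u" and lower: "\<exists>n0. \<forall>n<n0. hdvd cscale M (u n)"
  shows "expandable (\<lambda>n p q. if hdvd scale M (Y (Y_right \<phi> Y q (u n)) p) then 0 else (1 :: nat))"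
proof -
  have "\<exists>p0. \<forall>p<p0. \<forall>n. hdvd scale M (Y (Y_right \<phi> Y q (u n)) p)" for q
    by (rule Y_hom_lower [OF u Y_right_hom])
  moreover obtain n0 where "\<forall>n<n0. hdvd cscale M (u n)" using lower by blast
  then have "\<forall>n<n0. \<forall>p q. hdvd scale M (Y (Y_right \<phi> Y q (u n)) p)"
    by (blast intro: Y_hdvd hom_hdvd [OF Y_right_hom])
  moreover obtain q0 where "\<forall>q<q0. \<forall>n. hdvd cscale M (Y_right \<phi> Y q (u n))"
    using Y_right_lower [OF u] by blast
  then have "\<forall>q<q0. \<forall>n p. hdvd scale M (Y (Y_right \<phi> Y q (u n)) p)"
    by (blast intro: Y_hdvd)
  ultimately show ?thesis unfolding expandable_def by (simp, blast)
qed

lemma hsummable_right: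
  assumes u: "\<And>M. fin_type M u" and lower: "\<And>M. \<exists>n0. \<forall>n<n0. hdvd cscale M (u n)"
  shows "hsummable scale (\<lambda>(i, j). scale (binc c i j) (Y (Y_right \<phi> Y (q - int j) (u (i + int j))) (p - i)))"
  unfolding hsummable_def
proof
  fix M
  show "finite {x. \<not> hdvd scale M (case x of (i, j) \<Rightarrow>
      scale (binc c i j) (Y (Y_right \<phi> Y (q - int j) (u (i + int j))) (p - i)))}"
    by (rule finite_subset [OF _ finite_expansion_index [OF expandable_right [where M = M, OF u lower], where p = p and q = q]])
       (auto dest: hom_hdvd [OF module_hom_scale_self])
qed

lemma hfun_right:
  assumes u: "\<And>M. fin_type M u" and lower: "\<And>M. \<exists>n0. \<forall>n<n0. hdvd cscale M (u n)"
    and l: "hfun scale M l"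
  shows "l (hsum scale (\<lambda>(i, j). scale (binc c i j) (Y (Y_right \<phi> Y (q - int j) (u (i + int j))) (p - i))))
    = expansion c (\<lambda>n p q. l (Y (Y_right \<phi> Y q (u n)) p)) p q"
  unfolding hfun_hsum [OF hsummable_right [OF u lower] l] expansion_def
  by (rule Sum_any.cong) (simp add: case_prod_unfold binc_eq hfun_scale [OF l])

text \<open>
  \<open>QA1\<close> read through functionals; the exponent \<open>N\<close> does not depend on the functional, which is what later
  allows composing it with all divided powers of \<open>T\<close>.
\<close>

lemma locality_fun:
  "\<exists>N. \<forall>l u. hfun scale M l \<longrightarrow>
     (linmul (-1) ^^ N) (expansion (-1) (\<lambda>n p q. l (Y (Y_right \<phi> Y q (op12 (\<lambda>s. S s n) (tens3 \<phi> v w u))) p)))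
     = (linmul (-1) ^^ N) (\<lambda>p q. l (Y (Y_right \<phi> Y p (tens3 \<phi> w v u)) q))"
proof -
  obtain N where N: "\<forall>u p q. hcong scale M
     (binmult scale (-1) N
        (\<lambda>p q. hsum scale (\<lambda>(i, j). scale (binc (-1) i j)
           (Y (Y_right \<phi> Y (q - int j) (op12 (\<lambda>s. S s (i + int j)) (tens3 \<phi> v w u))) (p - i))))
        p q)
     (binmult scale (-1) N (\<lambda>p q. Y (Y_right \<phi> Y p (tens3 \<phi> w v u)) q) p q)"
    using QA1 [of M v w] by (elim exE that)
  have "(linmul (-1) ^^ N) (expansion (-1) (\<lambda>n p q. l (Y (Y_right \<phi> Y q (op12 (\<lambda>s. S s n) (tens3 \<phi> v w u))) p)))
     = (linmul (-1) ^^ N) (\<lambda>p q. l (Y (Y_right \<phi> Y p (tens3 \<phi> w v u)) q))"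
    if l: "hfun scale M l" for l u
  proof (intro ext)
    fix p q
    show "(linmul (-1) ^^ N) (expansion (-1) (\<lambda>n p q. l (Y (Y_right \<phi> Y q (op12 (\<lambda>s. S s n) (tens3 \<phi> v w u))) p))) p q
     = (linmul (-1) ^^ N) (\<lambda>p q. l (Y (Y_right \<phi> Y p (tens3 \<phi> w v u)) q)) p q"
      using hfun_hcong [OF l N [THEN spec, THEN spec, THEN spec, of u p q]]
      unfolding hfun_binmult [OF l]
        hfun_right [of "\<lambda>n. op12 (\<lambda>s. S s n) (tens3 \<phi> v w u)", OF operator_series_single [OF operator_series_op(1)] l] .
  qed
  then show ?thesis by blast
qed

definition append_vac :: "('b \<times> 'b, 'k) cfree \<Rightarrow> ('b \<times> 'b \<times> 'b, 'k) cfree" where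
  "append_vac = clift (\<lambda>(a, b). clift (\<lambda>c. cbasis (a, b, c)) (\<phi> \<Omega>))"

lemma append_vac_hom: "module_hom cscale cscale append_vac"
  unfolding append_vac_def by (rule clift_hom)

lemma append_vac_basis: "append_vac (cbasis (a, b)) = tens3 \<phi> (vbasis \<phi> a) (vbasis \<phi> b) \<Omega>"
  by (simp add: append_vac_def tens3_def)

lemma clift_swap:
  fixes F :: "'a \<Rightarrow> 'd \<Rightarrow> ('c, 'k) cfree"
  shows "clift (\<lambda>a. clift (F a) t) s = clift (\<lambda>b. clift (\<lambda>a. F a b) s) t"
proof -
  have "module_hom cscale cscale (\<lambda>s. clift (\<lambda>b. clift (\<lambda>a. F a b) s) t)"
    by (rule clift_param_hom [OF clift_hom module_cscale])
  from cfree.hom_ext [OF clift_hom this] show ?thesis by simp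
qed

lemma op12_append_vac: "op12 F (append_vac (cbasis (a, b))) = append_vac (F (cbasis (a, b)))"
proof -
  have "op12 F (append_vac (cbasis (a, b))) = op12 F (clift (\<lambda>c. cbasis (a, b, c)) (\<phi> \<Omega>))"
    by (simp add: append_vac_def)
  also have "\<dots> = clift (\<lambda>c. op12 F (cbasis (a, b, c))) (\<phi> \<Omega>)"
    by (rule hom_clift [OF op_hom(1)])
  also have "\<dots> = clift (\<lambda>c. clift (\<lambda>x. cbasis (fst x, snd x, c)) (F (cbasis (a, b)))) (\<phi> \<Omega>)"
    by (simp add: op12_def case_prod_unfold)
  also have "\<dots> = append_vac (F (cbasis (a, b)))"
    unfolding append_vac_def case_prod_unfold by (rule clift_swap)
  finally show ?thesis .
qed

lemma Y_right_append_vac: "Y_right \<phi> Y n (append_vac s) = (if n < 0 then 0 else T_right_dpow (nat n) s)"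
proof -
  have basis: "Y_right \<phi> Y n (append_vac (cbasis x)) = (if n < 0 then 0 else T_right_dpow (nat n) (cbasis x))" for x
  proof -
    obtain a b where x: "x = (a, b)" by (cases x)
    have "Y_right \<phi> Y n (append_vac (cbasis (a, b)))
        = Y_right \<phi> Y n (clift (\<lambda>c. cbasis (a, b, c)) (\<phi> \<Omega>))"
      by (simp add: append_vac_def)
    also have "\<dots> = clift (\<lambda>c. Y_right \<phi> Y n (cbasis (a, b, c))) (\<phi> \<Omega>)"
      by (rule hom_clift [OF Y_right_hom])
    also have "\<dots> = clift (\<lambda>c. tens2 \<phi> (vbasis \<phi> a) (Y (cbasis (b, c)) n)) (\<phi> \<Omega>)"
      by (simp add: Y_right_def)
    also have "\<dots> = tens2 \<phi> (vbasis \<phi> a) (Y (clift (\<lambda>c. cbasis (b, c)) (\<phi> \<Omega>)) n)"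
      by (rule cfree.hom_ext [OF clift_hom hom_comp [OF hom_comp [OF clift_hom Y_hom] tens2_hom_right]]) simp
    also have "clift (\<lambda>c. cbasis (b, c)) (\<phi> \<Omega>) = tens2 \<phi> (vbasis \<phi> b) \<Omega>"
      by (simp add: tens2_def)
    also have "tens2 \<phi> (vbasis \<phi> a) (Y (tens2 \<phi> (vbasis \<phi> b) \<Omega>) n)
        = (if n < 0 then 0 else T_right_dpow (nat n) (tens2 \<phi> (vbasis \<phi> a) (vbasis \<phi> b)))"
      using module_hom.zero [OF tens2_hom_right] by (simp add: Y_vacuum_right T_right_dpow_tens2 del: tens2_vbasis)
    finally show ?thesis by (simp add: x)
  qed
  show ?thesis
  proof (cases "n < 0")
    case True
    have "module_hom cscale cscale (\<lambda>s. 0 :: ('b \<times> 'b, 'k) cfree)"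
      by (simp add: module_hom_iff module_cscale module.scale_zero_right [OF module_cscale])
    then show ?thesis
      using cfree.hom_ext [OF hom_comp [OF append_vac_hom Y_right_hom], of "\<lambda>s. 0" n s] basis True by simp
  next
    case False
    then show ?thesis
      using cfree.hom_ext [OF hom_comp [OF append_vac_hom Y_right_hom] T_right_dpow_hom, of n "nat n" s] basis by simp
  qed
qed

lemma hsummable_skew_left: "hsummable scale (\<lambda>i. Y (S s i) (P - i))"
  unfolding hsummable_def
proof
  fix M
  obtain n0 where n0: "\<forall>n<n0. hdvd cscale M (S s n)" using S_bounds(2) by blast
  obtain p0 where p0: "\<forall>p<p0. \<forall>i. hdvd scale M (Y (S s i) p)"
    using Y_hom_lower [OF S_bounds(1) cfree.module_hom_ident] by blast
  have "{i. \<not> hdvd scale M (Y (S s i) (P - i))} \<subseteq> {n0..P - p0}"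
  proof
    fix i assume "i \<in> {i. \<not> hdvd scale M (Y (S s i) (P - i))}"
    then have "\<not> i < n0" "\<not> P - i < p0" using n0 p0 Y_hdvd by blast+
    then show "i \<in> {n0..P - p0}" by auto
  qed
  then show "finite {i. \<not> hdvd scale M (Y (S s i) (P - i))}" by (rule finite_subset) simp
qed

lemma hsummable_skew_right:
  "hsummable scale (\<lambda>k. scale (fps_const ((-1) powi (P - int k))) (T_dpow k (Y s (P - int k))))"
  unfolding hsummable_def
proof
  fix M
  obtain p0 where p0: "\<forall>p<p0. hdvd scale M (Y s p)"
    using Y_laurent unfolding laurent_def by blast
  have "{k. \<not> hdvd scale M (scale (fps_const ((-1) powi (P - int k))) (T_dpow k (Y s (P - int k))))} \<subseteq> {..nat (P - p0)}"
  proof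
    fix k assume "k \<in> {k. \<not> hdvd scale M (scale (fps_const ((-1) powi (P - int k))) (T_dpow k (Y s (P - int k))))}"
    then have "\<not> P - int k < p0"
      using p0 hom_hdvd [OF T_dpow_hom] hom_hdvd [OF module_hom_scale_self] by blast
    then show "k \<in> {..nat (P - p0)}" by auto
  qed
  then show "finite {k. \<not> hdvd scale M (scale (fps_const ((-1) powi (P - int k))) (T_dpow k (Y s (P - int k))))}"
    by (rule finite_subset) simp
qed

text \<open>
  The coefficient of \<open>z\<^sub>1^(P + N) z\<^sub>2^0\<close> of the braided side of \<open>QA1\<close> with the vacuum as third vector.
  Since \<open>Y(z\<^sub>2)(b \<otimes> \<Omega>)\<close> has no negative powers of \<open>z\<^sub>2\<close>, only \<open>z\<^sub>1^N\<close> from \<open>(z\<^sub>1 - z\<^sub>2)^N\<close> and the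
  value \<open>b\<close> at \<open>z\<^sub>2 = 0\<close> contribute.
\<close>

lemma locality_vacuum_left:
  assumes l: "hfun scale M l" and s: "s = cbasis (a, b)"
  shows "(linmul (-1) ^^ N) (expansion (-1) (\<lambda>n p q. l (Y (Y_right \<phi> Y q (op12 (\<lambda>s. S s n) (append_vac s))) p))) (P + int N) 0
    = Sum_any (\<lambda>i. l (Y (S s i) (P - i)))"
proof -
  let ?F = "\<lambda>n p q. l (Y (Y_right \<phi> Y q (op12 (\<lambda>s. S s n) (append_vac s))) p)"
  have F: "?F n p q = (if q < 0 then 0 else l (Y (T_right_dpow (nat q) (S s n)) p))" for n p q
    using module_hom.zero [OF Y_hom] hfun_zero [OF l]
    by (simp add: s op12_append_vac Y_right_append_vac)
  have neg: "expansion (-1) ?F p q = 0" if "q < 0" for p q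
    unfolding expansion_def F using that by (simp add: case_prod_unfold)
  have zero: "expansion (-1) ?F p 0 = Sum_any (\<lambda>i. l (Y (S s i) (p - i)))" for p
  proof -
    let ?g = "\<lambda>(i, j). bincoef (-1) i j * ?F (i + int j) (p - i) (0 - int j)"
    have "Sum_any (\<lambda>i. ?g (i, 0)) = Sum_any ?g"
    proof (rule Sum_any_inj_reindex)
      fix y :: "int \<times> nat" assume "y \<notin> range (\<lambda>i. (i, 0))"
      then have "0 < snd y" by (cases y) (auto simp: image_iff)
      then show "?g y = 0" by (simp add: case_prod_unfold F)
    qed (auto simp: inj_on_def)
    then show ?thesis unfolding expansion_def by (simp add: F)
  qed
  have "(linmul (-1) ^^ N) (expansion (-1) ?F) (P + int N) 0
      = (\<Sum>k\<le>N. of_nat (N choose k) * (-1) ^ k * expansion (-1) ?F (P + int N - int (N - k)) (0 - int k))"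
    by (rule linmul_pow_eq_sum)
  also have "\<dots> = (\<Sum>k\<in>{0}. of_nat (N choose k) * (-1) ^ k * expansion (-1) ?F (P + int N - int (N - k)) (0 - int k))"
    by (rule sum.mono_neutral_right) (auto intro!: neg)
  also have "\<dots> = Sum_any (\<lambda>i. l (Y (S s i) (P - i)))"
    using zero by simp
  finally show ?thesis .
qed

text \<open>
  The same coefficient of the other side, \<open>(z\<^sub>1 - z\<^sub>2)^N e^{z\<^sub>1 T} Y(z\<^sub>2 - z\<^sub>1) s\<close>.  For large \<open>N\<close> the factor
  cancels the poles of \<open>Y\<close>, so that \<open>z\<^sub>2 = 0\<close> may be substituted.
\<close>

lemma locality_vacuum_right:
  assumes l: "hfun scale M l" and lower: "\<And>n. n < - int N \<Longrightarrow> hdvd scale M (Y s n)"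
  shows "(linmul (-1) ^^ N) (\<lambda>p q. l (Y (Y_right \<phi> Y p (append_vac s)) q)) (P + int N) 0
    = Sum_any (\<lambda>k. (-1) powi (P - int k) * l (T_dpow k (Y s (P - int k))))"
proof -
  define y where "y e = l (T_dpow e (Y s (P - int e)))" for e
  define E where "E = nat (P + int N)"
  have y0: "y e = 0" if "P - int e < - int N" for e
    unfolding y_def by (rule hfun_hdvd [OF l hom_hdvd [OF T_dpow_hom lower [OF that]]])
  define d where "d e = P - int e" for e
  let ?c = "\<lambda>k e. of_nat (N choose k) * (-1) ^ k *
      (if int e \<le> P + int k then (-1) ^ nat (d e + int k) * (of_int (d e) gchoose nat (d e + int k)) * y e else 0)"
  have R: "l (Y (Y_right \<phi> Y (P + int k) (append_vac s)) (0 - int k))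
     = (\<Sum>e\<le>E. if int e \<le> P + int k then (-1) ^ nat (d e + int k) * (of_int (d e) gchoose nat (d e + int k)) * y e else 0)"
    if k: "k \<le> N" for k
  proof (cases "P + int k < 0")
    case True
    then show ?thesis
      using module_hom.zero [OF Y_hom] hfun_zero [OF l] by (simp add: Y_right_append_vac sum.neutral)
  next
    case False
    define i where "i = nat (P + int k)"
    have i: "int i = P + int k" using False by (simp add: i_def)
    have "l (Y (Y_right \<phi> Y (P + int k) (append_vac s)) (0 - int k)) = l (Y (T_right_dpow i s) (- int k))"
      using False by (simp add: Y_right_append_vac i_def)
    also have "\<dots> = (\<Sum>m\<le>i. (-1) ^ m * bincoef 1 (- int k) m * l (T_dpow (i - m) (Y s (- int k + int m))))"
      by (rule Y_T_power [OF l])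
    also have "\<dots> = (\<Sum>e\<le>i. (-1) ^ nat (d e + int k) * (of_int (d e) gchoose nat (d e + int k)) * y e)"
    proof (rule sum.reindex_bij_witness [where i = "\<lambda>e. i - e" and j = "\<lambda>m. i - m"])
      fix m assume "m \<in> {..i}"
      then have m: "P - int (i - m) = int m - int k" using i by auto
      then show "(-1) ^ nat (d (i - m) + int k) * (of_int (d (i - m)) gchoose nat (d (i - m) + int k)) * y (i - m)
        = (-1) ^ m * bincoef 1 (- int k) m * l (T_dpow (i - m) (Y s (- int k + int m)))"
        by (simp add: d_def y_def bincoef_def)
    qed auto
    also have "\<dots> = (\<Sum>e\<le>i. if int e \<le> P + int k then (-1) ^ nat (d e + int k) * (of_int (d e) gchoose nat (d e + int k)) * y e else 0)"
      by (rule sum.cong) (use i in auto)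
    also have "\<dots> = (\<Sum>e\<le>E. if int e \<le> P + int k then (-1) ^ nat (d e + int k) * (of_int (d e) gchoose nat (d e + int k)) * y e else 0)"
      by (rule sum.mono_neutral_left) (use i k in \<open>auto simp: E_def\<close>)
    finally show ?thesis .
  qed
  have "(linmul (-1) ^^ N) (\<lambda>p q. l (Y (Y_right \<phi> Y p (append_vac s)) q)) (P + int N) 0
     = (\<Sum>k\<le>N. of_nat (N choose k) * (-1) ^ k * l (Y (Y_right \<phi> Y (P + int N - int (N - k)) (append_vac s)) (0 - int k)))"
    by (rule linmul_pow_eq_sum)
  also have "\<dots> = (\<Sum>k\<le>N. of_nat (N choose k) * (-1) ^ k * l (Y (Y_right \<phi> Y (P + int k) (append_vac s)) (0 - int k)))"
  proof (rule sum.cong [OF refl])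
    fix k assume "k \<in> {..N}"
    then have "P + int N - int (N - k) = P + int k" by auto
    then show "of_nat (N choose k) * (-1) ^ k * l (Y (Y_right \<phi> Y (P + int N - int (N - k)) (append_vac s)) (0 - int k))
      = of_nat (N choose k) * (-1) ^ k * l (Y (Y_right \<phi> Y (P + int k) (append_vac s)) (0 - int k))" by simp
  qed
  also have "\<dots> = (\<Sum>k\<le>N. \<Sum>e\<le>E. ?c k e)"
    by (rule sum.cong [OF refl]) (use R in \<open>simp add: sum_distrib_left\<close>)
  also have "\<dots> = (\<Sum>e\<le>E. \<Sum>k\<le>N. ?c k e)" by (rule sum.swap)
  also have "\<dots> = (\<Sum>e\<le>E. (-1) powi (P - int e) * y e)"
  proof (rule sum.cong [OF refl])
    fix e assume "e \<in> {..E}"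
    show "(\<Sum>k\<le>N. ?c k e) = (-1) powi (P - int e) * y e"
    proof (cases "d e < - int N")
      case True
      then have "y e = 0" using y0 by (simp add: d_def)
      then show ?thesis by (simp add: sum.neutral)
    next
      case False
      have "?c k e = (-1) powi (P - int e) * y e *
         (if 0 \<le> d e + int k then of_nat (N choose k) * (of_int (d e) gchoose nat (d e + int k)) else 0)" for k
      proof (cases "0 \<le> d e + int k")
        case True
        have "(-1 :: 'k) ^ k * (-1) ^ nat (d e + int k) = (-1) powi (int k) * (-1) powi (d e + int k)"
          using True by (simp add: power_int_def)
        also have "\<dots> = (-1) powi (int k + int k + d e)"
        proof -
          have e: "int k + int k + d e = int k + (d e + int k)" by simp
          show ?thesis unfolding e by (rule power_int_add [symmetric]) simp
        qed
        also have "\<dots> = (-1) powi (int k + int k) * (-1) powi (d e)"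
          by (simp add: power_int_add)
        also have "(-1 :: 'k) powi (int k + int k) = 1"
          by (simp add: power_int_add power_mult_distrib [symmetric])
        finally have "(-1 :: 'k) ^ k * (-1) ^ nat (d e + int k) = (-1) powi (P - int e)"
          by (simp add: d_def)
        then have *: "of_nat (N choose k) * ((-1 :: 'k) ^ k * (-1) ^ nat (d e + int k)) * (of_int (d e) gchoose nat (d e + int k)) * y e
          = of_nat (N choose k) * (-1) powi (P - int e) * (of_int (d e) gchoose nat (d e + int k)) * y e"
          by simp
        show ?thesis using True * by (simp add: d_def mult_ac)
      next
        case False
        then show ?thesis by (simp add: d_def)
      qed
      then have "(\<Sum>k\<le>N. ?c k e) = (-1) powi (P - int e) * y e *
         (\<Sum>k\<le>N. if 0 \<le> d e + int k then of_nat (N choose k) * (of_int (d e) gchoose nat (d e + int k)) else 0)"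
        by (simp only: sum_distrib_left)
      also have "(\<Sum>k\<le>N. if 0 \<le> d e + int k then of_nat (N choose k) * (of_int (d e) gchoose nat (d e + int k)) else 0) = (1 :: 'k)"
        by (rule Vandermonde_shifted) (use False in simp)
      finally show ?thesis by simp
    qed
  qed
  also have "\<dots> = Sum_any (\<lambda>k. (-1) powi (P - int k) * y k)"
  proof (rule Sum_any_eq_sum [symmetric])
    fix e assume "e \<notin> {..E}"
    then have "P - int e < - int N" by (auto simp: E_def)
    then show "(-1) powi (P - int e) * y e = 0" by (simp add: y0)
  qed simp
  finally show ?thesis by (simp add: y_def)
qed

text \<open>
  The coefficient of \<open>z^P\<close> in \<open>Y(z) S(z) = e^{zT} Y(-z) \<sigma>\<close>.  Locality with the vacuum gives it after
  multiplication by \<open>z^N\<close>, which only shifts the coefficients; it holds modulo every power of \<open>h\<close>, hence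
  exactly.
\<close>

lemma skew_symmetry:
  "hsum scale (\<lambda>i. Y (S s i) (P - i))
     = hsum scale (\<lambda>k. scale (fps_const ((-1) powi (P - int k))) (T_dpow k (Y (flip s) (P - int k))))"
proof (rule hom_ext [of "\<lambda>s. hsum scale (\<lambda>i. Y (S s i) (P - i))"])
  show "module_hom cscale scale (\<lambda>s. hsum scale (\<lambda>i. Y (S s i) (P - i)))"
    by (rule hom_hsum [OF hom_comp [OF S_linear Y_hom] hsummable_skew_left module_cscale])
  show "module_hom cscale scale (\<lambda>s. hsum scale (\<lambda>k. scale (fps_const ((-1) powi (P - int k))) (T_dpow k (Y (flip s) (P - int k)))))"
    by (rule hom_hsum [OF hom_scaled [OF hom_comp [OF hom_comp [OF flip_hom Y_hom] T_dpow_hom]] hsummable_skew_right module_cscale])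
next
  fix x :: "'b \<times> 'b"
  obtain a b where x: "x = (a, b)" by (cases x)
  define s where "s = (cbasis (a, b) :: ('b \<times> 'b, 'k) cfree)"
  have flip_s: "flip s = cbasis (b, a)" by (simp add: s_def flip_def)
  have vac: "append_vac s = tens3 \<phi> (vbasis \<phi> a) (vbasis \<phi> b) \<Omega>"
    "append_vac (flip s) = tens3 \<phi> (vbasis \<phi> b) (vbasis \<phi> a) \<Omega>"
    unfolding flip_s by (simp_all add: s_def append_vac_basis)
  show "hsum scale (\<lambda>i. Y (S (cbasis x) i) (P - i))
     = hsum scale (\<lambda>k. scale (fps_const ((-1) powi (P - int k))) (T_dpow k (Y (flip (cbasis x)) (P - int k))))"
    unfolding x s_def [symmetric]
  proof (rule hfun_eqI)
    fix M l assume l: "hfun scale M l"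
    obtain N1 where N1: "(linmul (-1) ^^ N1) (expansion (-1) (\<lambda>n p q. l (Y (Y_right \<phi> Y q (op12 (\<lambda>s. S s n) (append_vac s))) p)))
       = (linmul (-1) ^^ N1) (\<lambda>p q. l (Y (Y_right \<phi> Y p (append_vac (flip s))) q))"
      using locality_fun [of M "vbasis \<phi> a" "vbasis \<phi> b"] l unfolding vac by blast
    obtain n0 where n0: "\<forall>n<n0. hdvd scale M (Y (flip s) n)"
      using Y_laurent unfolding laurent_def by blast
    \<comment> \<open>large enough for locality and for cancelling the poles of \<open>Y(z) \<sigma> s\<close>\<close>
    define N where "N = nat (- n0) + N1"
    have "(linmul (-1) ^^ N) (expansion (-1) (\<lambda>n p q. l (Y (Y_right \<phi> Y q (op12 (\<lambda>s. S s n) (append_vac s))) p)))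
       = (linmul (-1) ^^ N) (\<lambda>p q. l (Y (Y_right \<phi> Y p (append_vac (flip s))) q))"
      by (simp add: N_def funpow_add N1)
    moreover have "hdvd scale M (Y (flip s) n)" if "n < - int N" for n
    proof -
      have "n < n0" using that unfolding N_def by linarith
      then show ?thesis using n0 by blast
    qed
    ultimately have "Sum_any (\<lambda>i. l (Y (S s i) (P - i)))
        = Sum_any (\<lambda>k. (-1) powi (P - int k) * l (T_dpow k (Y (flip s) (P - int k))))"
      using locality_vacuum_left [OF l s_def, of N P] locality_vacuum_right [OF l, of N "flip s" P] by simp
    then show "l (hsum scale (\<lambda>i. Y (S s i) (P - i)))
      = l (hsum scale (\<lambda>k. scale (fps_const ((-1) powi (P - int k))) (T_dpow k (Y (flip s) (P - int k)))))"
      unfolding hfun_hsum [OF hsummable_skew_left l] hfun_hsum [OF hsummable_skew_right l] hfun_scale [OF l] .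
  qed
qed

section \<open>Products and iterates of vertex operators\<close>

text \<open>
  The product \<open>Y(x + w)(1 \<otimes> Y(w)) t\<close> at \<open>x^p w^q\<close>.  By \<open>vertex_product_eq\<close> it is the Taylor expansion
  \<open>\<Sum>m. w^m / m! Y^{(m)}(x)(1 \<otimes> Y(w)) t\<close>.
\<close>

definition vertex_product :: "('b \<times> 'b \<times> 'b, 'k) cfree \<Rightarrow> int \<Rightarrow> int \<Rightarrow> 'v" where
  "vertex_product t p q = hsum scale (\<lambda>m. scale (fps_const (bincoef 1 p m)) (Y (Y_right \<phi> Y (q - int m) t) (p + int m)))"

lemma dz_power: "(dz scale ^^ m) f p = scale (fps_const (fact m * bincoef 1 p m)) (f (p + int m))"
proof (induction m arbitrary: p)
  case (Suc m)
  have "fact m * (of_int (p + 1) * bincoef (1::'k) (p + 1) m) = fact (Suc m) * bincoef 1 p (Suc m)"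
    unfolding bincoef_absorb by (simp add: mult_ac)
  then have c: "of_int (p + 1) * (fact m * bincoef (1::'k) (p + 1) m) = fact (Suc m) * bincoef 1 p (Suc m)"
    by (simp only: mult_ac)
  have i: "p + 1 + int m = p + int (Suc m)" by simp
  have "(dz scale ^^ Suc m) f p = scale (of_int (p + 1)) ((dz scale ^^ m) f (p + 1))"
    by (simp add: dz_def [of scale "(dz scale ^^ m) f"])
  then show ?case
    unfolding Suc.IH fps_const_of_int scale_scale fps_const_mult c i .
qed simp

lemma vertex_product_eq:
  "hsum scale (\<lambda>m. scale (fps_const (1 / fact m)) ((dz scale ^^ m) (Y (Y_right \<phi> Y (q - int m) t)) p)) = vertex_product t p q"
  by (simp add: vertex_product_def dz_power mult.assoc [symmetric])

lemma hsummable_vertex_product: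
  "hsummable scale (\<lambda>m. scale (fps_const (bincoef 1 p m)) (Y (Y_right \<phi> Y (q - int m) t) (p + int m)))"
  unfolding hsummable_def
proof
  fix M
  obtain l0 where l0: "\<forall>l<l0. hdvd cscale M (Y_right \<phi> Y l t)"
    using Y_right_lower [OF fin_type_const, where 'a = unit] by blast
  have "{m. \<not> hdvd scale M (scale (fps_const (bincoef 1 p m)) (Y (Y_right \<phi> Y (q - int m) t) (p + int m)))}
      \<subseteq> {..nat (q - l0)}"
  proof
    fix m assume "m \<in> {m. \<not> hdvd scale M (scale (fps_const (bincoef 1 p m)) (Y (Y_right \<phi> Y (q - int m) t) (p + int m)))}"
    then have "\<not> q - int m < l0" using l0 Y_hdvd hom_hdvd [OF module_hom_scale_self] by blast
    then show "m \<in> {..nat (q - l0)}" by auto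
  qed
  then show "finite {m. \<not> hdvd scale M (scale (fps_const (bincoef 1 p m)) (Y (Y_right \<phi> Y (q - int m) t) (p + int m)))}"
    by (rule finite_subset) simp
qed

lemma vertex_product_hom: "module_hom cscale scale (\<lambda>t. vertex_product t p q)"
  unfolding vertex_product_def
  by (rule hom_hsum [OF hom_scaled [OF hom_comp [OF Y_right_hom Y_hom]] hsummable_vertex_product module_cscale])

lemma hfun_vertex_product:
  assumes l: "hfun scale M l"
  shows "l (vertex_product t p q) = Sum_any (\<lambda>m. bincoef 1 p m * l (Y (Y_right \<phi> Y (q - int m) t) (p + int m)))"
  unfolding vertex_product_def hfun_hsum [OF hsummable_vertex_product l] hfun_scale [OF l] ..

lemma vertex_product_lower:
  assumes v: "fin_type M v"
  shows "\<exists>q0. \<forall>q<q0. \<forall>i p. hdvd scale M (vertex_product (v i) p q)"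
    and "\<exists>p0. \<forall>p<p0. \<forall>i. hdvd scale M (vertex_product (v i) p q)"
proof -
  obtain l0 where l0: "\<forall>l<l0. \<forall>i. hdvd cscale M (Y_right \<phi> Y l (v i))"
    using Y_right_lower [OF v] by blast
  have z: "l (Y (Y_right \<phi> Y n (v i)) p) = 0" if "hfun scale M l" "n < l0" for l n i p
    using l0 that Y_hdvd hfun_hdvd by blast
  have "hdvd scale M (vertex_product (v i) p q)" if "q < l0" for q i p
    unfolding hdvd_iff_hfun
  proof (intro allI impI)
    fix l assume l: "hfun scale M l"
    have "l (Y (Y_right \<phi> Y (q - int m) (v i)) (p + int m)) = 0" for m
      by (rule z [OF l]) (use that in linarith)
    then show "l (vertex_product (v i) p q) = 0" by (simp add: hfun_vertex_product [OF l])
  qed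
  then show "\<exists>q0. \<forall>q<q0. \<forall>i p. hdvd scale M (vertex_product (v i) p q)" by blast
  have "\<exists>p0. \<forall>p<p0. \<forall>i. hdvd scale M (Y (Y_right \<phi> Y (q - int m) (v i)) (p + int m))" for m
  proof -
    obtain p0 where "\<forall>p<p0. \<forall>i. hdvd scale M (Y (Y_right \<phi> Y (q - int m) (v i)) p)"
      using Y_hom_lower [OF v Y_right_hom] by blast
    then have "\<forall>p<p0 - int m. \<forall>i. hdvd scale M (Y (Y_right \<phi> Y (q - int m) (v i)) (p + int m))" by simp
    then show ?thesis ..
  qed
  then have "\<exists>p0. \<forall>m\<in>{..nat (q - l0)}. \<forall>p<p0. \<forall>i. hdvd scale M (Y (Y_right \<phi> Y (q - int m) (v i)) (p + int m))"
    by (intro uniform_lower_bound) auto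
  then obtain p0 where p0: "\<forall>m\<in>{..nat (q - l0)}. \<forall>p<p0. \<forall>i. hdvd scale M (Y (Y_right \<phi> Y (q - int m) (v i)) (p + int m))"
    by blast
  have "hdvd scale M (vertex_product (v i) p q)" if p: "p < p0" for p i
    unfolding hdvd_iff_hfun
  proof (intro allI impI)
    fix l assume l: "hfun scale M l"
    have "l (Y (Y_right \<phi> Y (q - int m) (v i)) (p + int m)) = 0" for m
    proof (cases "m \<le> nat (q - l0)")
      case True
      then show ?thesis using p0 p hfun_hdvd [OF l] by simp
    next
      case False
      then show ?thesis by (intro z [OF l]) auto
    qed
    then show "l (vertex_product (v i) p q) = 0" by (simp add: hfun_vertex_product [OF l])
  qed
  then show "\<exists>p0. \<forall>p<p0. \<forall>i. hdvd scale M (vertex_product (v i) p q)" by blast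
qed

text \<open>
  The iterate \<open>Y(w)(Y(x) \<otimes> 1) t\<close> at \<open>x^p w^q\<close>.
\<close>

definition vertex_iterate :: "('b \<times> 'b \<times> 'b, 'k) cfree \<Rightarrow> int \<Rightarrow> int \<Rightarrow> 'v" where
  "vertex_iterate t p q = Y (Y_left \<phi> Y p t) q"

lemma vertex_iterate_hom: "module_hom cscale scale (\<lambda>t. vertex_iterate t p q)"
  unfolding vertex_iterate_def by (rule hom_comp [OF Y_left_hom Y_hom])

lemma vertex_iterate_lower:
  assumes v: "fin_type M v"
  shows "\<exists>p0. \<forall>p<p0. \<forall>i q. hdvd scale M (vertex_iterate (v i) p q)"
    and "\<exists>q0. \<forall>q<q0. \<forall>i. hdvd scale M (vertex_iterate (v i) p q)"
  unfolding vertex_iterate_def using Y_left_lower [OF v] Y_hom_lower [OF v Y_left_hom] Y_hdvd by blast+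

section \<open>Braiding the product\<close>

abbreviation S12 where "S12 n \<equiv> op12 (\<lambda>s. S s n)"
abbreviation S13 where "S13 n \<equiv> op13 (\<lambda>s. S s n)"
abbreviation S23 where "S23 n \<equiv> op23 (\<lambda>s. S s n)"
abbreviation swap23 :: "('b \<times> 'b \<times> 'b, 'k) cfree \<Rightarrow> ('b \<times> 'b \<times> 'b, 'k) cfree" where
  "swap23 \<equiv> op23 flip"

lemma swap23_basis: "swap23 (cbasis (a, b, c)) = cbasis (a, c, b)"
  by (simp add: op23_def flip_def)

lemma Y_right_op23: "Y_right \<phi> Y n (op23 F (cbasis (a, b, c))) = tens2 \<phi> (vbasis \<phi> a) (Y (F (cbasis (b, c))) n)"
proof -
  have "Y_right \<phi> Y n (clift (\<lambda>(b', c'). cbasis (a, b', c')) s) = tens2 \<phi> (vbasis \<phi> a) (Y s n)" for s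
    by (rule cfree.hom_ext [OF hom_comp [OF clift_hom Y_right_hom] hom_comp [OF Y_hom tens2_hom_right]])
       (auto simp: Y_right_def)
  then show ?thesis by (simp add: op23_def)
qed

lemma swap23_S13: "swap23 (S13 n (cbasis (a, b, c))) = S12 n (cbasis (a, c, b))"
proof -
  have "swap23 (clift (\<lambda>(a', c'). cbasis (a', b, c')) s) = clift (\<lambda>(a', c'). cbasis (a', c', b)) s" for s
    by (rule cfree.hom_ext [OF hom_comp [OF clift_hom op_hom(3)] clift_hom]) (auto simp: swap23_basis)
  then show ?thesis by (simp add: op13_def op12_def)
qed

lemma S23_family:
  shows "fin_type M (\<lambda>r. S23 r s)" and "\<exists>r0. \<forall>r<r0. hdvd cscale M (S23 r s)"
  by (rule operator_series_single [OF operator_series_op(3)])+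

lemma hsummable_skew23_left: "hsummable cscale (\<lambda>r. Y_right \<phi> Y (q - r) (S23 r s))"
  unfolding hsummable_def
proof
  fix M
  obtain r0 where r0: "\<forall>r<r0. hdvd cscale M (S23 r s)" using S23_family(2) by blast
  obtain l0 where l0: "\<forall>l<l0. \<forall>r. hdvd cscale M (Y_right \<phi> Y l (S23 r s))"
    using Y_right_lower [OF S23_family(1)] by blast
  have "{r. \<not> hdvd cscale M (Y_right \<phi> Y (q - r) (S23 r s))} \<subseteq> {r0..q - l0}"
  proof
    fix r assume "r \<in> {r. \<not> hdvd cscale M (Y_right \<phi> Y (q - r) (S23 r s))}"
    then have "\<not> r < r0" "\<not> q - r < l0" using r0 l0 hom_hdvd [OF Y_right_hom] by blast+
    then show "r \<in> {r0..q - l0}" by auto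
  qed
  then show "finite {r. \<not> hdvd cscale M (Y_right \<phi> Y (q - r) (S23 r s))}" by (rule finite_subset) simp
qed

lemma hsummable_skew23_right:
  "hsummable cscale (\<lambda>k. cscale (fps_const ((-1) powi (q - int k))) (T_right_dpow k (Y_right \<phi> Y (q - int k) s)))"
  unfolding hsummable_def
proof
  fix M
  obtain l0 where l0: "\<forall>l<l0. hdvd cscale M (Y_right \<phi> Y l s)"
    using Y_right_lower [OF fin_type_const, where 'a = unit] by blast
  have "{k. \<not> hdvd cscale M (cscale (fps_const ((-1) powi (q - int k))) (T_right_dpow k (Y_right \<phi> Y (q - int k) s)))}
      \<subseteq> {..nat (q - l0)}"
  proof
    fix k assume "k \<in> {k. \<not> hdvd cscale M (cscale (fps_const ((-1) powi (q - int k))) (T_right_dpow k (Y_right \<phi> Y (q - int k) s)))}"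
    then have "\<not> q - int k < l0"
      using l0 hom_hdvd [OF T_right_dpow_hom] hom_hdvd [OF cfree.module_hom_scale_self] by blast
    then show "k \<in> {..nat (q - l0)}" by auto
  qed
  then show "finite {k. \<not> hdvd cscale M (cscale (fps_const ((-1) powi (q - int k))) (T_right_dpow k (Y_right \<phi> Y (q - int k) s)))}"
    by (rule finite_subset) simp
qed

lemma skew_symmetry_23:
  "hsum cscale (\<lambda>r. Y_right \<phi> Y (q - r) (S23 r s))
    = hsum cscale (\<lambda>k. cscale (fps_const ((-1) powi (q - int k))) (T_right_dpow k (Y_right \<phi> Y (q - int k) (swap23 s))))"
proof (rule cfree.hom_ext [of "\<lambda>s. hsum cscale (\<lambda>r. Y_right \<phi> Y (q - r) (S23 r s))"])
  show "module_hom cscale cscale (\<lambda>s. hsum cscale (\<lambda>r. Y_right \<phi> Y (q - r) (S23 r s)))"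
    by (rule cfree.hom_hsum [OF hom_comp [OF op_hom(3) Y_right_hom] hsummable_skew23_left module_cscale])
  show "module_hom cscale cscale (\<lambda>s. hsum cscale (\<lambda>k. cscale (fps_const ((-1) powi (q - int k))) (T_right_dpow k (Y_right \<phi> Y (q - int k) (swap23 s)))))"
    by (rule cfree.hom_hsum [OF hom_scaled [OF hom_comp [OF hom_comp [OF op_hom(3) Y_right_hom] T_right_dpow_hom]] hsummable_skew23_right module_cscale])
next
  fix x :: "'b \<times> 'b \<times> 'b"
  obtain a b c where x: "x = (a, b, c)" by (cases x)
  show "hsum cscale (\<lambda>r. Y_right \<phi> Y (q - r) (S23 r (cbasis x)))
    = hsum cscale (\<lambda>k. cscale (fps_const ((-1) powi (q - int k))) (T_right_dpow k (Y_right \<phi> Y (q - int k) (swap23 (cbasis x)))))"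
  proof (rule cfree.hfun_eqI)
    fix M and l :: "('b \<times> 'b, 'k) cfree \<Rightarrow> 'k" assume l: "hfun cscale M l"
    note l' = hfun_comp [OF tens2_hom_right l]
    show "l (hsum cscale (\<lambda>r. Y_right \<phi> Y (q - r) (S23 r (cbasis x))))
      = l (hsum cscale (\<lambda>k. cscale (fps_const ((-1) powi (q - int k))) (T_right_dpow k (Y_right \<phi> Y (q - int k) (swap23 (cbasis x))))))"
      unfolding cfree.hfun_hsum [OF hsummable_skew23_left l] cfree.hfun_hsum [OF hsummable_skew23_right l] hfun_scale [OF l]
      unfolding x Y_right_op23 T_right_dpow_tens2
      using arg_cong [OF skew_symmetry [of "cbasis (b, c)" q], of "\<lambda>y. l (tens2 \<phi> (vbasis \<phi> a) y)"]
      unfolding hfun_hsum [OF hsummable_skew_left l'] hfun_hsum [OF hsummable_skew_right l'] hfun_scale [OF l'] .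
  qed
qed

text \<open>
  The product composed with \<open>S^{23}(w)\<close> is \<open>e^{wT} Y(x)(1 \<otimes> Y(-w) \<sigma>)\<close>: skew symmetry in the last two
  factors gives \<open>Y(x + w)(1 \<otimes> e^{wT} Y(-w) \<sigma>)\<close>, and \<open>e^{wT}\<close> moves to the left.
\<close>

lemma vertex_product_S23:
  assumes l: "hfun scale M l"
  shows "Sum_any (\<lambda>r. l (vertex_product (S23 r s) p (q - r)))
    = twist (\<lambda>k p q. l (T_dpow k (Y (Y_right \<phi> Y q (swap23 s)) p))) p q"
proof -
  let ?u = "\<lambda>n j. l (Y (T_right_dpow j (Y_right \<phi> Y (q - int n) (swap23 s))) (p + int (n - j)))"
  obtain r0 where r0: "\<forall>r<r0. hdvd cscale M (S23 r s)" using S23_family(2) by blast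
  obtain l0 where l0: "\<forall>l<l0. \<forall>r. hdvd cscale M (Y_right \<phi> Y l (S23 r s))"
    using Y_right_lower [OF S23_family(1)] by blast
  obtain l1 where l1: "\<forall>l<l1. hdvd cscale M (Y_right \<phi> Y l (swap23 s))"
    using Y_right_lower [OF fin_type_const, where 'a = unit] by blast
  let ?f = "\<lambda>r m. bincoef 1 p m * l (Y (Y_right \<phi> Y (q - r - int m) (S23 r s)) (p + int m))"
  let ?g = "\<lambda>m k. bincoef 1 p m * ((-1) powi (q - int m - int k) * l (Y (T_right_dpow k (Y_right \<phi> Y (q - int m - int k) (swap23 s))) (p + int m)))"
  have "{(r, m). ?f r m \<noteq> 0} \<subseteq> {r0..q - l0} \<times> {..nat (q - r0 - l0)}"
  proof (rule pair_subsetI)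
    fix r m assume "?f r m \<noteq> 0"
    then have nz: "\<not> hdvd scale M (Y (Y_right \<phi> Y (q - r - int m) (S23 r s)) (p + int m))"
      using hfun_hdvd [OF l] by auto
    then have "\<not> hdvd cscale M (Y_right \<phi> Y (q - r - int m) (S23 r s))" using Y_hdvd by blast
    then have "\<not> r < r0" "\<not> q - r - int m < l0" using r0 l0 hom_hdvd [OF Y_right_hom] by blast+
    then show "(r, m) \<in> {r0..q - l0} \<times> {..nat (q - r0 - l0)}" by auto
  qed
  then have finf: "finite {(r, m). ?f r m \<noteq> 0}" by (rule finite_subset) simp
  have "{(m, k). ?g m k \<noteq> 0} \<subseteq> {..nat (q - l1)} \<times> {..nat (q - l1)}"
  proof (rule pair_subsetI)
    fix m k assume "?g m k \<noteq> 0"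
    then have nz: "\<not> hdvd scale M (Y (T_right_dpow k (Y_right \<phi> Y (q - int m - int k) (swap23 s))) (p + int m))"
      using hfun_hdvd [OF l] by auto
    then have "\<not> hdvd cscale M (Y_right \<phi> Y (q - int m - int k) (swap23 s))"
      using Y_hdvd hom_hdvd [OF T_right_dpow_hom] by blast
    then have "\<not> q - int m - int k < l1" using l1 by blast
    then show "(m, k) \<in> {..nat (q - l1)} \<times> {..nat (q - l1)}" by auto
  qed
  then have fing: "finite {(m, k). ?g m k \<noteq> 0}" by (rule finite_subset) simp
  have "Sum_any (\<lambda>r. l (vertex_product (S23 r s) p (q - r))) = Sum_any (\<lambda>r. Sum_any (?f r))"
    unfolding hfun_vertex_product [OF l] ..
  also have "\<dots> = Sum_any (\<lambda>m. Sum_any (\<lambda>r. ?f r m))"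
    by (rule Sum_any_commute [OF finf])
  also have "\<dots> = Sum_any (\<lambda>m. Sum_any (?g m))"
  proof (rule Sum_any.cong)
    fix m
    note l' = hfun_comp [OF Y_hom [of "p + int m"] l]
    have i: "q - r - int m = q - int m - r" for r by simp
    show "Sum_any (\<lambda>r. ?f r m) = Sum_any (?g m)"
      unfolding Sum_any_cmult i
      using arg_cong [OF skew_symmetry_23 [of "q - int m" s], of "\<lambda>y. l (Y y (p + int m))"]
      unfolding cfree.hfun_hsum [OF hsummable_skew23_left l'] cfree.hfun_hsum [OF hsummable_skew23_right l'] hfun_scale [OF l']
      by (rule arg_cong)
  qed
  also have "\<dots> = Sum_any (\<lambda>n. \<Sum>j\<le>n. ?g (n - j) j)"
    by (rule Sum_any_antidiagonal [OF fing])
  also have "\<dots> = Sum_any (\<lambda>n. (-1) powi (q - int n) * (\<Sum>j\<le>n. bincoef 1 p (n - j) * ?u n j))"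
  proof (rule Sum_any.cong)
    fix n
    show "(\<Sum>j\<le>n. ?g (n - j) j) = (-1) powi (q - int n) * (\<Sum>j\<le>n. bincoef 1 p (n - j) * ?u n j)"
      unfolding sum_distrib_left
    proof (rule sum.cong [OF refl])
      fix j assume "j \<in> {..n}"
      then have i: "q - int (n - j) - int j = q - int n" by auto
      show "?g (n - j) j = (-1) powi (q - int n) * (bincoef 1 p (n - j) * ?u n j)"
        unfolding i by (rule mult.left_commute)
    qed
  qed
  also have "\<dots> = twist (\<lambda>k p q. l (T_dpow k (Y (Y_right \<phi> Y q (swap23 s)) p))) p q"
    unfolding twist_def Y_exp_T [OF l] ..
  finally show ?thesis .
qed

section \<open>Associativity after braiding\<close>

lemma S13_family:
  shows "fin_type M (\<lambda>n. S13 n t)" and "\<exists>n0. \<forall>n<n0. hdvd cscale M (S13 n t)"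
  by (rule operator_series_single [OF operator_series_op(2)])+

lemma S23_S13_family:
  shows "fin_type M (\<lambda>(r, n). S23 r (S13 n t))"
    and "\<exists>r0. \<forall>r<r0. \<forall>n. hdvd cscale M (S23 r (S13 n t))"
    and "\<exists>n0. \<forall>n<n0. \<forall>r. hdvd cscale M (S23 r (S13 n t))"
proof -
  show "fin_type M (\<lambda>(r, n). S23 r (S13 n t))"
    by (rule operator_series_fin_type [OF operator_series_op(3) S13_family(1)])
  show "\<exists>r0. \<forall>r<r0. \<forall>n. hdvd cscale M (S23 r (S13 n t))"
    by (rule operator_series_lower [OF operator_series_op(3) S13_family(1)])
  show "\<exists>n0. \<forall>n<n0. \<forall>r. hdvd cscale M (S23 r (S13 n t))"
    using S13_family(2) [of M t] hom_hdvd [OF op_hom(3)] by blast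
qed

lemma S23_S13_mod_h: "hcong cscale 1 (S23 r (S13 n t)) (if r = 0 \<and> n = 0 then t else 0)"
proof -
  have op: "hdvd cscale 1 (\<Theta> t - (if m = 0 then t else 0))"
    if hom: "module_hom cscale cscale \<Theta>"
      and basis: "\<And>x. \<exists>F y. \<Theta> (cbasis x) = clift F (S y m) \<and> clift F y = cbasis x"
    for \<Theta> :: "('b \<times> 'b \<times> 'b, 'k) cfree \<Rightarrow> ('b \<times> 'b \<times> 'b, 'k) cfree" and m and t
  proof (rule cfree.hdvd_hom_basis [where D = "\<lambda>t. \<Theta> t - (if m = 0 then t else 0)"])
    show "module_hom cscale cscale (\<lambda>t. \<Theta> t - (if m = 0 then t else 0))"
      using hom by (simp add: module_hom_iff module.scale_right_diff_distrib [OF module_cscale])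
    fix x
    obtain F y where F: "\<Theta> (cbasis x) = clift F (S y m)" "clift F y = cbasis x" using basis by blast
    have "hdvd cscale 1 (clift F (S y m - (if m = 0 then y else 0)))"
      by (rule hom_hdvd [OF clift_hom S_mod_h [of y m, unfolded hcong_def]])
    then show "hdvd cscale 1 (\<Theta> (cbasis x) - (if m = 0 then cbasis x else 0))"
      using F(2) module_hom.diff [OF clift_hom, of F] module_hom.zero [OF clift_hom, of F] by (simp add: F(1) split: if_splits)
  qed
  have 23: "hdvd cscale 1 (S23 m t - (if m = 0 then t else 0))" for m t
  proof (rule op [OF op_hom(3)])
    fix x :: "'b \<times> 'b \<times> 'b"
    obtain a b c where x: "x = (a, b, c)" by (cases x)
    show "\<exists>F y. S23 m (cbasis x) = clift F (S y m) \<and> clift F y = cbasis x"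
      unfolding x by (rule exI [of _ "\<lambda>(b', c'). cbasis (a, b', c')"], rule exI [of _ "cbasis (b, c)"]) (simp add: op23_def)
  qed
  have 13: "hdvd cscale 1 (S13 m t - (if m = 0 then t else 0))" for m t
  proof (rule op [OF op_hom(2)])
    fix x :: "'b \<times> 'b \<times> 'b"
    obtain a b c where x: "x = (a, b, c)" by (cases x)
    show "\<exists>F y. S13 m (cbasis x) = clift F (S y m) \<and> clift F y = cbasis x"
      unfolding x by (rule exI [of _ "\<lambda>(a', c'). cbasis (a', b, c')"], rule exI [of _ "cbasis (a, c)"]) (simp add: op13_def)
  qed
  have "S23 r (S13 n t) - (if r = 0 \<and> n = 0 then t else 0)
      = (S23 r (S13 n t) - (if r = 0 then S13 n t else 0)) + (if r = 0 then S13 n t - (if n = 0 then t else 0) else 0)"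
    by simp
  moreover have "hdvd cscale 1 (x + y)" if "hdvd cscale 1 x" "hdvd cscale 1 y" for x y :: "('b \<times> 'b \<times> 'b, 'k) cfree"
    using that by (simp add: hdvd_cscale_iff)
  moreover have "hdvd cscale 1 (if r = 0 then S13 n t - (if n = 0 then t else 0) else 0)"
    using 13 [of n t] by (simp add: hdvd_cscale_iff)
  ultimately show ?thesis unfolding hcong_def using 23 by metis
qed

text \<open>
  The product composed with \<open>S^{23}(w) S^{13}(x + w)\<close> is
  \<open>e^{wT} Y(x)(1 \<otimes> Y(-w)) S^{12}(x + w) \<sigma>^{23}\<close>, because \<open>\<sigma>^{23} S^{13} = S^{12} \<sigma>^{23}\<close>.
\<close>

lemma braided_left_side:
  fixes a b c :: 'b
  assumes l: "hfun scale M l"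
  defines "H \<equiv> \<lambda>k n p q. l (T_dpow k (Y (Y_right \<phi> Y q (S12 n (cbasis (a, c, b)))) p))"
  shows "expansion 1 (\<lambda>n p q. Sum_any (\<lambda>r. l (vertex_product (S23 r (S13 n (cbasis (a, b, c)))) p (q - r))))
    = twist (\<lambda>k. expansion (-1) (H k))" and "bdd_q (\<lambda>k. expansion (-1) (H k))"
proof -
  let ?E = "\<lambda>n p q. if hdvd scale M (Y (Y_right \<phi> Y q (S12 n (cbasis (a, c, b)))) p) then 0 else (1 :: nat)"
  have E: "expandable ?E" by (rule expandable_right [OF operator_series_single [OF operator_series_op(1)]])
  have H: "H k n p q = 0" if "?E n p q = 0" for k n p q
    using that hfun_hdvd [OF l hom_hdvd [OF T_dpow_hom]] by (auto simp: H_def split: if_splits)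
  have "Sum_any (\<lambda>r. l (vertex_product (S23 r (S13 n (cbasis (a, b, c)))) p (q - r))) = twist (\<lambda>k. H k n) p q" for n p q
    unfolding vertex_product_S23 [OF l] H_def swap23_S13 ..
  then show "expansion 1 (\<lambda>n p q. Sum_any (\<lambda>r. l (vertex_product (S23 r (S13 n (cbasis (a, b, c)))) p (q - r))))
    = twist (\<lambda>k. expansion (-1) (H k))"
    using expansion_twist(1) [OF E H] by simp
  show "bdd_q (\<lambda>k. expansion (-1) (H k))" by (rule expansion_twist(2) [OF E H])
qed

lemma flip_Y_left: "flip (Y_left \<phi> Y p (cbasis (a, b, c))) = Y_right \<phi> Y p (cbasis (c, a, b))"
  by (simp add: Y_left_def Y_right_def flip_tens2)

end

context quantum_voa
begin

lemma hexagon_fun: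
  assumes l: "hfun cscale M l"
  shows "l (S (Y_left \<phi> Y p x) q)
    = Sum_any (\<lambda>(j, i). bincoef 1 j i * l (Y_left \<phi> Y (p - int i) (S23 (q - j) (S13 (j + int i) x))))"
proof -
  have "hsummable cscale (\<lambda>(j, i). cscale (binc 1 j i) (Y_left \<phi> Y (p - int i) (S23 (q - j) (S13 (j + int i) x))))"
    unfolding hsummable_def
  proof
    fix M
    let ?E = "\<lambda>n q p. if hdvd cscale M (Y_left \<phi> Y p (S23 q (S13 n x))) then 0 else (1 :: nat)"
    obtain r0 where r0: "\<forall>r<r0. \<forall>n. hdvd cscale M (S23 r (S13 n x))" using S23_S13_family(2) by blast
    obtain n0 where n0: "\<forall>n<n0. \<forall>r. hdvd cscale M (S23 r (S13 n x))" using S23_S13_family(3) by blast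
    obtain p0 where p0: "\<forall>p<p0. \<forall>i. hdvd cscale M (Y_left \<phi> Y p ((\<lambda>(r, n). S23 r (S13 n x)) i))"
      using Y_left_lower [OF S23_S13_family(1)] by blast
    have p0': "hdvd cscale M (Y_left \<phi> Y p (S23 r (S13 n x)))" if "p < p0" for p r n
      using p0 [THEN spec, THEN mp, OF that, THEN spec, of "(r, n)"] by simp
    have "\<forall>n<n0. \<forall>q p. ?E n q p = 0" "\<forall>p<p0. \<forall>n q. ?E n q p = 0" "\<forall>q<r0. \<forall>n p. ?E n q p = 0"
      using n0 r0 p0' hom_hdvd [OF Y_left_hom] by simp_all
    then have E: "expandable ?E" unfolding expandable_def by blast
    show "finite {x'. \<not> hdvd cscale M (case x' of (j, i) \<Rightarrow>
        cscale (binc 1 j i) (Y_left \<phi> Y (p - int i) (S23 (q - j) (S13 (j + int i) x))))}"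
      by (rule finite_subset [OF _ finite_expansion_index [OF E, where p = q and q = p]])
         (auto dest: hom_hdvd [OF cfree.module_hom_scale_self])
  qed
  from cfree.hfun_hsum [OF this l] show ?thesis
    unfolding QA4 by (simp add: case_prod_unfold binc_eq hfun_scale [OF l])
qed

text \<open>
  The iterate composed with \<open>S^{23}(w) S^{13}(x + w)\<close>, now expanded in nonnegative powers of \<open>x\<close> as in the
  hexagon relation, is \<open>Y(w) S(w)(Y(x) \<otimes> 1)\<close>, to which skew symmetry applies.
\<close>

lemma braided_right_side:
  fixes a b c :: 'b
  assumes l: "hfun scale M l"
  defines "H \<equiv> \<lambda>k p q. l (T_dpow k (Y (Y_right \<phi> Y p (cbasis (c, a, b))) q))"
  shows "expansion' (\<lambda>n p q. Sum_any (\<lambda>r. l (vertex_iterate (S23 r (S13 n (cbasis (a, b, c)))) p (q - r)))) = twist H"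
    and "bdd_q H"
proof -
  define t where "t = (cbasis (a, b, c) :: ('b \<times> 'b \<times> 'b, 'k) cfree)"
  let ?u = "\<lambda>(r, n). S23 r (S13 n t)"
  show "expansion' (\<lambda>n p q. Sum_any (\<lambda>r. l (vertex_iterate (S23 r (S13 n (cbasis (a, b, c)))) p (q - r)))) = twist H"
    unfolding t_def [symmetric]
  proof (intro ext)
    fix p q
    let ?f = "\<lambda>(j, i) r. bincoef 1 j i * l (vertex_iterate (S23 (r - j) (S13 (j + int i) t)) (p - int i) (q - r))"
    obtain r0 where r0: "\<forall>r<r0. \<forall>n. hdvd cscale M (S23 r (S13 n t))" using S23_S13_family(2) by blast
    obtain n0 where n0: "\<forall>n<n0. \<forall>r. hdvd cscale M (S23 r (S13 n t))" using S23_S13_family(3) by blast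
    obtain p0 where p0: "\<forall>p<p0. \<forall>i q. hdvd scale M (vertex_iterate (?u i) p q)"
      using vertex_iterate_lower(1) [OF S23_S13_family(1)] by blast
    define I where "I = nat (p - p0)"
    have "\<exists>q0. \<forall>i\<in>{..I}. \<forall>q<q0. \<forall>x. hdvd scale M (vertex_iterate (?u x) (p - int i) q)"
      by (rule uniform_lower_bound) (use vertex_iterate_lower(2) [OF S23_S13_family(1)] in auto)
    then obtain q0 where q0: "\<forall>i\<in>{..I}. \<forall>q<q0. \<forall>x. hdvd scale M (vertex_iterate (?u x) (p - int i) q)" by blast
    have "{(x, r). ?f x r \<noteq> 0} \<subseteq> ({n0 - int I..q - q0 - r0} \<times> {..I}) \<times> {r0 + n0 - int I..q - q0}"
    proof (rule pair_subsetI)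
      fix x r assume nz: "?f x r \<noteq> 0"
      obtain j i where x: "x = (j, i)" by (cases x)
      have nd: "\<not> hdvd scale M (vertex_iterate (S23 (r - j) (S13 (j + int i) t)) (p - int i) (q - r))"
        using nz hfun_hdvd [OF l] by (auto simp: x)
      have "\<not> p - int i < p0" using nd p0 [THEN spec, THEN mp, THEN spec, THEN spec, of "p - int i" "(r - j, j + int i)"] by auto
      then have i: "i \<le> I" by (simp add: I_def)
      then have q: "\<not> q - r < q0"
        using nd q0 [THEN bspec, THEN spec, THEN mp, THEN spec, of i "q - r" "(r - j, j + int i)"] by auto
      have "\<not> hdvd cscale M (S23 (r - j) (S13 (j + int i) t))"
        using nd hom_hdvd [OF vertex_iterate_hom] by blast
      then have "\<not> r - j < r0" "\<not> j + int i < n0" using r0 n0 by blast+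
      with i q show "(x, r) \<in> ({n0 - int I..q - q0 - r0} \<times> {..I}) \<times> {r0 + n0 - int I..q - q0}"
        by (auto simp: x)
    qed
    then have fin: "finite {(x, r). ?f x r \<noteq> 0}" by (rule finite_subset) simp
    \<comment> \<open>the hexagon relation is indexed by the exponent of \<open>w\<close> in \<open>S(w)\<close>, which is \<open>r + j\<close> here\<close>
    have "expansion' (\<lambda>n p q. Sum_any (\<lambda>r. l (vertex_iterate (S23 r (S13 n t)) p (q - r)))) p q = Sum_any (\<lambda>x. Sum_any (?f x))"
      unfolding expansion'_def expansion_def
    proof (rule Sum_any.cong)
      fix x :: "int \<times> nat"
      obtain j i where x: "x = (j, i)" by (cases x)
      have i: "r + j - j = r" "q - (r + j) = q - j - r" for r by simp_all
      have "Sum_any (\<lambda>r. ?f (j, i) (r + j)) = Sum_any (?f (j, i))"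
      proof (rule Sum_any_inj_reindex)
        show "inj (\<lambda>r. r + j)" by (auto simp: inj_on_def)
        fix y assume "y \<notin> range (\<lambda>r. r + j)"
        moreover have "y = (y - j) + j" by simp
        ultimately show "?f (j, i) y = 0" by blast
      qed
      then show "(case x of (j, i) \<Rightarrow> bincoef 1 j i * Sum_any (\<lambda>r. l (vertex_iterate (S23 r (S13 (j + int i) t)) (p - int i) (q - j - r)))) = Sum_any (?f x)"
        unfolding x prod.case i Sum_any_cmult .
    qed
    also have "\<dots> = Sum_any (\<lambda>r. Sum_any (\<lambda>x. ?f x r))"
      by (rule Sum_any_commute [OF fin])
    also have "\<dots> = Sum_any (\<lambda>r. l (Y (S (Y_left \<phi> Y p t) r) (q - r)))"
    proof (rule Sum_any.cong)
      fix r
      show "Sum_any (\<lambda>x. ?f x r) = l (Y (S (Y_left \<phi> Y p t) r) (q - r))"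
        unfolding hexagon_fun [OF hfun_comp [OF Y_hom l]] vertex_iterate_def by (simp add: case_prod_unfold)
    qed
    also have "\<dots> = twist H p q"
      using arg_cong [OF skew_symmetry [of "Y_left \<phi> Y p t" q], of l]
      unfolding hfun_hsum [OF hsummable_skew_left l] hfun_hsum [OF hsummable_skew_right l] hfun_scale [OF l]
      unfolding t_def flip_Y_left twist_def H_def .
    finally show "expansion' (\<lambda>n p q. Sum_any (\<lambda>r. l (vertex_iterate (S23 r (S13 n t)) p (q - r)))) p q = twist H p q" .
  qed
  show "bdd_q H"
    unfolding bdd_q_def
  proof
    fix p
    obtain q0 where "\<forall>q<q0. hdvd scale M (Y (Y_right \<phi> Y p (cbasis (c, a, b))) q)"
      using Y_laurent unfolding laurent_def by blast
    then have "\<forall>q<q0. \<forall>k. H k p q = 0"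
      unfolding H_def using hfun_hdvd [OF l hom_hdvd [OF T_dpow_hom]] by blast
    then show "\<exists>q0. \<forall>q<q0. \<forall>k. H k p q = 0" ..
  qed
qed

text \<open>
  Both sides have the form \<open>e^{wT} X(x, -w)\<close>, and the two series \<open>X\<close> are the two sides of \<open>QA1\<close> in the
  variables \<open>z\<^sub>1 = x\<close>, \<open>z\<^sub>2 = -w\<close>.
\<close>

lemma braided_associativity:
  "\<exists>N. \<forall>l. hfun scale M l \<longrightarrow>
     (linmul 1 ^^ N) (expansion 1 (\<lambda>n p q. Sum_any (\<lambda>r. l (vertex_product (S23 r (S13 n (cbasis x))) p (q - r)))))
     = (linmul 1 ^^ N) (expansion' (\<lambda>n p q. Sum_any (\<lambda>r. l (vertex_iterate (S23 r (S13 n (cbasis x))) p (q - r)))))"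
proof -
  obtain a b c where x: "x = (a, b, c)" by (cases x)
  obtain N where N: "\<And>l u. hfun scale M l \<Longrightarrow>
     (linmul (-1) ^^ N) (expansion (-1) (\<lambda>n p q. l (Y (Y_right \<phi> Y q (S12 n (tens3 \<phi> (vbasis \<phi> a) (vbasis \<phi> c) u))) p)))
     = (linmul (-1) ^^ N) (\<lambda>p q. l (Y (Y_right \<phi> Y p (tens3 \<phi> (vbasis \<phi> c) (vbasis \<phi> a) u)) q))"
    using locality_fun [of M "vbasis \<phi> a" "vbasis \<phi> c"] by blast
  show ?thesis
  proof (intro exI allI impI)
    fix l assume l: "hfun scale M l"
    show "(linmul 1 ^^ N) (expansion 1 (\<lambda>n p q. Sum_any (\<lambda>r. l (vertex_product (S23 r (S13 n (cbasis x))) p (q - r)))))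
      = (linmul 1 ^^ N) (expansion' (\<lambda>n p q. Sum_any (\<lambda>r. l (vertex_iterate (S23 r (S13 n (cbasis x))) p (q - r)))))"
      unfolding x braided_left_side(1) [OF l] braided_right_side(1) [OF l]
        linmul_pow_twist(1) [OF braided_left_side(2) [OF l]] linmul_pow_twist(1) [OF braided_right_side(2) [OF l]]
      using N [OF hfun_comp [OF T_dpow_hom l], of _ "vbasis \<phi> b"] by simp
  qed
qed

section \<open>Removing the braidings\<close>

text \<open>
  Tested on functionals, this is associativity on \<open>t\<close> modulo \<open>h^M\<close> with the factor \<open>z^N\<close>.
\<close>

definition assoc_mod :: "nat \<Rightarrow> nat \<Rightarrow> ('b \<times> 'b \<times> 'b, 'k) cfree \<Rightarrow> bool" where
  "assoc_mod M N t \<longleftrightarrow> (\<forall>l. hfun scale M l \<longrightarrow>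
     (linmul 1 ^^ N) (\<lambda>p q. l (vertex_product t p q)) = (linmul 1 ^^ N) (\<lambda>p q. l (vertex_iterate t p q)))"

lemma assoc_mod_mono: "assoc_mod M N t \<Longrightarrow> N \<le> N' \<Longrightarrow> assoc_mod M N' t"
  unfolding le_iff_add add.commute [of N] by (auto simp: assoc_mod_def funpow_add)

text \<open>
  Both sides are linear in the vector, so the largest exponent needed by the finitely many basis vectors
  involved works for the whole family.
\<close>

lemma assoc_mod_fin_type:
  assumes basis: "\<And>x. \<exists>N. assoc_mod M N (cbasis x)" and u: "fin_type M u"
  shows "\<exists>N. \<forall>i. assoc_mod M N (u i)"
proof -
  obtain K where K: "finite K" "\<And>i m. m < M \<Longrightarrow> Poly_Mapping.keys (fps_nth (u i) m) \<subseteq> K"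
    using u unfolding fin_type_def by blast
  obtain N where N: "\<And>x. assoc_mod M (N x) (cbasis x)" using basis by metis
  define N' where "N' = Max (insert 0 (N ` K))"
  have N': "assoc_mod M N' (cbasis x)" if "x \<in> K" for x
    by (rule assoc_mod_mono [OF N]) (use that K(1) in \<open>simp add: N'_def\<close>)
  have "assoc_mod M N' (u i)" for i
    unfolding assoc_mod_def
  proof (intro allI impI)
    fix l assume l: "hfun scale M l"
    let ?w = "\<lambda>y. fps_nth (ccoord (snd y) (u i)) (fst y)"
    let ?l = "\<lambda>y z. l (scale (fps_X ^ fst y) z)"
    have expand: "l (f (u i)) = (\<Sum>y\<in>{..<M} \<times> K. ?w y * ?l y (f (cbasis (snd y))))"
      if "module_hom cscale scale f" for f
      using hfun_expand [OF hfun_comp [OF that l] K(1), of "u i"] K(2) [of _ i] that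
      by (simp add: module_hom_iff sum.cartesian_product case_prod_unfold)
    have "(linmul 1 ^^ N') (\<lambda>p q. ?l y (vertex_product (cbasis (snd y)) p q)) = (linmul 1 ^^ N') (\<lambda>p q. ?l y (vertex_iterate (cbasis (snd y)) p q))"
      if "y \<in> {..<M} \<times> K" for y
    proof -
      have "assoc_mod M N' (cbasis (snd y))" by (rule N') (use that in auto)
      from this [unfolded assoc_mod_def, THEN spec, THEN mp, OF hfun_comp [OF module_hom_scale_self l]]
      show ?thesis .
    qed
    then have "(\<lambda>p q. \<Sum>y\<in>{..<M} \<times> K. ?w y * (linmul 1 ^^ N') (\<lambda>p q. ?l y (vertex_product (cbasis (snd y)) p q)) p q)
      = (\<lambda>p q. \<Sum>y\<in>{..<M} \<times> K. ?w y * (linmul 1 ^^ N') (\<lambda>p q. ?l y (vertex_iterate (cbasis (snd y)) p q)) p q)"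
      by (intro ext sum.cong refl) simp
    then show "(linmul 1 ^^ N') (\<lambda>p q. l (vertex_product (u i) p q)) = (linmul 1 ^^ N') (\<lambda>p q. l (vertex_iterate (u i) p q))"
      unfolding expand [OF vertex_product_hom] expand [OF vertex_iterate_hom] linmul_pow_lincomb .
  qed
  then show ?thesis by blast
qed

text \<open>
  Induction on \<open>M\<close>.  With \<open>S^{23}(w) S^{13}(z) t = t + h v(w, z)\<close>, the braided identity modulo
  \<open>h^(M + 1)\<close> differs from the desired one by \<open>h\<close> times the same identity for \<open>v(w, z)\<close>, where it is needed
  modulo \<open>h^M\<close> only.
\<close>

lemma assoc_mod_basis: "\<exists>N. assoc_mod M N (cbasis x)"
proof (induction M arbitrary: x)
  case 0
  have "assoc_mod 0 0 (cbasis x)"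
    unfolding assoc_mod_def
  proof (intro allI impI)
    fix l assume l: "hfun scale 0 l"
    have "l y = 0" for y using hfun_X [OF l, of y] by simp
    then show "(linmul 1 ^^ 0) (\<lambda>p q. l (vertex_product (cbasis x) p q)) = (linmul 1 ^^ 0) (\<lambda>p q. l (vertex_iterate (cbasis x) p q))"
      by simp
  qed
  then show ?case ..
next
  case (Suc M)
  define t where "t = (cbasis x :: ('b \<times> 'b \<times> 'b, 'k) cfree)"
  \<comment> \<open>\<open>\<delta> r n\<close> and \<open>v (r, n)\<close>: the coefficients of \<open>w^r z^n\<close> in \<open>t\<close> and in \<open>(S^{23}(w) S^{13}(z) t - t) / h\<close>\<close>
  define \<delta> where "\<delta> r n = (if r = 0 \<and> n = 0 then t else 0)" for r n :: int
  define v where "v = (\<lambda>(r, n). hdiv (S23 r (S13 n t) - \<delta> r n))"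
  have u: "S23 r (S13 n t) = \<delta> r n + cscale fps_X (v (r, n))" for r n
    using cscale_hdiv [of "S23 r (S13 n t) - \<delta> r n"] S23_S13_mod_h [of r n t]
    by (simp add: v_def \<delta>_def hcong_def)
  have \<delta>: "fin_type (Suc M) (\<lambda>(r, n). \<delta> r n)"
    unfolding fin_type_def \<delta>_def
    by (rule exI [of _ "\<Union>m<Suc M. Poly_Mapping.keys (fps_nth t m)"]) auto
  have "fin_type (Suc M) (\<lambda>y. (\<lambda>(r, n). S23 r (S13 n t)) y - (\<lambda>(r, n). \<delta> r n) y)"
    by (rule fin_type_diff [OF S23_S13_family(1) \<delta>])
  from fin_type_hdiv [OF this] have v: "fin_type M v"
    by (simp add: v_def case_prod_unfold)
  obtain r0' where r0': "\<forall>r<r0'. \<forall>n. hdvd cscale (Suc M) (S23 r (S13 n t))" using S23_S13_family(2) by blast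
  obtain n0' where n0': "\<forall>n<n0'. \<forall>r. hdvd cscale (Suc M) (S23 r (S13 n t))" using S23_S13_family(3) by blast
  define r0 where "r0 = min r0' 0"
  define k where "k = nat (- n0')"
  have vr: "hdvd cscale M (v (r, n))" if "r < r0" for r n
    using r0' that by (auto simp: v_def \<delta>_def r0_def intro!: hdvd_hdiv)
  have vn: "hdvd cscale M (v (r, n))" if "n < - int k" for r n
  proof -
    have "n < n0'" "n \<noteq> 0" using that unfolding k_def by linarith+
    then show ?thesis using n0' by (auto simp: v_def \<delta>_def intro!: hdvd_hdiv)
  qed
  obtain N1 where N1: "\<And>i. assoc_mod M N1 (v i)"
    using assoc_mod_fin_type [OF Suc.IH v] by blast
  obtain N2 where N2: "\<And>l. hfun scale (Suc M) l \<Longrightarrow>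
     (linmul 1 ^^ N2) (expansion 1 (\<lambda>n p q. Sum_any (\<lambda>r. l (vertex_product (S23 r (S13 n t)) p (q - r)))))
     = (linmul 1 ^^ N2) (expansion' (\<lambda>n p q. Sum_any (\<lambda>r. l (vertex_iterate (S23 r (S13 n t)) p (q - r)))))"
    using braided_associativity [of "Suc M" x] unfolding t_def by blast
  obtain qA where qA: "\<forall>q<qA. \<forall>i p. hdvd scale M (vertex_product (v i) p q)" using vertex_product_lower(1) [OF v] by blast
  obtain pB where pB: "\<forall>p<pB. \<forall>i q. hdvd scale M (vertex_iterate (v i) p q)" using vertex_iterate_lower(1) [OF v] by blast
  \<comment> \<open>\<open>N1\<close> from the induction hypothesis, \<open>k\<close> for the poles of the braiding in \<open>z\<close>, \<open>N2\<close> from locality\<close>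
  define N where "N = N1 + k + N2"
  have "assoc_mod (Suc M) N t"
    unfolding assoc_mod_def
  proof (intro allI impI)
    fix l assume l: "hfun scale (Suc M) l"
    define l' where "l' = (\<lambda>y. l (scale fps_X y))"
    have l': "hfun scale M l'" unfolding l'_def by (rule hfun_Suc_X [OF module_axioms l])
    define fA where "fA r n p q = l' (vertex_product (v (r, n)) p q)" for r n p q
    define fB where "fB r n p q = l' (vertex_iterate (v (r, n)) p q)" for r n p q
    define FA where "FA n p q = Sum_any (\<lambda>r. fA r n p (q - r))" for n p q
    define FB where "FB n p q = Sum_any (\<lambda>r. fB r n p (q - r))" for n p q
    have z: "l' y = 0" if "hdvd scale M y" for y by (rule hfun_hdvd [OF l' that])
    have A_n: "\<forall>n<(- int k). \<forall>r p q. fA r n p q = 0" and A_r: "\<forall>r<r0. \<forall>n p q. fA r n p q = 0"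
      unfolding fA_def using vn vr z hom_hdvd [OF vertex_product_hom] by blast+
    have A_q: "\<forall>q<qA. \<forall>r n p. fA r n p q = 0" unfolding fA_def using qA z by blast
    have A_p: "\<forall>q. \<exists>p0. \<forall>p<p0. \<forall>r n. fA r n p q = 0"
      unfolding fA_def using vertex_product_lower(2) [OF v] z by meson
    have B_n: "\<forall>n<(- int k). \<forall>r p q. fB r n p q = 0" and B_r: "\<forall>r<r0. \<forall>n p q. fB r n p q = 0"
      unfolding fB_def using vn vr z hom_hdvd [OF vertex_iterate_hom] by blast+
    have B_p: "\<forall>p<pB. \<forall>r n q. fB r n p q = 0" unfolding fB_def using pB z by blast
    have B_q: "\<forall>p. \<exists>q0. \<forall>q<q0. \<forall>r n. fB r n p q = 0"
      unfolding fB_def using vertex_iterate_lower(2) [OF v] z by meson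
    have admA: "expandable FA" unfolding FA_def by (rule conv_expandable(1) [OF A_n A_r A_q A_p])
    have admB: "expandable (\<lambda>n q p. FB n p q)" unfolding FB_def by (rule conv_expandable'(1) [OF B_n B_r B_p B_q])
    have finA: "finite {r. fA r n p (q - r) \<noteq> 0}" for n p q by (rule conv_expandable(2) [OF A_n A_r A_q A_p])
    have finB: "finite {r. fB r n p (q - r) \<noteq> 0}" for n p q by (rule conv_expandable'(2) [OF B_n B_r B_p B_q])
    have fAB: "(linmul 1 ^^ N1) (fA r n) = (linmul 1 ^^ N1) (fB r n)" for r n
      using N1 [of "(r, n)"] l' unfolding assoc_mod_def fA_def fB_def by blast
    have FAB: "(linmul 1 ^^ N1) (FA n) = (linmul 1 ^^ N1) (FB n)" for n
      unfolding FA_def FB_def linmul_pow_conv [where f = "\<lambda>r. fA r n", OF finA] linmul_pow_conv [where f = "\<lambda>r. fB r n", OF finB] fAB ..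
    have FA0: "FA n = (\<lambda>p q. 0)" if "n < - int k" for n
      using A_n that by (simp add: FA_def fun_eq_iff)
    have exch: "(linmul 1 ^^ N) (expansion 1 FA) = (linmul 1 ^^ N) (expansion' FB)"
      using expansion_exchange [OF admA admB FAB FA0, of k] unfolding N_def by (simp add: funpow_add add.commute [of _ N2])
    have split: "Sum_any (\<lambda>r. l (f (S23 r (S13 n t)) p (q - r)))
        = (if n = 0 then l (f t p q) else 0) + Sum_any (\<lambda>r. l' (f (v (r, n)) p (q - r)))"
      if hom: "\<And>p q. module_hom cscale scale (\<lambda>t. f t p q)"
        and fin: "finite {r. l' (f (v (r, n)) p (q - r)) \<noteq> 0}" for f n p q
    proof -
      have "l (f (S23 r (S13 n t)) p (q - r)) = (if r = 0 \<and> n = 0 then l (f t p q) else 0) + l' (f (v (r, n)) p (q - r))" for r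
        using hom [of p "q - r"] hfun_zero [OF l] module_hom.zero [OF hom]
        by (simp add: u module_hom_iff hfun_add [OF l] l'_def \<delta>_def)
      then have "Sum_any (\<lambda>r. l (f (S23 r (S13 n t)) p (q - r)))
        = Sum_any (\<lambda>r. (if r = 0 \<and> n = 0 then l (f t p q) else 0) + l' (f (v (r, n)) p (q - r)))" by simp
      also have "\<dots> = Sum_any (\<lambda>r::int. if r = 0 \<and> n = 0 then l (f t p q) else 0) + Sum_any (\<lambda>r. l' (f (v (r, n)) p (q - r)))"
        by (rule Sum_any_add [OF _ fin]) (rule finite_subset [of _ "{0}"], auto)
      also have "Sum_any (\<lambda>r::int. if r = 0 \<and> n = 0 then l (f t p q) else 0) = (\<Sum>r\<in>{0::int}. if r = 0 \<and> n = 0 then l (f t p q) else 0)"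
        by (rule Sum_any_eq_sum) auto
      finally show ?thesis by simp
    qed
    obtain p1 where p1: "\<forall>q<p1. \<forall>p. hdvd scale (Suc M) (vertex_product t p q)"
      using vertex_product_lower(1) [OF fin_type_const, where 'a = unit] by blast
    have admt: "expandable (\<lambda>n p q. if n = 0 then l (vertex_product t p q) else 0)"
    proof -
      have "\<exists>p0. \<forall>p<p0. \<forall>n::int. (if n = 0 then l (vertex_product t p q) else 0) = 0" for q
        using vertex_product_lower(2) [OF fin_type_const, where 'a = unit] hfun_hdvd [OF l] by (metis (full_types))
      moreover have "\<forall>n<0. \<forall>p q. (if n = (0::int) then l (vertex_product t p q) else 0) = 0" by simp
      moreover have "\<forall>q<p1. \<forall>n p. (if n = (0::int) then l (vertex_product t p q) else 0) = 0"
        using p1 hfun_hdvd [OF l] by simp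
      ultimately show ?thesis unfolding expandable_def by blast
    qed
    obtain p2 where p2: "\<forall>p<p2. \<forall>q. hdvd scale (Suc M) (vertex_iterate t p q)"
      using vertex_iterate_lower(1) [OF fin_type_const, where 'a = unit] by blast
    have admt': "expandable (\<lambda>n q p. if n = 0 then l (vertex_iterate t p q) else 0)"
    proof -
      have "\<exists>q0. \<forall>q<q0. \<forall>n::int. (if n = 0 then l (vertex_iterate t p q) else 0) = 0" for p
        using vertex_iterate_lower(2) [OF fin_type_const, where 'a = unit] hfun_hdvd [OF l] by (metis (full_types))
      moreover have "\<forall>n<0. \<forall>p q. (if n = (0::int) then l (vertex_iterate t p q) else 0) = 0" by simp
      moreover have "\<forall>p<p2. \<forall>n q. (if n = (0::int) then l (vertex_iterate t p q) else 0) = 0"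
        using p2 hfun_hdvd [OF l] by simp
      ultimately show ?thesis unfolding expandable_def by blast
    qed
    have PA: "expansion 1 (\<lambda>n p q. Sum_any (\<lambda>r. l (vertex_product (S23 r (S13 n t)) p (q - r)))) = (\<lambda>p q. l (vertex_product t p q) + expansion 1 FA p q)"
    proof (intro ext)
      fix p q
      show "expansion 1 (\<lambda>n p q. Sum_any (\<lambda>r. l (vertex_product (S23 r (S13 n t)) p (q - r)))) p q = l (vertex_product t p q) + expansion 1 FA p q"
        unfolding split [of vertex_product, OF vertex_product_hom finA [unfolded fA_def]]
        using expansion_plus [OF admt admA, of 1 p q] unfolding expansion_delta FA_def fA_def .
    qed
    have PB: "expansion' (\<lambda>n p q. Sum_any (\<lambda>r. l (vertex_iterate (S23 r (S13 n t)) p (q - r)))) = (\<lambda>p q. l (vertex_iterate t p q) + expansion' FB p q)"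
    proof (intro ext)
      fix p q
      show "expansion' (\<lambda>n p q. Sum_any (\<lambda>r. l (vertex_iterate (S23 r (S13 n t)) p (q - r)))) p q = l (vertex_iterate t p q) + expansion' FB p q"
        unfolding split [of vertex_iterate, OF vertex_iterate_hom finB [unfolded fB_def]] expansion'_def
        using expansion_plus [OF admt' admB, of 1 q p] unfolding expansion_delta FB_def fB_def .
    qed
    have "(linmul 1 ^^ N) (\<lambda>p q. l (vertex_product t p q) + expansion 1 FA p q) = (linmul 1 ^^ N) (\<lambda>p q. l (vertex_iterate t p q) + expansion' FB p q)"
      using N2 [OF l] unfolding PA PB N_def by (simp add: funpow_add)
    then show "(linmul 1 ^^ N) (\<lambda>p q. l (vertex_product t p q)) = (linmul 1 ^^ N) (\<lambda>p q. l (vertex_iterate t p q))"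
      unfolding linmul_pow_plus using exch by (simp add: fun_eq_iff)
  qed
  then show ?case unfolding t_def by blast
qed

end

theorem proposition1p4:
  fixes scale :: "'k::field_char_0 fps \<Rightarrow> 'v::ab_group_add \<Rightarrow> 'v"
    and \<phi> :: "'v \<Rightarrow> ('b, 'k) cfree"
    and Y :: "('b \<times> 'b, 'k) cfree \<Rightarrow> int \<Rightarrow> 'v"
    and T :: "'v \<Rightarrow> 'v"
    and \<Omega> :: 'v
    and S :: "('b \<times> 'b, 'k) cfree \<Rightarrow> int \<Rightarrow> ('b \<times> 'b, 'k) cfree"
  assumes "quantum_voa scale \<phi> Y T \<Omega> S"
  shows "\<forall>(t :: ('b \<times> 'b \<times> 'b, 'k) cfree) (M :: nat). \<exists>N :: nat. \<forall>p q :: int.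
    hcong scale M
      (binmult scale 1 N
         (\<lambda>p q. hsum scale (\<lambda>m :: nat. scale (fps_const (1 / fact m))
            ((dz scale ^^ m) (Y (Y_right \<phi> Y (q - int m) t)) p)))
         p q)
      (binmult scale 1 N
         (\<lambda>p q. Y (Y_left \<phi> Y p t) q)
         p q)"
proof (intro allI)
  interpret quantum_voa scale \<phi> Y T \<Omega> S by (rule assms)
  fix t :: "('b \<times> 'b \<times> 'b, 'k) cfree" and M :: nat
  have "fin_type M (\<lambda>_::unit. t)" by (rule fin_type_const)
  then obtain N where N: "assoc_mod M N t"
    using assoc_mod_fin_type [OF assoc_mod_basis] by blast
  show "\<exists>N. \<forall>p q. hcong scale M
      (binmult scale 1 N
         (\<lambda>p q. hsum scale (\<lambda>m :: nat. scale (fps_const (1 / fact m))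
            ((dz scale ^^ m) (Y (Y_right \<phi> Y (q - int m) t)) p)))
         p q)
      (binmult scale 1 N
         (\<lambda>p q. Y (Y_left \<phi> Y p t) q)
         p q)"
    unfolding vertex_product_eq vertex_iterate_def [symmetric] hcong_iff_hfun
  proof (intro exI allI impI)
    fix p q l assume l: "hfun scale M l"
    then show "l (binmult scale 1 N (vertex_product t) p q) = l (binmult scale 1 N (vertex_iterate t) p q)"
      using N unfolding assoc_mod_def hfun_binmult [OF l] by simp
  qed
qed

end
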